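(* Let $d\ge5$. Suppose that $V\colon\mathbb{R}^d\to\mathbb{R}$ satisfies $V\in L^1_{\mathrm{loc}}(\mathbb{R}^d)$ and $[x\cdot\nabla V]_+\in L^1_{\mathrm{loc}}(\mathbb{R}^d)$. Moreover, assume that there exists $a\in[0,1)$ such that $$\forall\,\psi\in H^2(\mathbb{R}^d),\qquad\frac14\int_{\mathbb{R}^d}[x\cdot\nabla V]_+|\psi|^2\le a\int_{\mathbb{R}^d}|\Delta\psi|^2.$$ If also $V\in W^{1,d/4}_{\mathrm{loc}}(\mathbb{R}^d)$, then the operator $H_V=\Delta^2+V$ in $L^2(\mathbb{R}^d)$ has no eigenvalues: $\sigma_{\mathrm p}(H_V)=\varnothing$.
   Context: Notation: $[w]_+:=\max\{w,0\}$ is the positive part; $\nabla V$ is the weak gradient. $H_V:=\Delta^2+V$, where $V$ acts by multiplication. The equation $H_Vu=zu$ is understood weakly: $z$ belongs to the point spectrum $\sigma_{\mathrm p}(H_V)$ iff there is a nonzero $u\in H^2(\mathbb{R}^d)$ such that $\int_{\mathbb{R}^d}\Delta u\,\overline{\Delta v}+\int_{\mathbb{R}^d}Vu\,\bar v=z\int_{\mathbb{R}^d}u\,\bar v$ for all compactly supported $v\in H^2(\mathbb{R}^d)$. Since $H_V$ is considered as a self-adjoint operator, $z\in\mathbb{R}$. (The integral with $V$ converges since $V\in L^{d/4}_{\mathrm{loc}}$ and $H^2(\mathbb{R}^d)\subset L^{2d/(d-4)}(\mathbb{R}^d)$.) *)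

theory Defs
  imports "HOL-Analysis.Analysis"
begin

text \<open>
  Elements of Lebesgue and Sobolev spaces are represented by Lebesgue-measurable functions;
  equality almost everywhere is not quotiented out.
\<close>

definition Lp :: "real \<Rightarrow> ('a::euclidean_space \<Rightarrow> 'b::{banach,second_countable_topology}) set" where
  "Lp p = {f. f \<in> borel_measurable lebesgue \<and> integrable lebesgue (\<lambda>x. norm (f x) powr p)}"

definition Lp_loc :: "real \<Rightarrow> ('a::euclidean_space \<Rightarrow> 'b::{banach,second_countable_topology}) set" where
  "Lp_loc p = {f. f \<in> borel_measurable lebesgue \<and>
                  (\<forall>K. compact K \<longrightarrow> set_integrable lebesgue K (\<lambda>x. norm (f x) powr p))}"

abbreviation partial_deriv :: "'a::euclidean_space \<Rightarrow> ('a \<Rightarrow> real) \<Rightarrow> 'a \<Rightarrow> real" where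
  "partial_deriv i f x \<equiv> frechet_derivative f (at x) i"

primrec C_k :: "nat \<Rightarrow> ('a::euclidean_space \<Rightarrow> real) \<Rightarrow> bool" where
  "C_k 0 f \<longleftrightarrow> continuous_on UNIV f"
| "C_k (Suc k) f \<longleftrightarrow> f differentiable_on UNIV \<and> (\<forall>i\<in>Basis. C_k k (partial_deriv i f))"

definition test_fun :: "('a::euclidean_space \<Rightarrow> real) set" where
  "test_fun = {\<phi>. (\<forall>k. C_k k \<phi>) \<and> compact (closure {x. \<phi> x \<noteq> 0})}"

definition has_weak_deriv ::
  "'a::euclidean_space \<Rightarrow> ('a \<Rightarrow> 'b::{banach,second_countable_topology}) \<Rightarrow> ('a \<Rightarrow> 'b) \<Rightarrow> bool" where
  "has_weak_deriv i f g \<longleftrightarrow> f \<in> Lp_loc 1 \<and> g \<in> Lp_loc 1 \<and>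
     (\<forall>\<phi>\<in>test_fun. (LINT x|lebesgue. partial_deriv i \<phi> x *\<^sub>R f x) =
                   - (LINT x|lebesgue. \<phi> x *\<^sub>R g x))"

text \<open>
  The weak partial derivative is unique up to null sets, so \<^term>\<open>weak_deriv\<close> selects a
  representative; it is unspecified if \<^term>\<open>f\<close> has no weak derivative in direction \<^term>\<open>i\<close>.
\<close>

definition weak_deriv ::
  "'a::euclidean_space \<Rightarrow> ('a \<Rightarrow> 'b::{banach,second_countable_topology}) \<Rightarrow> 'a \<Rightarrow> 'b" where
  "weak_deriv i f = (SOME g. has_weak_deriv i f g)"

definition weak_grad :: "('a::euclidean_space \<Rightarrow> real) \<Rightarrow> 'a \<Rightarrow> 'a" where
  "weak_grad f x = (\<Sum>i\<in>Basis. weak_deriv i f x *\<^sub>R i)"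

definition weak_laplacian ::
  "('a::euclidean_space \<Rightarrow> 'b::{banach,second_countable_topology}) \<Rightarrow> 'a \<Rightarrow> 'b" where
  "weak_laplacian f x = (\<Sum>i\<in>Basis. weak_deriv i (weak_deriv i f) x)"

definition W1_loc :: "real \<Rightarrow> ('a::euclidean_space \<Rightarrow> 'b::{banach,second_countable_topology}) set" where
  "W1_loc p = {f \<in> Lp_loc p. \<forall>i\<in>Basis. \<exists>g\<in>Lp_loc p. has_weak_deriv i f g}"

definition H1 :: "('a::euclidean_space \<Rightarrow> 'b::{banach,second_countable_topology}) set" where
  "H1 = {f \<in> Lp 2. \<forall>i\<in>Basis. \<exists>g\<in>Lp 2. has_weak_deriv i f g}"

text \<open>All weak derivatives of order at most two, mixed ones included, are square integrable.\<close>

definition H2 :: "('a::euclidean_space \<Rightarrow> 'b::{banach,second_countable_topology}) set" where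
  "H2 = {f \<in> Lp 2. \<forall>i\<in>Basis. \<exists>g\<in>H1. has_weak_deriv i f g}"

definition essentially_compact_support :: "('a::euclidean_space \<Rightarrow> 'b::real_normed_vector) \<Rightarrow> bool" where
  "essentially_compact_support v \<longleftrightarrow> (\<exists>K. compact K \<and> (AE x in lebesgue. x \<notin> K \<longrightarrow> v x = 0))"

text \<open>
  The operator is the bi-Laplacian plus multiplication by \<^term>\<open>V\<close>, and its eigenvalue equation is
  understood weakly.  Spectral parameters are real, the operator being regarded as self-adjoint.
  The Bochner integral of a non-integrable function is 0, so the integral containing \<^term>\<open>V\<close> is
  meaningful only for suitable \<^term>\<open>V\<close>.  In dimension d at least 5, local d/4-integrability of
  \<^term>\<open>V\<close> suffices, by the Sobolev embedding of H2 into the L^p space with p = 2d/(d-4).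
\<close>

definition eigenfunction :: "('a::euclidean_space \<Rightarrow> real) \<Rightarrow> real \<Rightarrow> ('a \<Rightarrow> complex) \<Rightarrow> bool" where
  "eigenfunction V z u \<longleftrightarrow> u \<in> H2 \<and> \<not> (AE x in lebesgue. u x = 0) \<and>
     (\<forall>v\<in>H2. essentially_compact_support v \<longrightarrow>
        (LINT x|lebesgue. weak_laplacian u x * cnj (weak_laplacian v x))
          + (LINT x|lebesgue. complex_of_real (V x) * u x * cnj (v x))
        = complex_of_real z * (LINT x|lebesgue. u x * cnj (v x)))"

definition point_spectrum :: "('a::euclidean_space \<Rightarrow> real) \<Rightarrow> real set" where
  "point_spectrum V = {z. \<exists>u. eigenfunction V z u}"

end

theory Submission
  imports Defs "HOL-Computational_Algebra.Polynomial"
begin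

text \<open>
  The proof is a virial argument.  Formally, pairing the eigenvalue equation with
  \<open>2 x \<bullet> \<nabla>u + d u\<close> gives \<open>4 \<integral> |\<Delta>u|\<^sup>2 = \<integral> (x \<bullet> \<nabla>V) |u|\<^sup>2\<close>, and the
  assumed inequality bounds the right-hand side by \<open>4 a \<integral> |\<Delta>u|\<^sup>2\<close> with \<open>a < 1\<close>.
  Hence \<open>\<Delta>u = 0\<close>, and a harmonic square integrable function vanishes.

  To make this rigorous, \<open>u\<close> may be taken real-valued.  Let \<open>\<rho>\<close> be an even mollifier, \<open>w = \<rho> * u\<close>
  and \<open>\<eta>\<close> a cut-off function.  The multiplier \<open>\<rho> * (2 \<eta> x \<bullet> \<nabla>w + div(\<eta> x) w)\<close> is an admissible
  test function.  By symmetry of the convolution the bi-Laplacian term becomes an expression in the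
  smooth function \<open>w\<close> alone, containing only derivatives of order at most two, and the spectral term
  is the integral of a divergence.  The potential term differs from \<open>\<integral> V div(\<eta> x w\<^sup>2)\<close> by a
  commutator that vanishes in the limit: by the Sobolev inequality \<open>u\<close>, \<open>\<nabla>u\<close> and \<open>V\<close> lie locally in
  \<open>L\<^sup>p\<close> for \<open>p = 2d/(d-4)\<close>, \<open>2d/(d-2)\<close> and \<open>d/3\<close>, and these exponents are dual to each other.
  All limits are dominated with the help of Young's inequality and of Jensen's inequality
  \<open>|\<rho> * f|\<^sup>p \<le> \<rho> * |f|\<^sup>p\<close>.  Finally the cut-off is removed by scaling.
\<close>

section \<open>Smooth functions and test functions\<close>

text \<open>The obstacle is regularity. For \<open>u\<close> in \<open>H2\<close> the function
  \<open>x \<bullet> \<nabla>u\<close> is locally only once weakly differentiable with square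
  integrable derivatives, so it is no admissible test function, and its Laplacian contains third
  derivatives. The multiplier is therefore built from \<open>w\<close> and mollified once more, and
  symmetry returns the outer mollification to the factors containing \<open>u\<close>. For smooth
  \<open>w\<close> the third derivatives occur only in
  \<open>\<Delta>w (x \<bullet> \<nabla>\<Delta>w)\<close>, half the radial derivative of a square,
  which the term \<open>div(\<eta> x) w\<close> of the multiplier completes to a divergence. The
  same antisymmetry removes \<open>z\<close>, whatever its sign.

  The exponents leave no room. With \<open>V\<close> merely in L^(d/4) the reciprocals for
  \<open>V u \<nabla>u\<close> add up to 4/d + (d-4)/(2d) + (d-2)/(2d) = 1 + 1/d; the weak gradient
  of \<open>V\<close> improves 4/d to 3/d, and the sum becomes 1. For \<open>\<nabla>V u u\<close>
  it is 1 with 4/d. The commutator of \<open>V\<close> with the mollification is therefore not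
  estimated by a rate: multiplying before and after mollifying are shown to have the same
  limit.\<close>

definition pd :: "'a::euclidean_space \<Rightarrow> ('a \<Rightarrow> real) \<Rightarrow> 'a \<Rightarrow> real" where
  "pd i f x = frechet_derivative f (at x) i"

definition smooth :: "('a::euclidean_space \<Rightarrow> real) \<Rightarrow> bool" where
  "smooth f \<longleftrightarrow> (\<forall>k. C_k k f)"

lemma C_k_Suc_pd: "C_k (Suc k) f \<longleftrightarrow> f differentiable_on UNIV \<and> (\<forall>i\<in>Basis. C_k k (pd i f))"
  by (simp add: pd_def[abs_def])

declare C_k.simps(2)[simp del]

lemma C_k_continuous: "C_k k f \<Longrightarrow> continuous_on UNIV f"
  by (cases k) (auto simp: C_k_Suc_pd differentiable_imp_continuous_on)

lemma C_k_lower: "C_k (Suc k) f \<Longrightarrow> C_k k f"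
proof (induction k arbitrary: f)
  case 0
  then show ?case by (simp add: C_k_continuous)
next
  case (Suc k)
  then show ?case unfolding C_k_Suc_pd[of "Suc k"] by (auto simp: C_k_Suc_pd[of k])
qed

lemma C_k_differentiable: "C_k (Suc k) f \<Longrightarrow> f differentiable (at x)"
  by (simp add: C_k_Suc_pd differentiable_on_def)

lemma pd_eqI: "(f has_derivative f') (at x) \<Longrightarrow> pd i f x = f' i"
  by (metis frechet_derivative_at pd_def)

lemma C_k_const: "C_k k (\<lambda>x. c)"
proof (induction k arbitrary: c)
  case (Suc k)
  have "pd i (\<lambda>x::'a. c) = (\<lambda>x. 0)" for i
    by (rule ext, rule pd_eqI) simp
  then show ?case using Suc by (simp add: C_k_Suc_pd)
qed simp

lemma C_k_inner: "C_k k (\<lambda>x. x \<bullet> c)"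
proof (cases k)
  case (Suc n)
  have "pd i (\<lambda>x::'a. x \<bullet> c) = (\<lambda>x. i \<bullet> c)" for i
    by (rule ext, rule pd_eqI) (auto intro!: derivative_eq_intros)
  then show ?thesis using Suc by (simp add: C_k_Suc_pd C_k_const differentiable_on_def)
qed (auto intro!: continuous_intros)

lemma has_derivative_frechet:
  assumes "f differentiable (at x)" shows "(f has_derivative frechet_derivative f (at x)) (at x)"
  using assms frechet_derivative_works by blast

lemma pd_add:
  assumes "f differentiable (at x)" "g differentiable (at x)"
  shows "pd i (\<lambda>x. f x + g x) x = pd i f x + pd i g x"
  unfolding pd_def[of i f] pd_def[of i g]
  by (rule pd_eqI) (use assms has_derivative_frechet in \<open>auto intro!: derivative_intros\<close>)

lemma pd_mult:
  assumes "f differentiable (at x)" "g differentiable (at x)"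
  shows "pd i (\<lambda>x. f x * g x) x = f x * pd i g x + pd i f x * g x"
  unfolding pd_def[of i f] pd_def[of i g]
  by (rule pd_eqI[where f'="\<lambda>h. f x * frechet_derivative g (at x) h + frechet_derivative f (at x) h * g x"])
     (use assms has_derivative_frechet in \<open>auto intro!: has_derivative_mult\<close>)

lemma C_k_add: "C_k k f \<Longrightarrow> C_k k g \<Longrightarrow> C_k k (\<lambda>x. f x + g x)"
proof (induction k arbitrary: f g)
  case (Suc k)
  have "pd i (\<lambda>x. f x + g x) = (\<lambda>x. pd i f x + pd i g x)" for i
    using Suc.prems by (intro ext pd_add C_k_differentiable) auto
  then show ?case using Suc by (auto simp: C_k_Suc_pd differentiable_on_add)
qed (auto intro: continuous_on_add)

lemma C_k_mult: "C_k k f \<Longrightarrow> C_k k g \<Longrightarrow> C_k k (\<lambda>x. f x * g x)"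
proof (induction k arbitrary: f g)
  case (Suc k)
  have "pd i (\<lambda>x. f x * g x) = (\<lambda>x. f x * pd i g x + pd i f x * g x)" for i
    using Suc.prems by (intro ext pd_mult C_k_differentiable) auto
  moreover have "C_k k f" "C_k k g" using Suc.prems C_k_lower by auto
  ultimately show ?case using Suc.IH Suc.prems
    by (auto simp: C_k_Suc_pd differentiable_on_mult intro!: C_k_add)
qed (auto intro: continuous_on_mult)

lemma pd_affine:
  fixes f :: "'a::euclidean_space \<Rightarrow> real"
  assumes "f differentiable (at (c *\<^sub>R x + t))"
  shows "pd i (\<lambda>x. f (c *\<^sub>R x + t)) x = c * pd i f (c *\<^sub>R x + t)"
proof -
  let ?F = "frechet_derivative f (at (c *\<^sub>R x + t))"
  have F: "(f has_derivative ?F) (at (c *\<^sub>R x + t))"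
    by (rule has_derivative_frechet[OF assms])
  have "((\<lambda>x. f (c *\<^sub>R x + t)) has_derivative (\<lambda>h. ?F (c *\<^sub>R h))) (at x)"
    by (rule has_derivative_compose[of "\<lambda>x. c *\<^sub>R x + t" "\<lambda>h. c *\<^sub>R h", OF _ F])
       (auto intro!: derivative_eq_intros)
  moreover have "?F (c *\<^sub>R i) = c * ?F i"
    using linear_scale[OF has_derivative_linear[OF F]] by simp
  ultimately show ?thesis using pd_eqI by (metis pd_def)
qed

lemma C_k_affine:
  fixes f :: "'a::euclidean_space \<Rightarrow> real"
  shows "C_k k f \<Longrightarrow> C_k k (\<lambda>x. f (c *\<^sub>R x + t))"
proof (induction k arbitrary: f)
  case 0
  then have "continuous_on UNIV (f \<circ> (\<lambda>x. c *\<^sub>R x + t))"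
    by (intro continuous_on_compose continuous_intros) (auto intro: continuous_on_subset)
  then show ?case by (simp add: o_def)
next
  case (Suc k)
  have "pd i (\<lambda>x. f (c *\<^sub>R x + t)) = (\<lambda>x. c * pd i f (c *\<^sub>R x + t))" for i
    using Suc.prems by (intro ext pd_affine C_k_differentiable)
  moreover have "(\<lambda>x. f (c *\<^sub>R x + t)) differentiable (at x)" for x
    using differentiable_chain_at[of "\<lambda>x. c *\<^sub>R x + t" x f] C_k_differentiable[OF Suc.prems]
    by (simp add: o_def)
  ultimately show ?case using Suc
    by (auto simp: C_k_Suc_pd differentiable_on_def intro!: C_k_mult C_k_const)
qed

lemma smooth_const [simp, intro]: "smooth (\<lambda>x. c)" by (simp add: smooth_def C_k_const)
lemma smooth_inner [simp, intro]: "smooth (\<lambda>x. x \<bullet> c)" by (simp add: smooth_def C_k_inner)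
lemma smooth_add [intro]: "smooth f \<Longrightarrow> smooth g \<Longrightarrow> smooth (\<lambda>x. f x + g x)"
  by (simp add: smooth_def C_k_add)
lemma smooth_mult [intro]: "smooth f \<Longrightarrow> smooth g \<Longrightarrow> smooth (\<lambda>x. f x * g x)"
  by (simp add: smooth_def C_k_mult)
lemma smooth_affine: "smooth f \<Longrightarrow> smooth (\<lambda>x. f (c *\<^sub>R x + t))"
  by (simp add: smooth_def C_k_affine)
lemma smooth_pd [intro]: "smooth f \<Longrightarrow> i \<in> Basis \<Longrightarrow> smooth (pd i f)"
  using C_k_Suc_pd unfolding smooth_def by blast
lemma smooth_differentiable: "smooth f \<Longrightarrow> f differentiable (at x)"
  using C_k_differentiable smooth_def by blast
lemma smooth_continuous: "smooth f \<Longrightarrow> continuous_on S f"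
  using C_k_continuous smooth_def continuous_on_subset by blast
lemma smooth_measurable: "smooth f \<Longrightarrow> f \<in> borel_measurable borel"
  by (intro borel_measurable_continuous_onI smooth_continuous)
lemma smooth_sum [intro]: "(\<And>i. i \<in> I \<Longrightarrow> smooth (f i)) \<Longrightarrow> smooth (\<lambda>x. \<Sum>i\<in>I. f i x)"
  by (induction I rule: infinite_finite_induct) auto

lemma smooth_pd_add: "smooth f \<Longrightarrow> smooth g \<Longrightarrow> pd i (\<lambda>x. f x + g x) = (\<lambda>x. pd i f x + pd i g x)"
  by (intro ext pd_add smooth_differentiable)
lemma smooth_pd_mult:
  "smooth f \<Longrightarrow> smooth g \<Longrightarrow> pd i (\<lambda>x. f x * g x) = (\<lambda>x. f x * pd i g x + pd i f x * g x)"
  by (intro ext pd_mult smooth_differentiable)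
lemma pd_const [simp]: "pd i (\<lambda>x. c) = (\<lambda>x. 0)"
  by (rule ext, rule pd_eqI) simp
lemma pd_inner [simp]: "pd i (\<lambda>x. x \<bullet> c) = (\<lambda>x. i \<bullet> c)"
  by (rule ext, rule pd_eqI) (auto intro!: derivative_eq_intros)
lemma smooth_pd_sum:
  "(\<And>j. j \<in> I \<Longrightarrow> smooth (f j)) \<Longrightarrow> pd i (\<lambda>x. \<Sum>j\<in>I. f j x) = (\<lambda>x. \<Sum>j\<in>I. pd i (f j) x)"
  by (induction I rule: infinite_finite_induct) (auto simp: smooth_pd_add smooth_sum)
lemma smooth_pd_affine:
  "smooth f \<Longrightarrow> pd i (\<lambda>x. f (c *\<^sub>R x + t)) = (\<lambda>x. c * pd i f (c *\<^sub>R x + t))"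
  by (intro ext pd_affine smooth_differentiable)

lemma smooth_has_derivative:
  assumes "smooth f"
  shows "(f has_derivative (\<lambda>h. \<Sum>i\<in>Basis. (h \<bullet> i) * pd i f x)) (at x)"
proof -
  let ?F = "frechet_derivative f (at x)"
  have F: "(f has_derivative ?F) (at x)"
    by (rule has_derivative_frechet[OF smooth_differentiable[OF assms]])
  have l: "linear ?F" by (rule has_derivative_linear[OF F])
  have "?F h = (\<Sum>i\<in>Basis. (h \<bullet> i) * pd i f x)" for h
    by (subst euclidean_representation[of h, symmetric])
       (simp add: linear_sum[OF l] linear_scale[OF l] pd_def)
  then show ?thesis using F by (metis (no_types, lifting) ext)
qed

lemma smooth_line_derivative:
  assumes "smooth f" "i \<in> Basis"
  shows "((\<lambda>t. f (x + t *\<^sub>R i)) has_real_derivative pd i f (x + t *\<^sub>R i)) (at t)"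
proof -
  have F: "(f has_derivative frechet_derivative f (at (x + t *\<^sub>R i))) (at (x + t *\<^sub>R i))"
    by (rule has_derivative_frechet[OF smooth_differentiable[OF assms(1)]])
  have "((\<lambda>t. f (x + t *\<^sub>R i)) has_derivative (\<lambda>h. frechet_derivative f (at (x + t *\<^sub>R i)) (h *\<^sub>R i))) (at t)"
    by (rule has_derivative_compose[of "\<lambda>t. x + t *\<^sub>R i" "\<lambda>h. h *\<^sub>R i", OF _ F])
       (auto intro!: derivative_eq_intros)
  then show ?thesis unfolding has_field_derivative_def pd_def
    using linear_scale[OF has_derivative_linear[OF F]] by (simp add: mult.commute[of _ "frechet_derivative _ _ _"] mult_commute_abs)
qed

text \<open>The left-hand side is symmetric in \<open>i\<close> and \<open>j\<close>, which yields the symmetry of second derivatives.\<close>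

lemma smooth_second_difference:
  assumes f: "smooth f" and i: "i \<in> Basis" and j: "j \<in> Basis" and h: "h > 0"
  shows "\<exists>s t. 0 < s \<and> s < h \<and> 0 < t \<and> t < h \<and>
     f (x + h *\<^sub>R i + h *\<^sub>R j) - f (x + h *\<^sub>R i) - f (x + h *\<^sub>R j) + f x
       = h * h * pd j (pd i f) (x + s *\<^sub>R i + t *\<^sub>R j)"
proof -
  let ?g = "\<lambda>s. f (x + h *\<^sub>R j + s *\<^sub>R i) - f (x + s *\<^sub>R i)"
  have "(?g has_real_derivative (pd i f (x + h *\<^sub>R j + s *\<^sub>R i) - pd i f (x + s *\<^sub>R i))) (at s)" for s
    by (intro derivative_intros smooth_line_derivative[OF f i])
  from MVT2[OF h this] obtain s where s: "0 < s" "s < h"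
    "?g h - ?g 0 = (h - 0) * (pd i f (x + h *\<^sub>R j + s *\<^sub>R i) - pd i f (x + s *\<^sub>R i))"
    by blast
  let ?k = "\<lambda>t. pd i f (x + s *\<^sub>R i + t *\<^sub>R j)"
  obtain t where t: "0 < t" "t < h" "?k h - ?k 0 = (h - 0) * pd j (pd i f) (x + s *\<^sub>R i + t *\<^sub>R j)"
    using MVT2[OF h smooth_line_derivative[OF smooth_pd[OF f i] j]] by blast
  have "?g h - ?g 0 = h * (h * pd j (pd i f) (x + s *\<^sub>R i + t *\<^sub>R j))"
    using s(3) t(3) by (simp add: add_ac)
  then have "f (x + h *\<^sub>R i + h *\<^sub>R j) - f (x + h *\<^sub>R i) - f (x + h *\<^sub>R j) + f x
       = h * h * pd j (pd i f) (x + s *\<^sub>R i + t *\<^sub>R j)"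
    by (simp add: algebra_simps)
  then show ?thesis using s t by blast
qed

text \<open>One second difference equals \<open>h n * h n\<close> times either mixed derivative,
  evaluated at points that tend to \<open>x\<close> with \<open>h n\<close>. Cancelling the factor
  and passing to the limit by continuity equates the two.\<close>

lemma pd_commute:
  assumes f: "smooth f" and i: "i \<in> Basis" and j: "j \<in> Basis"
  shows "pd i (pd j f) = pd j (pd i f)"
proof (rule ext)
  fix x
  define h :: "nat \<Rightarrow> real" where "h n = inverse (real (Suc n))" for n
  have h0: "h \<longlonglongrightarrow> 0" unfolding h_def by (rule LIMSEQ_inverse_real_of_nat)
  have hp: "h n > 0" for n by (simp add: h_def)
  have "\<exists>s t s' t'. 0 < s \<and> s < h n \<and> 0 < t \<and> t < h n \<and> 0 < s' \<and> s' < h n \<and> 0 < t' \<and> t' < h n \<and>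
     pd j (pd i f) (x + s *\<^sub>R i + t *\<^sub>R j) = pd i (pd j f) (x + s' *\<^sub>R j + t' *\<^sub>R i)" for n
  proof -
    obtain s t where st: "0 < s" "s < h n" "0 < t" "t < h n"
     "f (x + h n *\<^sub>R i + h n *\<^sub>R j) - f (x + h n *\<^sub>R i) - f (x + h n *\<^sub>R j) + f x
       = h n * h n * pd j (pd i f) (x + s *\<^sub>R i + t *\<^sub>R j)"
      using smooth_second_difference[OF f i j hp[of n]] by blast
    obtain s' t' where st': "0 < s'" "s' < h n" "0 < t'" "t' < h n"
     "f (x + h n *\<^sub>R j + h n *\<^sub>R i) - f (x + h n *\<^sub>R j) - f (x + h n *\<^sub>R i) + f x
       = h n * h n * pd i (pd j f) (x + s' *\<^sub>R j + t' *\<^sub>R i)"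
      using smooth_second_difference[OF f j i hp[of n]] by blast
    have "h n * h n * pd j (pd i f) (x + s *\<^sub>R i + t *\<^sub>R j) = h n * h n * pd i (pd j f) (x + s' *\<^sub>R j + t' *\<^sub>R i)"
      using st(5) st'(5) by (simp add: algebra_simps)
    then show ?thesis using st st' hp[of n] by (metis mult_cancel_left mult_eq_0_iff less_irrefl)
  qed
  then obtain s t s' t' where st: "\<And>n. 0 < s n \<and> s n < h n \<and> 0 < t n \<and> t n < h n \<and>
     0 < s' n \<and> s' n < h n \<and> 0 < t' n \<and> t' n < h n \<and>
     pd j (pd i f) (x + s n *\<^sub>R i + t n *\<^sub>R j) = pd i (pd j f) (x + s' n *\<^sub>R j + t' n *\<^sub>R i)"
    by metis
  have lim: "r \<longlonglongrightarrow> 0" if "\<And>n. 0 < r n \<and> r n < h n" for r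
    by (rule tendsto_sandwich[OF _ _ tendsto_const h0]) (use that in \<open>auto intro!: always_eventually less_imp_le\<close>)
  have pt: "(\<lambda>n. x + r n *\<^sub>R a + q n *\<^sub>R b) \<longlonglongrightarrow> x"
    if "\<And>n. 0 < r n \<and> r n < h n" "\<And>n. 0 < q n \<and> q n < h n" for r q and a b :: 'a
  proof -
    have "(\<lambda>n. x + r n *\<^sub>R a + q n *\<^sub>R b) \<longlonglongrightarrow> x + 0 *\<^sub>R a + 0 *\<^sub>R b"
      by (intro tendsto_intros lim that)
    then show ?thesis by simp
  qed
  have c: "isCont (pd a (pd b f)) x" if "a \<in> Basis" "b \<in> Basis" for a b
    using smooth_continuous[OF smooth_pd[OF smooth_pd[OF f that(2)] that(1)]]
    by (metis continuous_on_eq_continuous_at open_UNIV UNIV_I)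
  have "(\<lambda>n. pd j (pd i f) (x + s n *\<^sub>R i + t n *\<^sub>R j)) \<longlonglongrightarrow> pd j (pd i f) x"
    by (rule isCont_tendsto_compose[OF c[OF j i] pt]) (use st in auto)
  moreover have "(\<lambda>n. pd i (pd j f) (x + s' n *\<^sub>R j + t' n *\<^sub>R i)) \<longlonglongrightarrow> pd i (pd j f) x"
    by (rule isCont_tendsto_compose[OF c[OF i j] pt]) (use st in auto)
  ultimately show "pd i (pd j f) x = pd j (pd i f) x"
    using st by (simp add: LIMSEQ_unique)
qed

text \<open>The compact closure in \<open>test_fun\<close> is replaced by a radius beyond which the
  function vanishes, so that support arguments become norm estimates. The two notions agree by
  \<open>test_fun_iff\<close>.\<close>

definition test :: "('a::euclidean_space \<Rightarrow> real) \<Rightarrow> bool" where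
  "test \<phi> \<longleftrightarrow> smooth \<phi> \<and> (\<exists>R. \<forall>x. R < norm x \<longrightarrow> \<phi> x = 0)"

lemma test_fun_iff: "\<phi> \<in> test_fun \<longleftrightarrow> test \<phi>"
proof -
  have "compact (closure {x. \<phi> x \<noteq> 0}) \<longleftrightarrow> (\<exists>R. \<forall>x. R < norm x \<longrightarrow> \<phi> x = 0)"
    unfolding compact_eq_bounded_closed bounded_closure_image
  proof
    assume "bounded (closure {x. \<phi> x \<noteq> 0}) \<and> closed (closure {x. \<phi> x \<noteq> 0})"
    then have "bounded {x. \<phi> x \<noteq> 0}" using bounded_subset closure_subset by blast
    then obtain R where "\<forall>x\<in>{x. \<phi> x \<noteq> 0}. norm x \<le> R" by (auto simp: bounded_iff)
    then show "\<exists>R. \<forall>x. R < norm x \<longrightarrow> \<phi> x = 0" by (intro exI[of _ R]) force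
  next
    assume "\<exists>R. \<forall>x. R < norm x \<longrightarrow> \<phi> x = 0"
    then have "bounded {x. \<phi> x \<noteq> 0}" unfolding bounded_iff by (metis (mono_tags) linorder_not_less mem_Collect_eq)
    then show "bounded (closure {x. \<phi> x \<noteq> 0}) \<and> closed (closure {x. \<phi> x \<noteq> 0})"
      using bounded_closure by simp
  qed
  then show ?thesis by (simp add: test_fun_def test_def smooth_def)
qed

lemma test_smooth: "test f \<Longrightarrow> smooth f" by (simp add: test_def)

lemma test_bound:
  assumes "test f" obtains R where "R > 0" "\<And>x. R < norm x \<Longrightarrow> f x = 0"
proof -
  obtain R where "\<forall>x. R < norm x \<longrightarrow> f x = 0" using assms by (auto simp: test_def)
  then show ?thesis using that[of "max R 1"] by auto
qed

lemma pd_zero_outside: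
  assumes "\<And>x. R < norm x \<Longrightarrow> f x = 0" "R < norm x"
  shows "pd i f x = 0"
proof -
  have "open {y::'a. R < norm y}" by (intro open_Collect_less continuous_intros)
  then have "(f has_derivative (\<lambda>h. 0)) (at x)"
    by (rule has_derivative_transform_within_open[OF has_derivative_const[of 0]]) (use assms in auto)
  then show ?thesis by (rule pd_eqI)
qed

lemma test_pd: "test f \<Longrightarrow> i \<in> Basis \<Longrightarrow> test (pd i f)"
  unfolding test_def using pd_zero_outside by (metis smooth_pd)

lemma test_mult: "test f \<Longrightarrow> smooth g \<Longrightarrow> test (\<lambda>x. f x * g x)"
  unfolding test_def by (auto intro: smooth_mult)
lemma test_mult2: "test f \<Longrightarrow> smooth g \<Longrightarrow> test (\<lambda>x. g x * f x)"
  unfolding test_def by (auto intro: smooth_mult)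
lemma test_add: assumes "test f" "test g" shows "test (\<lambda>x. f x + g x)"
proof -
  obtain R where "\<And>x. R < norm x \<Longrightarrow> f x = 0" using test_bound[OF assms(1)] by blast
  moreover obtain S where "\<And>x. S < norm x \<Longrightarrow> g x = 0" using test_bound[OF assms(2)] by blast
  ultimately show ?thesis unfolding test_def
    using assms by (intro conjI smooth_add exI[of _ "max R S"]) (auto simp: test_def)
qed
lemma test_zero: "test (\<lambda>x. 0)" by (auto simp: test_def)
lemma test_sum: "(\<And>i. i \<in> I \<Longrightarrow> test (f i)) \<Longrightarrow> test (\<lambda>x. \<Sum>i\<in>I. f i x)"
  by (induction I rule: infinite_finite_induct) (auto simp: test_zero test_add)
lemma test_affine:
  assumes "test f" "c \<noteq> 0" shows "test (\<lambda>x. f (c *\<^sub>R x + t))"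
proof -
  obtain R where R: "\<And>x. R < norm x \<Longrightarrow> f x = 0" using test_bound[OF assms(1)] by blast
  have "f (c *\<^sub>R x + t) = 0" if "(R + norm t) / \<bar>c\<bar> < norm x" for x
  proof (rule R)
    have "R + norm t < \<bar>c\<bar> * norm x" using that assms(2) by (simp add: field_simps)
    also have "\<dots> = norm (c *\<^sub>R x + t - t)" by simp
    also have "\<dots> \<le> norm (c *\<^sub>R x + t) + norm t" by (rule norm_triangle_ineq4)
    finally show "R < norm (c *\<^sub>R x + t)" by simp
  qed
  then show ?thesis using assms(1) by (auto simp: test_def intro: smooth_affine)
qed

lemma compact_support_integrable:
  fixes f :: "'a::euclidean_space \<Rightarrow> real"
  assumes "continuous_on UNIV f" "\<And>x. R < norm x \<Longrightarrow> f x = 0"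
  shows "integrable lborel f"
proof -
  have "integrable lborel (\<lambda>x. indicator (cball 0 R) x *\<^sub>R f x)"
    by (rule borel_integrable_compact) (auto intro: continuous_on_subset[OF assms(1)])
  also have "(\<lambda>x. indicator (cball 0 R) x *\<^sub>R f x) = f"
    using assms(2) by (force simp: indicator_def)
  finally show ?thesis .
qed

lemma test_integrable: "test f \<Longrightarrow> integrable lborel f"
  using compact_support_integrable smooth_continuous by (metis test_def)

lemma compact_support_bounded:
  fixes f :: "'a::euclidean_space \<Rightarrow> real"
  assumes "continuous_on UNIV f" "\<And>x. R < norm x \<Longrightarrow> f x = 0"
  obtains C where "C > 0" "\<And>x. \<bar>f x\<bar> \<le> C"
proof -
  have "bounded (f ` cball 0 R)"
    by (intro compact_imp_bounded compact_continuous_image continuous_on_subset[OF assms(1)]) auto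
  then obtain C where "\<forall>x\<in>cball 0 R. \<bar>f x\<bar> \<le> C" by (auto simp: bounded_iff)
  then have "\<bar>f x\<bar> \<le> max C 1" for x
    using assms(2)[of x] by (cases "R < norm x") (auto simp: le_max_iff_disj)
  then show ?thesis using that[of "max C 1"] by auto
qed

lemma test_bounded:
  assumes "test f" obtains C where "C > 0" "\<And>x. \<bar>f x\<bar> \<le> C"
  using assms compact_support_bounded smooth_continuous by (metis test_def)

lemma compact_support_uniformly_continuous:
  fixes f :: "'a::euclidean_space \<Rightarrow> real"
  assumes "continuous_on UNIV f" "\<And>x. R < norm x \<Longrightarrow> f x = 0"
  shows "uniformly_continuous_on UNIV f"
  unfolding uniformly_continuous_on_def
proof (intro allI impI)
  fix e :: real assume "e > 0"
  \<comment> \<open>The margin 1 makes two points at distance less than 1 lie either both in this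
    ball or both where \<open>f\<close> vanishes.\<close>
  have "uniformly_continuous_on (cball 0 (R+1)) f"
    by (intro compact_uniformly_continuous continuous_on_subset[OF assms(1)]) auto
  then obtain d where d: "d > 0"
    "\<And>x y. x \<in> cball 0 (R+1) \<Longrightarrow> y \<in> cball 0 (R+1) \<Longrightarrow> dist y x < d \<Longrightarrow> dist (f y) (f x) < e"
    unfolding uniformly_continuous_on_def using \<open>e > 0\<close> by metis
  have "dist (f y) (f x) < e" if "dist y x < min d 1" for x y
  proof (cases "norm x \<le> R + 1 \<and> norm y \<le> R + 1")
    case True then show ?thesis using d(2) that by auto
  next
    case False
    moreover have "\<bar>norm y - norm x\<bar> < 1" using that norm_triangle_ineq3[of y x] by (auto simp: dist_norm)
    ultimately have "R < norm x" "R < norm y" by auto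
    then show ?thesis using assms(2) \<open>e > 0\<close> by simp
  qed
  then show "\<exists>d>0. \<forall>x\<in>UNIV. \<forall>x'\<in>UNIV. dist x' x < d \<longrightarrow> dist (f x') (f x) < e"
    using d(1) by (intro exI[of _ "min d 1"]) auto
qed

text \<open>The partial derivatives have compact support and are uniformly continuous, so one
  \<open>\<delta>\<close> serves every base point \<open>z\<close>. This uniformity is what allows
  differentiation under the convolution integral.\<close>

lemma test_uniform_taylor:
  fixes \<phi> :: "'a::euclidean_space \<Rightarrow> real"
  assumes "test \<phi>" "e > 0"
  shows "\<exists>\<delta>>0. \<forall>z h. norm h < \<delta> \<longrightarrow> \<bar>\<phi> (z + h) - \<phi> z - (\<Sum>i\<in>Basis. (h \<bullet> i) * pd i \<phi> z)\<bar> \<le> e * norm h"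
proof -
  obtain R where R: "\<And>x. R < norm x \<Longrightarrow> \<phi> x = 0" using test_bound[OF assms(1)] by blast
  define e' where "e' = e / DIM('a)"
  have e': "e' > 0" using assms(2) by (simp add: e'_def)
  have "\<exists>\<delta>>0. \<forall>x y. dist y x < \<delta> \<longrightarrow> dist (pd i \<phi> y) (pd i \<phi> x) < e'" if "i \<in> Basis" for i
  proof -
    have "uniformly_continuous_on UNIV (pd i \<phi>)"
      by (rule compact_support_uniformly_continuous[of _ R])
         (use smooth_continuous[OF smooth_pd[OF test_smooth[OF assms(1)] that]] pd_zero_outside[of R \<phi>] R in auto)
    then show ?thesis using e' unfolding uniformly_continuous_on_def by (metis UNIV_I)
  qed
  then obtain \<delta> where \<delta>: "\<And>i. i \<in> Basis \<Longrightarrow> \<delta> i > 0"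
    "\<And>i x y. i \<in> Basis \<Longrightarrow> dist y x < \<delta> i \<Longrightarrow> dist (pd i \<phi> y) (pd i \<phi> x) < e'" by metis
  define d where "d = Min (\<delta> ` Basis)"
  have d: "d > 0" "\<And>i. i \<in> Basis \<Longrightarrow> d \<le> \<delta> i" unfolding d_def using \<delta>(1) by auto
  have "\<bar>\<phi> (z + h) - \<phi> z - (\<Sum>i\<in>Basis. (h \<bullet> i) * pd i \<phi> z)\<bar> \<le> e * norm h" if h: "norm h < d" for z h
  proof -
    have "norm (\<phi> (z + h) - \<phi> z - (\<lambda>h. \<Sum>i\<in>Basis. (h \<bullet> i) * pd i \<phi> z) (z + h - z)) \<le> norm (z + h - z) * e"
    proof (rule differentiable_bound_linearization[where S="ball z d" and f'="\<lambda>x h. \<Sum>i\<in>Basis. (h \<bullet> i) * pd i \<phi> x"])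
      show "z + t *\<^sub>R (z + h - z) \<in> ball z d" if "t \<in> {0..1}" for t
      proof -
        have "\<bar>t\<bar> * norm h \<le> norm h" using that by (intro mult_left_le_one_le) auto
        then show ?thesis using h by (simp add: dist_norm)
      qed
      show "(\<phi> has_derivative (\<lambda>h. \<Sum>i\<in>Basis. (h \<bullet> i) * pd i \<phi> x)) (at x within ball z d)" for x
        using smooth_has_derivative[OF test_smooth[OF assms(1)]] by (rule has_derivative_at_withinI)
      show "onorm ((\<lambda>h. \<Sum>i\<in>Basis. (h \<bullet> i) * pd i \<phi> x) - (\<lambda>h. \<Sum>i\<in>Basis. (h \<bullet> i) * pd i \<phi> z)) \<le> e"
        if "x \<in> ball z d" for x
      proof (rule onorm_le)
        fix h :: 'a
        have "norm (((\<lambda>h. \<Sum>i\<in>Basis. (h \<bullet> i) * pd i \<phi> x) - (\<lambda>h. \<Sum>i\<in>Basis. (h \<bullet> i) * pd i \<phi> z)) h)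
          = \<bar>\<Sum>i\<in>Basis. (h \<bullet> i) * (pd i \<phi> x - pd i \<phi> z)\<bar>"
          by (simp add: sum_subtractf right_diff_distrib)
        also have "\<dots> \<le> (\<Sum>i\<in>Basis. \<bar>h \<bullet> i\<bar> * \<bar>pd i \<phi> x - pd i \<phi> z\<bar>)"
          by (rule order_trans[OF sum_abs]) (simp add: abs_mult)
        also have "\<dots> \<le> (\<Sum>i\<in>(Basis::'a set). norm h * e')"
        proof (intro sum_mono mult_mono Basis_le_norm)
          fix i :: 'a assume "i \<in> Basis"
          then show "\<bar>pd i \<phi> x - pd i \<phi> z\<bar> \<le> e'"
            using \<delta>(2)[of i x z] that d(2)[of i] by (simp add: dist_norm norm_minus_commute)
        qed auto
        also have "\<dots> = e * norm h" by (simp add: e'_def)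
        finally show "norm (((\<lambda>h. \<Sum>i\<in>Basis. (h \<bullet> i) * pd i \<phi> x) - (\<lambda>h. \<Sum>i\<in>Basis. (h \<bullet> i) * pd i \<phi> z)) h) \<le> e * norm h" .
      qed
      show "z \<in> ball z d" using d by simp
    qed
    then show ?thesis by (simp add: mult.commute)
  qed
  then show ?thesis using d(1) by blast
qed

section \<open>The standard bump function and mollifiers\<close>

definition flat :: "real poly \<Rightarrow> real \<Rightarrow> real" where
  "flat P t = (if t > 0 then poly P (1 / t) * exp (- (1 / t)) else 0)"

lemma poly_times_exp_tendsto_0: "((\<lambda>s. poly P s * exp (- s)) \<longlongrightarrow> (0::real)) at_top"
proof -
  have "((\<lambda>s. \<Sum>i\<le>degree P. coeff P i * (s ^ i / exp s)) \<longlongrightarrow> (\<Sum>i\<le>degree P. coeff P i * 0)) at_top"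
    by (intro tendsto_intros tendsto_power_div_exp_0)
  moreover have "(\<Sum>i\<le>degree P. coeff P i * (s ^ i / exp s)) = poly P s * exp (- s)" for s
    unfolding poly_altdef sum_distrib_right by (intro sum.cong) (simp_all add: exp_minus divide_inverse)
  ultimately show ?thesis by simp
qed

text \<open>The functions P(1/t) exp(-1/t), extended by 0, are closed under differentiation: the
  derivative belongs to the polynomial X^2 (P - P'). At 0 the difference quotient is 0 on the left,
  and on the right it is again a polynomial in 1/t times exp(-1/t), which tends to 0.\<close>

lemma flat_deriv: "(flat P has_real_derivative flat (monom 1 2 * (P - pderiv P)) t) (at t)"
proof -
  consider "t > 0" | "t < 0" | "t = 0" by linarith
  then show ?thesis
  proof cases
    case 1
    have "((\<lambda>t. poly P (1 / t) * exp (- (1 / t))) has_real_derivative flat (monom 1 2 * (P - pderiv P)) t) (at t)"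
      using 1 by (auto intro!: derivative_eq_intros DERIV_chain2[OF poly_DERIV]
          simp: flat_def poly_monom power2_eq_square field_simps)
    then show ?thesis
      by (rule has_field_derivative_transform_within_open[where S="{0<..}"]) (use 1 in \<open>auto simp: flat_def\<close>)
  next
    case 2
    have "((\<lambda>t. 0) has_real_derivative flat (monom 1 2 * (P - pderiv P)) t) (at t)"
      using 2 by (simp add: flat_def)
    then show ?thesis
      by (rule has_field_derivative_transform_within_open[where S="{..<0}"]) (use 2 in \<open>auto simp: flat_def\<close>)
  next
    case 3
    have "((\<lambda>y. flat P y / y) \<longlongrightarrow> 0) (at_left 0)"
      by (rule tendsto_eventually) (auto simp: eventually_at_left_field flat_def intro!: exI[of _ "-1"])
    moreover have "((\<lambda>y. flat P y / y) \<longlongrightarrow> 0) (at_right 0)"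
    proof -
      have "((\<lambda>y. poly (monom 1 1 * P) (inverse y) * exp (- inverse y)) \<longlongrightarrow> (0::real)) (at_right 0)"
        by (rule filterlim_compose[OF poly_times_exp_tendsto_0 filterlim_inverse_at_top_right])
      moreover have "eventually (\<lambda>y. poly (monom 1 1 * P) (inverse y) * exp (- inverse y) = flat P y / y) (at_right 0)"
        by (auto simp: eventually_at_right_field flat_def poly_monom field_simps intro!: exI[of _ 1])
      ultimately show ?thesis by (rule Lim_transform_eventually)
    qed
    ultimately have "((\<lambda>y. flat P y / y) \<longlongrightarrow> 0) (at 0)" by (simp add: filterlim_split_at)
    then show ?thesis using 3 by (simp add: DERIV_def flat_def)
  qed
qed

definition bump :: "'a::euclidean_space \<Rightarrow> real" where
  "bump x = flat 1 (1 - x \<bullet> x)"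

lemma has_derivative_flat_ball:
  "((\<lambda>x::'a::euclidean_space. flat P (1 - x \<bullet> x)) has_derivative
     (\<lambda>h. flat (monom 1 2 * (P - pderiv P)) (1 - x \<bullet> x) * (- 2 * (x \<bullet> h)))) (at x)"
proof -
  have 1: "((\<lambda>x::'a. 1 - x \<bullet> x) has_derivative (\<lambda>h. - 2 * (x \<bullet> h))) (at x)"
    by (auto intro!: derivative_eq_intros simp: inner_commute)
  show ?thesis
    using has_derivative_compose[OF 1 flat_deriv[unfolded has_field_derivative_def]] by simp
qed

lemma smooth_bump: "smooth (bump :: 'a::euclidean_space \<Rightarrow> real)"
proof -
  \<comment> \<open>Generalised over \<open>P\<close>, since a partial derivative is a linear factor
    times the same expression for another polynomial.\<close>
  have "C_k k (\<lambda>x::'a. flat P (1 - x \<bullet> x))" for k P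
  proof (induction k arbitrary: P)
    case 0
    have "(\<lambda>x::'a. flat P (1 - x \<bullet> x)) differentiable_on UNIV"
      using has_derivative_flat_ball unfolding differentiable_on_def differentiable_def by blast
    then show ?case by (simp add: differentiable_imp_continuous_on)
  next
    case (Suc k)
    have "pd i (\<lambda>x::'a. flat P (1 - x \<bullet> x))
        = (\<lambda>x. flat (monom 1 2 * (P - pderiv P)) (1 - x \<bullet> x) * (x \<bullet> (- 2 *\<^sub>R i)))" for i
      by (intro ext, subst pd_eqI[OF has_derivative_flat_ball]) simp
    moreover have "(\<lambda>x::'a. flat P (1 - x \<bullet> x)) differentiable_on UNIV"
      using has_derivative_flat_ball unfolding differentiable_on_def differentiable_def by blast
    moreover have "C_k k (\<lambda>x. flat (monom 1 2 * (P - pderiv P)) (1 - x \<bullet> x) * (x \<bullet> (- 2 *\<^sub>R i)))" for i :: 'a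
      by (rule C_k_mult[OF Suc C_k_inner])
    ultimately show ?case
      unfolding C_k_Suc_pd by simp
  qed
  then show ?thesis by (simp add: smooth_def bump_def[abs_def])
qed

lemma bump_nonneg: "bump x \<ge> 0" by (simp add: bump_def flat_def)
lemma bump_pos: "norm x < 1 \<Longrightarrow> bump x > 0"
  by (simp add: bump_def flat_def dot_square_norm abs_square_less_1)
lemma bump_zero: "1 \<le> norm x \<Longrightarrow> bump x = 0"
  by (simp add: bump_def flat_def dot_square_norm not_less one_le_power)

lemma test_bump: "test bump"
  unfolding test_def using smooth_bump by (intro conjI exI[of _ 1] allI impI bump_zero) auto

text \<open>A vanishing integral would force \<open>bump\<close> to be 0 almost everywhere, whereas
  it is positive on the unit ball, which has positive measure.\<close>

lemma integral_bump_pos: "(LINT x|lborel. bump (x::'a::euclidean_space)) > 0"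
proof -
  have "(LINT x|lborel. bump (x::'a)) \<noteq> 0"
  proof
    assume "(LINT x|lborel. bump (x::'a)) = 0"
    then have "AE x in lborel. bump (x::'a) = 0"
      using integral_nonneg_eq_0_iff_AE[OF test_integrable[OF test_bump]] bump_nonneg by auto
    then have "AE x::'a in lborel. x \<notin> ball 0 1" by eventually_elim (use bump_pos in force)
    then have "emeasure lborel (ball (0::'a) 1) = 0"
      by (subst (asm) AE_iff_measurable[OF _ refl]) (auto simp: ball_def)
    then show False using content_ball_pos[of 1 "0::'a"]
      by (simp add: emeasure_lborel_ball_finite measure_def)
  qed
  moreover have "(LINT x|lborel. bump (x::'a)) \<ge> 0" by (simp add: bump_nonneg)
  ultimately show ?thesis by linarith
qed

definition moll :: "real \<Rightarrow> 'a::euclidean_space \<Rightarrow> real" where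
  "moll e x = bump ((1/e) *\<^sub>R x) / (e ^ DIM('a) * (LINT y|lborel. bump (y::'a)))"

lemma test_moll: "e > 0 \<Longrightarrow> test (moll e)"
  using test_mult[OF test_affine[OF test_bump, of "1/e" 0] smooth_const]
  by (simp add: moll_def[abs_def] divide_inverse)

lemma moll_nonneg: "e > 0 \<Longrightarrow> moll e x \<ge> 0"
  using integral_bump_pos by (auto simp: moll_def bump_nonneg intro!: divide_nonneg_pos)

lemma moll_zero: "e > 0 \<Longrightarrow> e \<le> norm x \<Longrightarrow> moll e x = 0"
  by (simp add: moll_def bump_zero field_simps)

lemma moll_even: "moll e (- x) = moll e x"
  by (simp add: moll_def bump_def)

lemma integral_lborel_affine:
  fixes f :: "'a::euclidean_space \<Rightarrow> real"
  assumes "c \<noteq> 0" "f \<in> borel_measurable borel"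
  shows "(LINT x|lborel. f (t + c *\<^sub>R x)) = (LINT x|lborel. f x) / \<bar>c\<bar> ^ DIM('a)"
proof -
  have "(LINT x|lborel. f x) = (LINT x|lborel. \<bar>c\<bar> ^ DIM('a) * f (t + c *\<^sub>R x))"
    by (subst lborel_affine[OF assms(1), of t]) (use assms(2) in \<open>simp add: integral_density integral_distr\<close>)
  then show ?thesis using assms(1) by simp
qed

lemma integral_lborel_reflect:
  fixes f :: "'a::euclidean_space \<Rightarrow> real"
  assumes "f \<in> borel_measurable borel"
  shows "(LINT x|lborel. f (t - x)) = (LINT x|lborel. f x)"
  using integral_lborel_affine[of "-1" f t] assms by simp

lemma integral_moll: "e > 0 \<Longrightarrow> (LINT x|lborel. moll e x) = 1"
  using integral_lborel_affine[of "1/e" "bump :: 'a \<Rightarrow> real" 0] integral_bump_pos[where 'a='a]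
  by (simp add: moll_def smooth_measurable smooth_bump power_divide)

section \<open>Convolution of test functions with locally integrable functions\<close>

definition conv :: "('a::euclidean_space \<Rightarrow> real) \<Rightarrow> ('a \<Rightarrow> real) \<Rightarrow> 'a \<Rightarrow> real" where
  "conv k f x = (LINT y|lborel. k (x - y) * f y)"

text \<open>Integrability is tested on centred balls only; they absorb every compact set and fit the
  radii used for supports.\<close>

definition loc1 :: "('a::euclidean_space \<Rightarrow> real) \<Rightarrow> bool" where
  "loc1 f \<longleftrightarrow> f \<in> borel_measurable borel \<and> (\<forall>R. integrable lborel (\<lambda>x. indicator (cball 0 R) x * f x))"

lemma loc1_measurable [measurable_dest]: "loc1 f \<Longrightarrow> f \<in> borel_measurable borel"
  by (simp add: loc1_def)

lemma loc1_integrable: "loc1 f \<Longrightarrow> integrable lborel (\<lambda>x. indicator (cball 0 R) x * f x)"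
  by (simp add: loc1_def)

lemma loc1_abs: "loc1 f \<Longrightarrow> loc1 (\<lambda>x. \<bar>f x\<bar>)"
  unfolding loc1_def using integrable_abs[of lborel "\<lambda>x. indicator (cball 0 _) x * f x"] by (auto simp: abs_mult)

lemma loc1_bounded_support:
  fixes g :: "'a::euclidean_space \<Rightarrow> real"
  assumes f: "loc1 f" and [measurable]: "g \<in> borel_measurable borel"
    and C: "\<And>x. \<bar>g x\<bar> \<le> C" and R: "\<And>x. R < norm x \<Longrightarrow> g x = 0"
  shows "integrable lborel (\<lambda>x. g x * f x)"
proof (rule Bochner_Integration.integrable_bound)
  note [measurable] = loc1_measurable[OF f]
  show "integrable lborel (\<lambda>x. C * (indicator (cball 0 R) x * f x))"
    using loc1_integrable[OF f] by simp
  show "(\<lambda>x. g x * f x) \<in> borel_measurable lborel" by simp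
  have "C \<ge> 0" using C[of 0] by linarith
  then show "AE x in lborel. norm (g x * f x) \<le> norm (C * (indicator (cball 0 R) x * f x))"
    using C R by (intro always_eventually) (auto simp: indicator_def abs_mult intro!: mult_right_mono)
qed

lemma test_integrable_loc1:
  assumes "test \<phi>" "loc1 f" shows "integrable lborel (\<lambda>x. \<phi> x * f x)"
proof -
  obtain R where "\<And>x. R < norm x \<Longrightarrow> \<phi> x = 0" using test_bound[OF assms(1)] by blast
  moreover obtain C where "\<And>x. \<bar>\<phi> x\<bar> \<le> C" using test_bounded[OF assms(1)] by blast
  ultimately show ?thesis
    using assms by (intro loc1_bounded_support smooth_measurable) (auto simp: test_smooth)
qed

lemma test_reflect: "test \<phi> \<Longrightarrow> test (\<lambda>y. \<phi> (x - y))"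
  using test_affine[of \<phi> "-1" x] by (simp add: add.commute[of _ x])

lemma conv_integrable: "test \<phi> \<Longrightarrow> loc1 f \<Longrightarrow> integrable lborel (\<lambda>y. \<phi> (x - y) * f y)"
  by (intro test_integrable_loc1 test_reflect)

text \<open>The Taylor error of \<open>\<phi>\<close> is small uniformly in the base point, and the
  integrand lives on a fixed ball, so the error integrates to at most \<open>e * norm h\<close>
  without any limit theorem.\<close>

lemma conv_has_derivative:
  fixes f :: "'a::euclidean_space \<Rightarrow> real"
  assumes \<phi>: "test \<phi>" and f: "loc1 f"
  shows "(conv \<phi> f has_derivative (\<lambda>h. \<Sum>i\<in>Basis. (h \<bullet> i) * conv (pd i \<phi>) f x)) (at x)"
  unfolding has_derivative_at_alt
proof (intro conjI allI impI)
  show "bounded_linear (\<lambda>h. \<Sum>i\<in>Basis. (h \<bullet> i) * conv (pd i \<phi>) f x)"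
    by (intro bounded_linear_sum bounded_linear_mult_const bounded_linear_inner_left)
next
  fix e :: real assume e: "0 < e"
  obtain R where R: "R > 0" "\<And>x. R < norm x \<Longrightarrow> \<phi> x = 0" using test_bound[OF \<phi>] by blast
  \<comment> \<open>The ball contains the support of \<open>\<lambda>y. \<phi> (x' - y)\<close> for
    every \<open>x'\<close> within distance 1 of \<open>x\<close>, so \<open>M\<close> does not
    depend on the increment.\<close>
  let ?B = "cball (0::'a) (norm x + R + 1)"
  let ?g = "\<lambda>y. indicator ?B y * \<bar>f y\<bar>"
  define M where "M = (LINT y|lborel. ?g y)"
  have M0: "M \<ge> 0" unfolding M_def by simp
  have ig: "integrable lborel ?g" by (rule loc1_integrable[OF loc1_abs[OF f]])
  \<comment> \<open>The denominator is \<open>M + 1\<close> because \<open>M\<close> may be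
    0.\<close>
  obtain \<delta> where \<delta>: "\<delta> > 0" "\<And>z h. norm h < \<delta> \<Longrightarrow>
      \<bar>\<phi> (z + h) - \<phi> z - (\<Sum>i\<in>Basis. (h \<bullet> i) * pd i \<phi> z)\<bar> \<le> e / (M + 1) * norm h"
    using test_uniform_taylor[OF \<phi>, of "e / (M + 1)"] e M0 by auto
  show "\<exists>d>0. \<forall>y. norm (y - x) < d \<longrightarrow>
      norm (conv \<phi> f y - conv \<phi> f x - (\<Sum>i\<in>Basis. ((y - x) \<bullet> i) * conv (pd i \<phi>) f x)) \<le> e * norm (y - x)"
  proof (intro exI[of _ "min \<delta> 1"] conjI allI impI)
    fix x' assume x': "norm (x' - x) < min \<delta> 1"
    define h where "h = x' - x"
    let ?T = "\<lambda>y. \<phi> (x - y + h) - \<phi> (x - y) - (\<Sum>i\<in>Basis. (h \<bullet> i) * pd i \<phi> (x - y))"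
    have i1: "integrable lborel (\<lambda>y. \<phi> (x' - y) * f y)" "integrable lborel (\<lambda>y. \<phi> (x - y) * f y)"
      by (rule conv_integrable[OF \<phi> f])+
    have i2: "integrable lborel (\<lambda>y. pd i \<phi> (x - y) * f y)" if "i \<in> Basis" for i
      by (rule conv_integrable[OF test_pd[OF \<phi> that] f])
    have eq: "?T y * f y = \<phi> (x' - y) * f y - \<phi> (x - y) * f y - (\<Sum>i\<in>Basis. (h \<bullet> i) * (pd i \<phi> (x - y) * f y))" for y
      by (simp add: h_def algebra_simps sum_distrib_left)
    have iT: "integrable lborel (\<lambda>y. ?T y * f y)"
      unfolding eq using i1 i2 by (intro Bochner_Integration.integrable_diff Bochner_Integration.integrable_sum integrable_mult_right) auto
    have "conv \<phi> f x' - conv \<phi> f x - (\<Sum>i\<in>Basis. (h \<bullet> i) * conv (pd i \<phi>) f x) = (LINT y|lborel. ?T y * f y)"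
      unfolding eq conv_def using i1 i2
      by (simp add: Bochner_Integration.integral_diff Bochner_Integration.integral_sum)
    also have "norm \<dots> \<le> (LINT y|lborel. (e / (M + 1) * norm h) * ?g y)"
    proof (rule Bochner_Integration.integral_norm_bound_integral)
      show "integrable lborel (\<lambda>y. (e / (M + 1) * norm h) * ?g y)" using ig by simp
      fix y
      show "norm (?T y * f y) \<le> (e / (M + 1) * norm h) * ?g y"
      proof (cases "y \<in> ?B")
        case True
        have "norm h < \<delta>" using x' by (simp add: h_def)
        then have "\<bar>?T y\<bar> * \<bar>f y\<bar> \<le> (e / (M + 1) * norm h) * \<bar>f y\<bar>"
          by (intro mult_right_mono \<delta>(2)) auto
        with True show ?thesis by (simp only: real_norm_def abs_mult indicator_simps mult_1)
      next
        case False
        then have y: "norm x + R + 1 < norm y" by simp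
        have "norm y \<le> norm (x - y) + norm x" using norm_triangle_ineq4[of x "x - y"] by simp
        with y have 1: "R + 1 < norm (x - y)" by simp
        have "norm (x - y) \<le> norm (x - y + h) + norm h" using norm_triangle_ineq4[of "x - y + h" h] by simp
        with 1 x' have "R < norm (x - y + h)" by (simp add: h_def)
        then have "?T y = 0" using R(2) 1 pd_zero_outside[of R \<phi> "x - y"] by simp
        then show ?thesis using False by simp
      qed
    qed (rule iT)
    also have "\<dots> = e / (M + 1) * norm h * M" by (simp add: M_def)
    also have "\<dots> \<le> e * norm h"
    proof -
      have "e / (M + 1) * M \<le> e" using e M0 by (simp add: field_simps)
      then show ?thesis using mult_right_mono[of "e / (M + 1) * M" e "norm h"] by (simp add: mult_ac)
    qed
    finally show "norm (conv \<phi> f x' - conv \<phi> f x - (\<Sum>i\<in>Basis. ((x' - x) \<bullet> i) * conv (pd i \<phi>) f x)) \<le> e * norm (x' - x)"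
      by (simp add: h_def)
  qed (use \<delta> in auto)
qed

lemma conv_pd:
  assumes "test \<phi>" "loc1 f" "i \<in> Basis"
  shows "pd i (conv \<phi> f) = conv (pd i \<phi>) f"
proof (rule ext)
  fix x
  have "pd i (conv \<phi> f) x = (\<Sum>j\<in>Basis. (i \<bullet> j) * conv (pd j \<phi>) f x)"
    by (rule pd_eqI[OF conv_has_derivative[OF assms(1,2)]])
  also have "\<dots> = (\<Sum>j\<in>Basis. if j = i then conv (pd j \<phi>) f x else 0)"
    using assms(3) by (intro sum.cong) (auto simp: inner_Basis)
  finally show "pd i (conv \<phi> f) x = conv (pd i \<phi>) f x" using assms(3) by simp
qed

lemma conv_smooth:
  assumes "test \<phi>" "loc1 f"
  shows "smooth (conv \<phi> f)"
proof -
  have "C_k k (conv \<phi> f)" if "test \<phi>" for k \<phi> using that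
  proof (induction k arbitrary: \<phi>)
    case 0
    have "isCont (conv \<phi> f) x" for x
      using conv_has_derivative[OF 0 assms(2)] has_derivative_continuous by blast
    then show ?case by (simp add: continuous_at_imp_continuous_on)
  next
    case (Suc k)
    have "conv \<phi> f differentiable (at x)" for x
      using conv_has_derivative[OF Suc.prems assms(2)] by (auto simp: differentiable_def)
    then show ?case unfolding C_k_Suc_pd
      using Suc.IH[OF test_pd[OF Suc.prems]] conv_pd[OF Suc.prems assms(2)]
      by (auto simp: differentiable_on_def intro: differentiable_at_withinI)
  qed
  then show ?thesis using assms(1) by (simp add: smooth_def)
qed

lemma conv_compact_support:
  assumes "\<And>x. R < norm x \<Longrightarrow> \<phi> x = 0" "\<And>x. S < norm x \<Longrightarrow> f x = 0" "R + S < norm x"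
  shows "conv \<phi> f x = 0"
proof -
  have "\<phi> (x - y) * f y = 0" for y
  proof (cases "S < norm y")
    case False
    then have "R < norm (x - y)" using assms(3) norm_triangle_ineq[of "x - y" y] by simp
    then show ?thesis using assms(1) by simp
  qed (use assms(2) in simp)
  then show ?thesis unfolding conv_def by (simp only: integral_zero)
qed

lemma loc1_continuous: 
  assumes "continuous_on UNIV f" shows "loc1 f"
  unfolding loc1_def
proof (intro conjI allI)
  show "integrable lborel (\<lambda>x. indicator (cball 0 R) x * f x)" for R
    using borel_integrable_compact[of "cball 0 R" f] continuous_on_subset[OF assms] by auto
qed (rule borel_measurable_continuous_onI[OF assms])

lemma test_loc1: "test \<phi> \<Longrightarrow> loc1 \<phi>"
  by (intro loc1_continuous smooth_continuous test_smooth)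

lemma test_conv: assumes "test \<phi>" "test g" shows "test (conv \<phi> g)"
proof -
  obtain R where "\<And>x. R < norm x \<Longrightarrow> \<phi> x = 0" using test_bound[OF assms(1)] by blast
  moreover obtain S where "\<And>x. S < norm x \<Longrightarrow> g x = 0" using test_bound[OF assms(2)] by blast
  ultimately have "conv \<phi> g x = 0" if "R + S < norm x" for x using conv_compact_support that by blast
  then show ?thesis using conv_smooth[OF assms(1) test_loc1[OF assms(2)]] by (auto simp: test_def)
qed

section \<open>Weak derivatives and mollification\<close>

text \<open>Convolution of \<open>\<phi>\<close> with the constant 1 is the constant function with
  value the integral of \<open>\<phi>\<close>. Its derivative is 0, and it is also the convolution
  of \<open>pd i \<phi>\<close> with 1.\<close>

lemma integral_pd_zero:
  fixes \<phi> :: "'a::euclidean_space \<Rightarrow> real"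
  assumes "test \<phi>" "i \<in> Basis"
  shows "(LINT x|lborel. pd i \<phi> x) = 0"
proof -
  have refl: "(LINT y|lborel. \<psi> (x - y)) = (LINT y|lborel. \<psi> y)" if "test \<psi>" for \<psi> and x :: 'a
    by (rule integral_lborel_reflect[OF smooth_measurable[OF test_smooth[OF that]]])
  have "pd i (conv \<phi> (\<lambda>_. 1)) = conv (pd i \<phi>) (\<lambda>_. 1)"
    by (rule conv_pd[OF assms(1) loc1_continuous assms(2)]) simp
  moreover have "conv \<phi> (\<lambda>_. 1) = (\<lambda>_. LINT y|lborel. \<phi> y)"
    by (rule ext) (simp add: conv_def refl[OF assms(1)])
  moreover have "conv (pd i \<phi>) (\<lambda>_. 1) 0 = (LINT y|lborel. pd i \<phi> y)"
    using refl[OF test_pd[OF assms], of 0] by (simp add: conv_def)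
  ultimately show ?thesis by (metis pd_const)
qed

text \<open>The counterpart of \<open>has_weak_deriv\<close> for real Borel functions and
  \<open>lborel\<close>, on which the analysis runs; \<open>has_weak_deriv_wd\<close> leads from one
  to the other.\<close>

definition wd :: "'a::euclidean_space \<Rightarrow> ('a \<Rightarrow> real) \<Rightarrow> ('a \<Rightarrow> real) \<Rightarrow> bool" where
  "wd i f g \<longleftrightarrow> loc1 f \<and> loc1 g \<and>
     (\<forall>\<phi>. test \<phi> \<longrightarrow> (LINT x|lborel. pd i \<phi> x * f x) = - (LINT x|lborel. \<phi> x * g x))"

lemma smooth_wd:
  assumes "smooth f" "i \<in> Basis" shows "wd i f (pd i f)"
  unfolding wd_def
proof (intro conjI allI impI loc1_continuous smooth_continuous)
  show "smooth f" "smooth (pd i f)" using assms by auto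
  fix \<phi> :: "'a \<Rightarrow> real" assume \<phi>: "test \<phi>"
  have l: "loc1 f" "loc1 (pd i f)" using assms by (auto intro!: loc1_continuous smooth_continuous)
  have "(LINT x|lborel. pd i (\<lambda>x. \<phi> x * f x) x) = 0"
    by (rule integral_pd_zero[OF test_mult[OF \<phi> assms(1)] assms(2)])
  then show "(LINT x|lborel. pd i \<phi> x * f x) = - (LINT x|lborel. \<phi> x * pd i f x)"
    using test_integrable_loc1[OF \<phi> l(2)] test_integrable_loc1[OF test_pd[OF \<phi> assms(2)] l(1)]
    by (simp add: smooth_pd_mult test_smooth[OF \<phi>] assms(1))
qed

text \<open>For fixed \<open>x\<close> the kernel \<open>\<lambda>y. \<phi> (x - y)\<close> is a
  test function. Reflection contributes a minus sign to its derivative, which cancels the one in the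
  definition of the weak derivative.\<close>

lemma conv_wd:
  assumes w: "wd i f g" and \<phi>: "test \<phi>" and i: "i \<in> Basis"
  shows "conv (pd i \<phi>) f = conv \<phi> g" "pd i (conv \<phi> f) = conv \<phi> g"
proof -
  show *: "conv (pd i \<phi>) f = conv \<phi> g"
  proof (rule ext)
    fix x
    have "pd i (\<lambda>y. \<phi> ((-1) *\<^sub>R y + x)) = (\<lambda>y. (-1) * pd i \<phi> ((-1) *\<^sub>R y + x))"
      by (rule smooth_pd_affine[OF test_smooth[OF \<phi>]])
    then have p: "pd i (\<lambda>y. \<phi> (x - y)) = (\<lambda>y. - pd i \<phi> (x - y))" by simp
    have "(LINT y|lborel. pd i (\<lambda>y. \<phi> (x - y)) y * f y) = - (LINT y|lborel. \<phi> (x - y) * g y)"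
      using w test_reflect[OF \<phi>] by (simp add: wd_def)
    then show "conv (pd i \<phi>) f x = conv \<phi> g x" unfolding p conv_def by simp
  qed
  show "pd i (conv \<phi> f) = conv \<phi> g" using conv_pd[OF \<phi> _ i, of f] w * by (simp add: wd_def)
qed

lemma conv_pd_test:
  assumes "test \<phi>" "smooth g" "i \<in> Basis"
  shows "pd i (conv \<phi> g) = conv \<phi> (pd i g)"
  by (rule conv_wd(2)[OF smooth_wd[OF assms(2,3)] assms(1,3)])

lemma integrable_product_lborel:
  fixes f g :: "'a::euclidean_space \<Rightarrow> real"
  assumes f: "integrable lborel f" and g: "integrable lborel g"
  shows "integrable (lborel \<Otimes>\<^sub>M lborel) (\<lambda>(x, y). f x * g y)"
proof (rule lborel_pair.Fubini_integrable)
  note [measurable] = borel_measurable_integrable[OF f] borel_measurable_integrable[OF g]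
  show "(\<lambda>(x, y). f x * g y) \<in> borel_measurable (lborel \<Otimes>\<^sub>M lborel)" by measurable
  show "integrable lborel (\<lambda>x. LINT y|lborel. norm (case (x, y) of (x, y) \<Rightarrow> f x * g y))"
    using f by (simp add: abs_mult)
  show "AE x in lborel. integrable lborel (\<lambda>y. case (x, y) of (x, y) \<Rightarrow> f x * g y)"
    using g by simp
qed

text \<open>Fubini's theorem, with evenness identifying the two kernels. As \<open>f\<close> is only
  locally integrable, integrability on the product rests on \<open>\<phi> (x - y) * g x\<close>
  being 0 unless \<open>norm y \<le> R + S\<close>.\<close>

lemma conv_symmetric:
  fixes f g :: "'a::euclidean_space \<Rightarrow> real"
  assumes \<phi>: "test \<phi>" and even: "\<And>x. \<phi> (- x) = \<phi> x" and f: "loc1 f" and g: "test g"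
  shows "(LINT x|lborel. conv \<phi> f x * g x) = (LINT x|lborel. f x * conv \<phi> g x)"
proof -
  obtain R where R: "\<And>x. R < norm x \<Longrightarrow> \<phi> x = 0" using test_bound[OF \<phi>] by blast
  obtain S where S: "\<And>x. S < norm x \<Longrightarrow> g x = 0" using test_bound[OF g] by blast
  obtain C where C: "C > 0" "\<And>x. \<bar>\<phi> x\<bar> \<le> C" using test_bounded[OF \<phi>] by blast
  note [measurable] = smooth_measurable[OF test_smooth[OF \<phi>]] smooth_measurable[OF test_smooth[OF g]]
    loc1_measurable[OF f]
  let ?F = "\<lambda>(x, y). \<phi> (x - y) * f y * g x"
  have "integrable (lborel \<Otimes>\<^sub>M lborel) (\<lambda>(x, y). (C * g x) * (indicator (cball 0 (R + S)) y * f y))"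
    by (rule integrable_product_lborel) (use test_integrable[OF g] loc1_integrable[OF f] in auto)
  then have "integrable (lborel \<Otimes>\<^sub>M lborel) ?F"
  proof (rule Bochner_Integration.integrable_bound)
    show "?F \<in> borel_measurable (lborel \<Otimes>\<^sub>M lborel)" by measurable
    have "\<bar>\<phi> (x - y) * f y * g x\<bar> \<le> \<bar>(C * g x) * (indicator (cball 0 (R + S)) y * f y)\<bar>" for x y
    proof (cases "S < norm x \<or> R < norm (x - y)")
      case True then show ?thesis using S[of x] R[of "x - y"] by auto
    next
      case False
      then have "norm y \<le> R + S" using norm_triangle_ineq4[of x "x - y"] by simp
      then show ?thesis using C(1) mult_right_mono[OF C(2)[of "x - y"], of "\<bar>f y\<bar> * \<bar>g x\<bar>"]
        by (simp add: abs_mult mult_ac)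
    qed
    then show "AE z in lborel \<Otimes>\<^sub>M lborel. norm (?F z)
        \<le> norm (case z of (x, y) \<Rightarrow> (C * g x) * (indicator (cball 0 (R + S)) y * f y))"
      by (intro always_eventually) (auto simp: split_beta)
  qed
  then have "(LINT y|lborel. LINT x|lborel. \<phi> (x - y) * f y * g x) = (LINT x|lborel. LINT y|lborel. \<phi> (x - y) * f y * g x)"
    by (rule lborel_pair.Fubini_integral)
  moreover have "(LINT x|lborel. \<phi> (x - y) * f y * g x) = f y * conv \<phi> g y" for y
  proof -
    have "(LINT x|lborel. \<phi> (x - y) * f y * g x) = (LINT x|lborel. f y * (\<phi> (y - x) * g x))"
      using even[of "y - _"] by (intro Bochner_Integration.integral_cong) (auto simp: mult_ac)
    then show ?thesis by (simp add: conv_def)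
  qed
  ultimately show ?thesis by (simp add: conv_def)
qed

text \<open>The width of the mollifier never exceeds 1, even for \<open>n = 0\<close>, so on a ball
  of radius \<open>R\<close> the mollification depends on \<open>f\<close> only within radius
  \<open>R + 1\<close>.\<close>

definition mo :: "nat \<Rightarrow> ('a::euclidean_space \<Rightarrow> real) \<Rightarrow> 'a \<Rightarrow> real" where
  "mo n f = conv (moll (1 / (real n + 1))) f"

lemma moll_n: "test (moll (1 / (real n + 1)))" by (rule test_moll) simp

lemma mo_smooth: "loc1 f \<Longrightarrow> smooth (mo n f)" unfolding mo_def by (intro conv_smooth moll_n)
lemma mo_test: "test g \<Longrightarrow> test (mo n g)" unfolding mo_def by (intro test_conv moll_n)
lemma mo_wd: "wd i f g \<Longrightarrow> i \<in> Basis \<Longrightarrow> pd i (mo n f) = mo n g"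
  unfolding mo_def by (intro conv_wd moll_n)
lemma mo_pd: "smooth g \<Longrightarrow> i \<in> Basis \<Longrightarrow> pd i (mo n g) = mo n (pd i g)"
  unfolding mo_def by (intro conv_pd_test moll_n)
lemma mo_symmetric: "loc1 f \<Longrightarrow> test g \<Longrightarrow>
    (LINT x|lborel. mo n f x * g x) = (LINT x|lborel. f x * mo n g x)"
  unfolding mo_def by (intro conv_symmetric moll_n moll_even)
lemma mo_measurable: "loc1 f \<Longrightarrow> mo n f \<in> borel_measurable borel"
  by (intro smooth_measurable mo_smooth)
lemma mo_integrable: "loc1 f \<Longrightarrow> integrable lborel (\<lambda>y. moll (1 / (real n + 1)) (x - y) * f y)"
  by (intro conv_integrable moll_n)

lemma mo_add: "loc1 f \<Longrightarrow> loc1 g \<Longrightarrow> mo n (\<lambda>x. f x + g x) x = mo n f x + mo n g x"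
  unfolding mo_def conv_def using mo_integrable[of f n x] mo_integrable[of g n x]
  by (simp add: distrib_left)

lemma mo_mono: "loc1 f \<Longrightarrow> loc1 g \<Longrightarrow> (\<And>x. f x \<le> g x) \<Longrightarrow> mo n f x \<le> mo n g x"
  unfolding mo_def conv_def using mo_integrable[of f n x] mo_integrable[of g n x]
  by (intro integral_mono mult_left_mono moll_nonneg) auto

lemma mo_nonneg: "(\<And>x. 0 \<le> f x) \<Longrightarrow> 0 \<le> mo n f x"
  unfolding mo_def conv_def by (intro integral_nonneg_AE always_eventually allI mult_nonneg_nonneg moll_nonneg) auto

lemma integral_moll_reflect: "e > 0 \<Longrightarrow> (LINT y|lborel. moll e (x - y)) = 1"
  using integral_lborel_reflect[OF smooth_measurable[OF test_smooth[OF test_moll[of e]]], of x] integral_moll[of e]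
  by (metis (mono_tags, lifting))

text \<open>The graph of the convex function s^p lies above its tangent at \<open>m\<close>. For
  positive arguments this is Young's inequality with weights \<open>1 / p\<close> and
  \<open>1 - 1 / p\<close>.\<close>

lemma powr_tangent:
  fixes s m p :: real
  assumes "p \<ge> 1" "s \<ge> 0" "m \<ge> 0"
  shows "m powr p + p * m powr (p - 1) * (s - m) \<le> s powr p"
proof (cases "m = 0 \<or> s = 0")
  case True
  have "m powr p = m powr (p - 1) * m" if "m > 0"
    using that by (simp add: powr_diff)
  moreover have "m powr p * (1 - p) \<le> 0" using assms by (intro mult_nonneg_nonpos) auto
  ultimately show ?thesis using True assms
    by (cases "m = 0") (auto simp: algebra_simps powr_diff)
next
  case False
  then have pos: "s > 0" "m > 0" using assms by auto
  have "(s powr p) powr (1/p) * (m powr p) powr (1 - 1/p) \<le> 1/p * s powr p + (1 - 1/p) * m powr p"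
    by (rule Youngs_inequality_0) (use pos assms in \<open>auto simp: field_simps\<close>)
  moreover have "(s powr p) powr (1/p) = s" "(m powr p) powr (1 - 1/p) = m powr (p - 1)"
    using pos assms by (auto simp: powr_powr right_diff_distrib)
  ultimately have "p * (s * m powr (p - 1)) \<le> p * (1/p * s powr p + (1 - 1/p) * m powr p)"
    using assms by (intro mult_left_mono) auto
  also have "\<dots> = s powr p + (p - 1) * m powr p" using assms by (simp add: field_simps)
  finally have "p * s * m powr (p - 1) \<le> s powr p + (p - 1) * m powr p" by (simp add: mult_ac)
  moreover have "m powr p = m powr (p - 1) * m" using pos by (simp add: powr_diff)
  ultimately show ?thesis by (simp add: algebra_simps)
qed

definition locp :: "real \<Rightarrow> ('a::euclidean_space \<Rightarrow> real) \<Rightarrow> bool" where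
  "locp p f \<longleftrightarrow> f \<in> borel_measurable borel \<and> loc1 (\<lambda>x. \<bar>f x\<bar> powr p)"

lemma loc1_bound:
  assumes g: "loc1 g" and [measurable]: "f \<in> borel_measurable borel" and "\<And>x. \<bar>f x\<bar> \<le> g x"
  shows "loc1 f"
  unfolding loc1_def
proof (intro conjI allI)
  show "integrable lborel (\<lambda>x. indicator (cball 0 R) x * f x)" for R
  proof (rule Bochner_Integration.integrable_bound[OF loc1_integrable[OF g, of R]])
    show "AE x in lborel. norm (indicat_real (cball 0 R) x * f x) \<le> norm (indicat_real (cball 0 R) x * g x)"
      using assms(3) by (intro always_eventually) (auto simp: indicator_def intro: order_trans[OF _ abs_ge_self])
    have [measurable]: "cball (0::'a) R \<in> sets borel" by simp
    show "(\<lambda>x. indicator (cball 0 R) x * f x) \<in> borel_measurable lborel" by measurable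
  qed
qed fact

lemma loc1_add: "loc1 f \<Longrightarrow> loc1 g \<Longrightarrow> loc1 (\<lambda>x. f x + g x)"
  by (auto simp: loc1_def distrib_left)
lemma loc1_cmult: "loc1 f \<Longrightarrow> loc1 (\<lambda>x. c * f x)"
  unfolding loc1_def by (auto simp: mult.left_commute[of _ c])
lemma loc1_const: "loc1 (\<lambda>x. c)" by (rule loc1_continuous) simp
lemma loc1_sum: "(\<And>i. i \<in> I \<Longrightarrow> loc1 (f i)) \<Longrightarrow> loc1 (\<lambda>x. \<Sum>i\<in>I. f i x)"
  by (induction I rule: infinite_finite_induct) (auto simp: loc1_add loc1_const)

lemma le_one_plus_powr: "p \<ge> 1 \<Longrightarrow> t \<ge> 0 \<Longrightarrow> t \<le> 1 + t powr p" for t :: real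
proof (cases "t \<le> 1")
  case False assume "p \<ge> 1"
  then have "t powr 1 \<le> t powr p" using False by (intro powr_mono) auto
  then show ?thesis using False by simp
qed (simp add: add_increasing2)

lemma locp_loc1: assumes "locp p f" "p \<ge> 1" shows "loc1 f"
proof (rule loc1_bound)
  show "loc1 (\<lambda>x. 1 + \<bar>f x\<bar> powr p)" using assms by (intro loc1_add loc1_const) (auto simp: locp_def)
qed (use assms le_one_plus_powr in \<open>auto simp: locp_def\<close>)

text \<open>Jensen's inequality for the probability density
  \<open>moll (1 / (real n + 1)) (x - y)\<close> in \<open>y\<close>. The tangent inequality at the
  mean \<open>m\<close> of \<open>\<bar>f\<bar>\<close> is integrated; its linear term has mean 0,
  which leaves \<open>m powr p\<close> on the left.\<close>

lemma mo_jensen: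
  assumes f: "locp p f" and p: "p \<ge> 1"
  shows "\<bar>mo n f x\<bar> powr p \<le> mo n (\<lambda>x. \<bar>f x\<bar> powr p) x"
proof -
  let ?k = "\<lambda>y. moll (1 / (real n + 1)) (x - y)"
  have k: "?k y \<ge> 0" for y by (rule moll_nonneg) simp
  have l: "loc1 f" "loc1 (\<lambda>x. \<bar>f x\<bar>)" "loc1 (\<lambda>x. \<bar>f x\<bar> powr p)"
    using locp_loc1[OF f p] loc1_abs f by (auto simp: locp_def)
  define m where "m = mo n (\<lambda>x. \<bar>f x\<bar>) x"
  have m: "m \<ge> 0" unfolding m_def by (rule mo_nonneg) simp
  have "- m \<le> mo n f x" "mo n f x \<le> m"
    using mo_mono[OF l(1,2), of n x] mo_mono[OF loc1_cmult[OF l(2), of "-1"] l(1), of n x]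
    unfolding m_def by (auto simp: mo_def conv_def)
  then have "\<bar>mo n f x\<bar> powr p \<le> m powr p" using p by (intro powr_mono2) auto
  also have "\<dots> = (LINT y|lborel. ?k y * (m powr p + p * m powr (p - 1) * (\<bar>f y\<bar> - m)))"
  proof -
    have i: "integrable lborel ?k" by (rule test_integrable[OF test_reflect[OF moll_n]])
    have "(LINT y|lborel. ?k y * (m powr p + p * m powr (p - 1) * (\<bar>f y\<bar> - m)))
      = (LINT y|lborel. (m powr p - p * m powr (p - 1) * m) * ?k y + (p * m powr (p - 1)) * (?k y * \<bar>f y\<bar>))"
      by (intro Bochner_Integration.integral_cong) (auto simp: algebra_simps)
    also have "\<dots> = (m powr p - p * m powr (p - 1) * m) * (LINT y|lborel. ?k y) + (p * m powr (p - 1)) * (LINT y|lborel. ?k y * \<bar>f y\<bar>)"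
      using i mo_integrable[OF l(2), of n x] by simp
    also have "\<dots> = m powr p"
      using integral_moll_reflect[of "1 / (real n + 1)" x] unfolding m_def mo_def conv_def by simp
    finally show ?thesis by simp
  qed
  also have "\<dots> \<le> mo n (\<lambda>x. \<bar>f x\<bar> powr p) x"
    unfolding mo_def conv_def
  proof (rule integral_mono)
    have "integrable lborel (\<lambda>y. (m powr p - p * m powr (p - 1) * m) * ?k y + (p * m powr (p - 1)) * (?k y * \<bar>f y\<bar>))"
      using test_integrable[OF test_reflect[OF moll_n]] mo_integrable[OF l(2), of n x]
      by (intro Bochner_Integration.integrable_add integrable_mult_right) auto
    then show "integrable lborel (\<lambda>y. ?k y * (m powr p + p * m powr (p - 1) * (\<bar>f y\<bar> - m)))"
      by (rule back_subst[of "integrable lborel"]) (auto simp: algebra_simps)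
    show "integrable lborel (\<lambda>y. ?k y * \<bar>f y\<bar> powr p)" by (rule mo_integrable[OF l(3)])
  qed (use k m p powr_tangent in \<open>auto intro!: mult_left_mono\<close>)
  finally show ?thesis .
qed

section \<open>Continuity of translations in L1 and convergence of mollifications\<close>

definition trans_err :: "('a::euclidean_space \<Rightarrow> real) \<Rightarrow> 'a \<Rightarrow> real" where
  "trans_err f h = (LINT x|lborel. \<bar>f (x - h) - f x\<bar>)"

lemma integrable_translate:
  fixes f :: "'a::euclidean_space \<Rightarrow> real"
  assumes "integrable lborel f" shows "integrable lborel (\<lambda>x. f (x - h))"
    "(LINT x|lborel. f (x - h)) = (LINT x|lborel. f x)"
proof -
  have d: "lborel = distr lborel borel (\<lambda>x. x - h)"
  proof -
    have "(\<lambda>x. x - h) = (+) (- h)" by auto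
    then show ?thesis using lborel_distr_plus[of "- h"] by simp
  qed
  have m: "f \<in> borel_measurable borel" using borel_measurable_integrable[OF assms] by simp
  have "integrable (distr lborel borel (\<lambda>x. x - h)) f" using assms by (simp flip: d)
  then show "integrable lborel (\<lambda>x. f (x - h))" by (subst (asm) integrable_distr_eq) (use m in auto)
  show "(LINT x|lborel. f (x - h)) = (LINT x|lborel. f x)"
    by (subst (2) d) (use m in \<open>simp add: integral_distr\<close>)
qed

text \<open>Translation preserves the L1 distance of \<open>f\<close> and \<open>g\<close>, so this
  distance enters twice and the translation error of \<open>g\<close> once. Hence continuity of
  translation passes to L1 limits.\<close>

lemma trans_err_approx:
  fixes f :: "'a::euclidean_space \<Rightarrow> real"
  assumes f: "integrable lborel f"
    and g: "\<And>e. e > 0 \<Longrightarrow> \<exists>g. integrable lborel g \<and> (trans_err g \<longlongrightarrow> 0) (at 0) \<and> (LINT x|lborel. \<bar>f x - g x\<bar>) < e"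
  shows "(trans_err f \<longlongrightarrow> 0) (at 0)"
proof (rule tendstoI)
  fix e :: real assume "e > 0"
  then obtain g where g: "integrable lborel g" "(trans_err g \<longlongrightarrow> 0) (at 0)" "(LINT x|lborel. \<bar>f x - g x\<bar>) < e / 3"
    using g[of "e / 3"] by auto
  have "eventually (\<lambda>h. dist (trans_err g h) 0 < e / 3) (at 0)" using tendstoD[OF g(2), of "e/3"] \<open>e > 0\<close> by simp
  then show "eventually (\<lambda>h. dist (trans_err f h) 0 < e) (at 0)"
  proof eventually_elim
    case (elim h)
    have i: "integrable lborel (\<lambda>x. \<bar>f x - g x\<bar>)" using f g(1) by auto
    note t = integrable_translate[OF i, of h] integrable_translate(1)[OF f, of h] integrable_translate(1)[OF g(1), of h]
    have "trans_err f h \<le> (LINT x|lborel. \<bar>f (x - h) - g (x - h)\<bar> + (\<bar>g (x - h) - g x\<bar> + \<bar>f x - g x\<bar>))"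
      unfolding trans_err_def
      by (intro integral_mono integrable_abs Bochner_Integration.integrable_diff Bochner_Integration.integrable_add) (use t f g in auto)
    also have "\<dots> = (LINT x|lborel. \<bar>f (x - h) - g (x - h)\<bar>) + (trans_err g h + (LINT x|lborel. \<bar>f x - g x\<bar>))"
      unfolding trans_err_def using t i f g by (subst Bochner_Integration.integral_add Bochner_Integration.integral_add)+ auto
    also have "\<dots> < e" using elim g(3) t(2) by (simp add: dist_real_def)
    finally show ?case by (simp add: dist_real_def trans_err_def)
  qed
qed

text \<open>For indicators the absolute difference is the sum minus twice the product. The product
  vanishes off \<open>U\<close>, and at points of \<open>U\<close> openness makes it eventually 1;
  hence no information on the boundary of \<open>U\<close> enters.\<close>

lemma trans_err_open:
  fixes U :: "'a::euclidean_space set"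
  assumes U: "open U" and fin: "emeasure lborel U < \<infinity>"
  shows "(trans_err (indicator U) \<longlongrightarrow> 0) (at 0)"
  unfolding tendsto_at_iff_sequentially
proof (intro allI impI)
  fix X :: "nat \<Rightarrow> 'a" assume X: "X \<longlonglongrightarrow> 0"
  have i: "integrable lborel (indicator U :: 'a \<Rightarrow> real)" using U fin by (simp add: integrable_indicator_iff)
  have b[measurable]: "U \<in> sets borel" using U by simp
  have ip: "integrable lborel (\<lambda>x. indicator U x * indicator U (x - h) :: real)" for h
    by (rule Bochner_Integration.integrable_bound[OF i]) (auto simp: indicator_def)
  have lim: "(\<lambda>n. LINT x|lborel. indicator U x * indicator U (x - X n) :: real) \<longlonglongrightarrow> (LINT x|lborel. indicator U x)"
  proof (rule integral_dominated_convergence[OF _ _ i])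
    show "AE x in lborel. (\<lambda>n. indicator U x * indicator U (x - X n) :: real) \<longlonglongrightarrow> indicator U x"
    proof (intro always_eventually allI)
      fix x
      show "(\<lambda>n. indicator U x * indicator U (x - X n) :: real) \<longlonglongrightarrow> indicator U x"
      proof (cases "x \<in> U")
        case True
        have "(\<lambda>n. x - X n) \<longlonglongrightarrow> x - 0" by (intro tendsto_intros X)
        then have "eventually (\<lambda>n. x - X n \<in> U) sequentially" using U True by (auto simp: tendsto_def)
        then have "eventually (\<lambda>n. indicator U x = (indicator U x * indicator U (x - X n) :: real)) sequentially"
          by eventually_elim (use True in auto)
        then show ?thesis using tendsto_const by (rule Lim_transform_eventually[rotated])
      qed simp
    qed
  qed (auto simp: indicator_def)
  have "trans_err (indicator U) h = 2 * (LINT x|lborel. indicator U x :: real) - 2 * (LINT x|lborel. indicator U x * indicator U (x - h) :: real)" for h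
  proof -
    have "trans_err (indicator U) h = (LINT x|lborel. (indicator U (x - h) + indicator U x) - 2 * (indicator U x * indicator U (x - h) :: real))"
      unfolding trans_err_def by (intro Bochner_Integration.integral_cong) (auto simp: indicator_def)
    also have "\<dots> = (LINT x|lborel. indicator U (x - h)) + (LINT x|lborel. indicator U x) - 2 * (LINT x|lborel. indicator U x * indicator U (x - h) :: real)"
      using i ip[of h] integrable_translate(1)[OF i, of h] by (simp add: Bochner_Integration.integral_diff Bochner_Integration.integral_add)
    finally show ?thesis using integrable_translate(2)[OF i, of h] by simp
  qed
  moreover have "(\<lambda>n. 2 * (LINT x|lborel. indicator U x :: real) - 2 * (LINT x|lborel. indicator U x * indicator U (x - X n) :: real)) \<longlonglongrightarrow>
     2 * (LINT x|lborel. indicator U x :: real) - 2 * (LINT x|lborel. indicator U x)"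
    by (intro tendsto_intros lim)
  ultimately show "(trans_err (indicator U) \<circ> X) \<longlonglongrightarrow> 0" by (simp add: o_def)
qed

text \<open>Induction over integrable functions. A set of finite measure is approximated from
  outside by open sets, which are settled by \<open>trans_err_open\<close>; sums and dominated
  pointwise limits follow from the triangle inequality and \<open>trans_err_approx\<close>.\<close>

lemma trans_err_tendsto:
  fixes f :: "'a::euclidean_space \<Rightarrow> real"
  assumes "integrable lborel f"
  shows "(trans_err f \<longlongrightarrow> 0) (at 0)"
  using assms
proof (induction rule: integrable_induct)
  case (base A c)
  have iA: "integrable lborel (indicator A :: 'a \<Rightarrow> real)" using base by (simp add: integrable_indicator_iff)
  have "(trans_err (indicator A :: 'a \<Rightarrow> real) \<longlongrightarrow> 0) (at 0)"
  proof (rule trans_err_approx[OF iA])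
    fix e :: real assume e: "e > 0"
    obtain U where U: "open U" "A \<subseteq> U" "emeasure lborel (U - A) < ennreal e"
      using outer_regular_lborel[of A e] base(1) e by auto
    have "emeasure lborel U \<le> emeasure lborel A + emeasure lborel (U - A)"
      using U base by (subst plus_emeasure) (auto intro!: emeasure_mono)
    also have "\<dots> < \<infinity>" using U(3) base(2) ennreal_less_top[of e] by (auto simp: less_top[symmetric])
    finally have fin: "emeasure lborel U < \<infinity>" .
    have "(LINT x|lborel. \<bar>indicator A x - indicator U x\<bar>) = (LINT x|lborel. indicator (U - A) x :: real)"
      using U(2) by (intro Bochner_Integration.integral_cong) (auto simp: indicator_def)
    also have "\<dots> = measure lborel (U - A)" by simp
    also have "\<dots> < e" using U(3) e by (simp add: measure_def enn2real_less_iff less_top ennreal_less_top order_less_trans)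
    finally show "\<exists>g. integrable lborel g \<and> (trans_err g \<longlongrightarrow> 0) (at 0) \<and> (LINT x|lborel. \<bar>indicator A x - g x\<bar>) < e"
      using trans_err_open[OF U(1) fin] U fin by (intro exI[of _ "indicator U"]) (auto simp: integrable_indicator_iff)
  qed
  then have "((\<lambda>h. \<bar>c\<bar> * trans_err (indicator A) h) \<longlongrightarrow> \<bar>c\<bar> * 0) (at 0)" by (intro tendsto_intros)
  moreover have "trans_err (\<lambda>x. indicator A x *\<^sub>R c) h = \<bar>c\<bar> * trans_err (indicator A) h" for h
  proof -
    have "\<bar>indicator A (x - h) *\<^sub>R c - indicator A x *\<^sub>R c\<bar> = \<bar>c\<bar> * \<bar>indicator A (x - h) - indicator A x :: real\<bar>" for x
      by (auto simp: indicator_def)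
    then show ?thesis unfolding trans_err_def by simp
  qed
  ultimately show ?case by simp
next
  case (add f g)
  show ?case
  proof (rule tendsto_sandwich[of "\<lambda>_. 0" _ _ "\<lambda>h. trans_err f h + trans_err g h"])
    have "((\<lambda>h. trans_err f h + trans_err g h) \<longlongrightarrow> 0 + 0) (at 0)" by (intro tendsto_intros add)
    then show "((\<lambda>h. trans_err f h + trans_err g h) \<longlongrightarrow> 0) (at 0)" by simp
    show "\<forall>\<^sub>F h in at 0. trans_err (\<lambda>x. f x + g x) h \<le> trans_err f h + trans_err g h"
    proof (intro always_eventually allI)
      fix h
      note t = integrable_translate(1)[OF add(1), of h] integrable_translate(1)[OF add(2), of h]
      have "trans_err (\<lambda>x. f x + g x) h \<le> (LINT x|lborel. \<bar>f (x - h) - f x\<bar> + \<bar>g (x - h) - g x\<bar>)"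
        unfolding trans_err_def using t add by (intro integral_mono) auto
      then show "trans_err (\<lambda>x. f x + g x) h \<le> trans_err f h + trans_err g h"
        unfolding trans_err_def using t add by simp
    qed
  qed (auto simp: trans_err_def)
next
  case (lim f s)
  show ?case
  proof (rule trans_err_approx[OF lim(4)])
    fix e :: real assume e: "e > 0"
    have "(\<lambda>n. LINT x|lborel. \<bar>f x - s n x\<bar>) \<longlonglongrightarrow> integral\<^sup>L lborel (\<lambda>x::'a. 0)"
    proof (rule integral_dominated_convergence[where w="\<lambda>x. 3 * \<bar>f x\<bar>"])
      show "integrable lborel (\<lambda>x. 3 * \<bar>f x\<bar>)" using lim by simp
      show "AE x in lborel. (\<lambda>n. \<bar>f x - s n x\<bar>) \<longlonglongrightarrow> 0"
      proof (intro always_eventually allI)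
        fix x
        have "(\<lambda>n. \<bar>f x - s n x\<bar>) \<longlonglongrightarrow> \<bar>f x - f x\<bar>" using lim(2)[of x] by (intro tendsto_intros) auto
        then show "(\<lambda>n. \<bar>f x - s n x\<bar>) \<longlonglongrightarrow> 0" by simp
      qed
      show "AE x in lborel. norm \<bar>f x - s n x\<bar> \<le> 3 * \<bar>f x\<bar>" for n
        using lim(3)[of _ n] by (intro always_eventually allI) (smt (verit) UNIV_I real_norm_def space_borel space_lborel)
    qed (use lim in auto)
    then have "eventually (\<lambda>n. (LINT x|lborel. \<bar>f x - s n x\<bar>) < e) sequentially"
      using e by (auto dest: order_tendstoD(2))
    then obtain n where "(LINT x|lborel. \<bar>f x - s n x\<bar>) < e" by (auto simp: eventually_sequentially)
    then show "\<exists>g. integrable lborel g \<and> (trans_err g \<longlongrightarrow> 0) (at 0) \<and> (LINT x|lborel. \<bar>f x - g x\<bar>) < e"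
      using lim by blast
  qed
qed

lemma integrable_lborel_reflect:
  fixes F :: "'a::euclidean_space \<Rightarrow> real"
  assumes "integrable lborel F" shows "integrable lborel (\<lambda>h. F (x - h))"
proof -
  have m: "F \<in> borel_measurable borel" using borel_measurable_integrable[OF assms] by simp
  have d: "lborel = distr lborel borel (\<lambda>h. x - h)"
    using lborel_affine[of "-1" x] by (simp add: density_1)
  have "integrable (distr lborel borel (\<lambda>h. x - h)) F" using assms by (simp flip: d)
  then show ?thesis by (subst (asm) integrable_distr_eq) (use m in auto)
qed

text \<open>\<open>mo n F x - F x\<close> is the mean of \<open>F (x - h) - F x\<close> with respect
  to the mollifier. Exchanging the integrals bounds its L1 norm by the mean of
  \<open>trans_err F h\<close> over the small \<open>h\<close> in the support.\<close>

lemma mo_L1_global: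
  fixes F :: "'a::euclidean_space \<Rightarrow> real"
  assumes F: "integrable lborel F" and e: "e > 0"
  shows "\<exists>N. \<forall>n\<ge>N. (\<integral>\<^sup>+x. ennreal \<bar>mo n F x - F x\<bar> \<partial>lborel) \<le> ennreal e"
proof -
  have [measurable]: "F \<in> borel_measurable borel" using borel_measurable_integrable[OF F] by simp
  have lF: "loc1 F" unfolding loc1_def
  proof (intro conjI allI)
    show "integrable lborel (\<lambda>x. indicator (cball 0 R) x * F x)" for R
      using integrable_real_mult_indicator[OF _ F, of "cball 0 R"] by (simp add: mult.commute)
  qed measurable
  obtain d where d: "d > 0" "\<And>h. h \<noteq> 0 \<Longrightarrow> norm h < d \<Longrightarrow> norm (trans_err F h - 0) < e"
    using LIM_D[OF trans_err_tendsto[OF F] e] by auto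
  \<comment> \<open>The limit at 0 excludes \<open>h = 0\<close>, where the error is 0
    anyway.\<close>
  have T: "trans_err F h \<le> e" if "norm h < d" for h
    using d(2)[of h] that e by (cases "h = 0") (auto simp: trans_err_def)
  obtain N where N: "1 / real (Suc N) < d" using d(1) nat_approx_posE by blast
  show ?thesis
  proof (intro exI allI impI)
    fix n assume n: "n \<ge> N"
    let ?k = "moll (1 / (real n + 1)) :: 'a \<Rightarrow> real"
    have "1 / (real n + 1) \<le> 1 / real (Suc N)" using n by (intro divide_left_mono) auto
    then have kd: "?k h = 0" if "d \<le> norm h" for h using N that by (intro moll_zero) auto
    have k0: "?k h \<ge> 0" for h by (rule moll_nonneg) simp
    have [measurable]: "?k \<in> borel_measurable borel" by (intro smooth_measurable test_smooth moll_n)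
    have ik: "integrable lborel ?k" by (rule test_integrable[OF moll_n])
    have bound: "ennreal \<bar>mo n F x - F x\<bar> \<le> (\<integral>\<^sup>+h. ennreal (?k h) * ennreal \<bar>F (x - h) - F x\<bar> \<partial>lborel)" for x
    proof -
      have i: "integrable lborel (\<lambda>h. ?k h * F (x - h))"
      proof -
        have "loc1 (\<lambda>h. F (x - h))"
        proof -
          have "integrable lborel (\<lambda>h. F (x - h))" by (rule integrable_lborel_reflect[OF F])
          then have "integrable lborel (\<lambda>h. indicator (cball 0 R) h * F (x - h))" for R
            using integrable_real_mult_indicator[of "cball 0 R" lborel "\<lambda>h. F (x - h)"] by (simp add: mult.commute)
          then show ?thesis unfolding loc1_def by simp
        qed
        then show ?thesis by (rule test_integrable_loc1[OF moll_n])
      qed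
      have "mo n F x = (LINT h|lborel. ?k h * F (x - h))"
        unfolding mo_def conv_def using integral_lborel_reflect[of "\<lambda>h. ?k h * F (x - h)" x] by simp
      moreover have "F x = (LINT h|lborel. ?k h * F x)" using ik integral_moll[where 'a='a, of "1 / (real n + 1)"] by simp
      ultimately have "mo n F x - F x = (LINT h|lborel. ?k h * (F (x - h) - F x))"
        using i ik by (simp add: right_diff_distrib)
      then have "ennreal \<bar>mo n F x - F x\<bar> \<le> (\<integral>\<^sup>+h. ennreal \<bar>?k h * (F (x - h) - F x)\<bar> \<partial>lborel)"
        using integral_norm_bound_ennreal[of lborel "\<lambda>h. ?k h * (F (x - h) - F x)"] i ik
        by (simp add: right_diff_distrib)
      then show ?thesis using k0 by (simp add: abs_mult ennreal_mult)
    qed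
    have "(\<integral>\<^sup>+x. ennreal \<bar>mo n F x - F x\<bar> \<partial>lborel)
        \<le> (\<integral>\<^sup>+x. \<integral>\<^sup>+h. ennreal (?k h) * ennreal \<bar>F (x - h) - F x\<bar> \<partial>lborel \<partial>lborel)"
      by (intro nn_integral_mono bound)
    also have "\<dots> = (\<integral>\<^sup>+h. \<integral>\<^sup>+x. ennreal (?k h) * ennreal \<bar>F (x - h) - F x\<bar> \<partial>lborel \<partial>lborel)"
      by (rule lborel_pair.Fubini'[symmetric]) measurable
    also have "\<dots> \<le> (\<integral>\<^sup>+h. ennreal (?k h) * ennreal e \<partial>lborel)"
    proof (intro nn_integral_mono)
      fix h
      have "(\<integral>\<^sup>+x. ennreal (?k h) * ennreal \<bar>F (x - h) - F x\<bar> \<partial>lborel) = ennreal (?k h) * ennreal (trans_err F h)"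
        unfolding trans_err_def using F integrable_translate(1)[OF F, of h]
        by (subst nn_integral_cmult) (auto simp: nn_integral_eq_integral)
      also have "\<dots> \<le> ennreal (?k h) * ennreal e"
      proof (cases "norm h < d")
        case True then show ?thesis by (intro mult_left_mono ennreal_leI T) auto
      next
        case False then show ?thesis using kd[of h] by simp
      qed
      finally show "(\<integral>\<^sup>+x. ennreal (?k h) * ennreal \<bar>F (x - h) - F x\<bar> \<partial>lborel) \<le> ennreal (?k h) * ennreal e" .
    qed
    also have "\<dots> = ennreal e"
      using ik k0 integral_moll[where 'a='a, of "1 / (real n + 1)"] by (subst nn_integral_multc) (auto simp: nn_integral_eq_integral)
    finally show "(\<integral>\<^sup>+x. ennreal \<bar>mo n F x - F x\<bar> \<partial>lborel) \<le> ennreal e" .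
  qed
qed

lemma mo_local:
  assumes "\<And>x. norm x \<le> R + 1 \<Longrightarrow> f x = g x" "norm x \<le> R"
  shows "mo n f x = mo n g x"
  unfolding mo_def conv_def
proof (intro Bochner_Integration.integral_cong refl)
  fix y
  show "moll (1 / (real n + 1)) (x - y) * f y = moll (1 / (real n + 1)) (x - y) * g y"
  proof (cases "norm y \<le> R + 1")
    case False
    have "1 / (real n + 1) \<le> 1" by simp
    moreover have "1 \<le> norm (x - y)" using False assms(2) norm_triangle_ineq3[of x y] by simp
    ultimately have "moll (1 / (real n + 1)) (x - y) = 0" by (intro moll_zero order_trans[OF _ \<open>1 \<le> norm (x - y)\<close>]) auto
    then show ?thesis by simp
  qed (simp add: assms(1))
qed

lemma mo_diff_integrable:
  assumes "loc1 f" shows "integrable lborel (\<lambda>x. indicator (cball 0 R) x * \<bar>mo n f x - f x\<bar>)"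
proof -
  have "loc1 (\<lambda>x. mo n f x + (-1) * f x)"
    by (intro loc1_add loc1_cmult assms loc1_continuous smooth_continuous mo_smooth)
  then show ?thesis using loc1_integrable[OF loc1_abs] by fastforce
qed

lemma mo_L1:
  fixes f :: "'a::euclidean_space \<Rightarrow> real"
  assumes f: "loc1 f"
  shows "(\<lambda>n. LINT x|lborel. indicator (cball 0 R) x * \<bar>mo n f x - f x\<bar>) \<longlonglongrightarrow> 0"
proof (rule LIMSEQ_I)
  fix e :: real assume e: "e > 0"
  \<comment> \<open>This truncation is globally integrable and, by \<open>mo_local\<close>, leaves
    \<open>mo n f\<close> unchanged on \<open>cball 0 R\<close>.\<close>
  let ?F = "\<lambda>x. indicator (cball 0 (R + 1)) x * f x"
  obtain N where N: "\<And>n. n \<ge> N \<Longrightarrow> (\<integral>\<^sup>+x. ennreal \<bar>mo n ?F x - ?F x\<bar> \<partial>lborel) \<le> ennreal (e/2)"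
    using mo_L1_global[OF loc1_integrable[OF f], of "e/2"] e by auto
  show "\<exists>N. \<forall>n\<ge>N. norm ((LINT x|lborel. indicator (cball 0 R) x * \<bar>mo n f x - f x\<bar>) - 0) < e"
  proof (intro exI allI impI)
    fix n assume "n \<ge> N"
    have "ennreal (LINT x|lborel. indicator (cball 0 R) x * \<bar>mo n f x - f x\<bar>)
        = (\<integral>\<^sup>+x. ennreal (indicator (cball 0 R) x * \<bar>mo n f x - f x\<bar>) \<partial>lborel)"
      by (rule nn_integral_eq_integral[symmetric, OF mo_diff_integrable[OF f]]) auto
    also have "\<dots> \<le> (\<integral>\<^sup>+x. ennreal \<bar>mo n ?F x - ?F x\<bar> \<partial>lborel)"
    proof (intro nn_integral_mono ennreal_leI)
      fix x
      show "indicator (cball 0 R) x * \<bar>mo n f x - f x\<bar> \<le> \<bar>mo n ?F x - ?F x\<bar>"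
        using mo_local[of R f ?F x n] by (cases "norm x \<le> R") (auto simp: indicator_def)
    qed
    also have "\<dots> \<le> ennreal (e/2)" by (rule N) fact
    finally have "(LINT x|lborel. indicator (cball 0 R) x * \<bar>mo n f x - f x\<bar>) \<le> e / 2"
      using e by (simp add: ennreal_le_iff)
    moreover have "0 \<le> (LINT x|lborel. indicator (cball 0 R) x * \<bar>mo n f x - f x\<bar>)" by simp
    ultimately show "norm ((LINT x|lborel. indicator (cball 0 R) x * \<bar>mo n f x - f x\<bar>) - 0) < e"
      using e by simp
  qed
qed

text \<open>Convergence in L1 gives almost everywhere convergence only along a subsequence, so the
  subsequence \<open>s\<close> is a parameter.\<close>

definition aeconv :: "(nat \<Rightarrow> nat) \<Rightarrow> real \<Rightarrow> ('a::euclidean_space \<Rightarrow> real) \<Rightarrow> bool" where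
  "aeconv s R f \<longleftrightarrow> (AE x in lborel. norm x \<le> R \<longrightarrow> (\<lambda>n. mo (s n) f x) \<longlonglongrightarrow> f x)"

text \<open>The sum of the L1 errors over the finite family tends to 0, so a subsequence that works
  for the sum works for every member at once.\<close>

lemma aeconv_subseq:
  fixes Fs :: "('a::euclidean_space \<Rightarrow> real) set"
  assumes fin: "finite Fs" and l: "\<And>f. f \<in> Fs \<Longrightarrow> loc1 f"
  shows "\<exists>s. strict_mono s \<and> (\<forall>f\<in>Fs. aeconv s R f)"
proof -
  let ?u = "\<lambda>n x. \<Sum>f\<in>Fs. indicator (cball 0 R) x * \<bar>mo n f x - f x\<bar>"
  have "\<exists>r. strict_mono r \<and> (AE x in lborel. (\<lambda>n. ?u (r n) x) \<longlonglongrightarrow> 0)"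
  proof (rule tendsto_L1_AE_subseq)
    show "integrable lborel (?u n)" for n
      using l by (intro Bochner_Integration.integrable_sum mo_diff_integrable)
    have "(\<lambda>n. \<Sum>f\<in>Fs. LINT x|lborel. indicator (cball 0 R) x * \<bar>mo n f x - f x\<bar>) \<longlonglongrightarrow> (\<Sum>f\<in>Fs. 0)"
      using l by (intro tendsto_sum mo_L1)
    moreover have "(LINT x|lborel. norm (?u n x)) = (\<Sum>f\<in>Fs. LINT x|lborel. indicator (cball 0 R) x * \<bar>mo n f x - f x\<bar>)" for n
    proof -
      have "norm (?u n x) = ?u n x" for x
        unfolding real_norm_def by (intro abs_of_nonneg sum_nonneg) simp
      then show ?thesis using mo_diff_integrable[OF l] by (subst Bochner_Integration.integral_sum[symmetric]) auto
    qed
    ultimately show "(\<lambda>n. LINT x|lborel. norm (?u n x)) \<longlonglongrightarrow> 0" by simp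
  qed
  then obtain r where r: "strict_mono r" "AE x in lborel. (\<lambda>n. ?u (r n) x) \<longlonglongrightarrow> 0" by blast
  have "aeconv r R f" if f: "f \<in> Fs" for f
    unfolding aeconv_def using r(2)
  proof eventually_elim
    case (elim x)
    show "norm x \<le> R \<longrightarrow> (\<lambda>n. mo (r n) f x) \<longlonglongrightarrow> f x"
    proof
      assume x: "norm x \<le> R"
      have "(\<lambda>n. mo (r n) f x - f x) \<longlonglongrightarrow> 0"
      proof (rule tendsto_0_le[OF elim, where K=1])
        have "\<bar>mo (r n) f x - f x\<bar> \<le> ?u (r n) x" for n
          using member_le_sum[OF f, of "\<lambda>f. indicator (cball 0 R) x * \<bar>mo (r n) f x - f x\<bar>"] fin x by auto
        then show "\<forall>\<^sub>F n in sequentially. norm (mo (r n) f x - f x) \<le> norm (?u (r n) x) * 1"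
          unfolding real_norm_def mult_1_right by (intro always_eventually allI) (rule order_trans[OF _ abs_ge_self])
      qed
      then show "(\<lambda>n. mo (r n) f x) \<longlonglongrightarrow> f x" by (simp add: LIM_zero_iff)
    qed
  qed
  then show ?thesis using r(1) by blast
qed

text \<open>A form of the dominated convergence theorem whose dominating functions may vary with \<open>n\<close>,
  as long as they converge in \<open>L\<^sup>1\<close>.\<close>

lemma mo_dominated_convergence:
  fixes f :: "'a::euclidean_space \<Rightarrow> real"
  assumes s: "strict_mono s" and F: "loc1 F" and G: "loc1 G" and F0: "\<And>x. 0 \<le> F x" and G0: "\<And>x. 0 \<le> G x"
    and ae: "aeconv s R F"
    and [measurable]: "\<And>n. fn n \<in> borel_measurable borel" "f \<in> borel_measurable borel"
    and lim: "AE x in lborel. (\<lambda>n. fn n x) \<longlonglongrightarrow> f x"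
    and bound: "\<And>n x. \<bar>fn n x\<bar> \<le> indicator (cball 0 R) x * (G x + mo (s n) F x)"
  shows "integrable lborel (fn n)" "integrable lborel f"
    "(\<lambda>n. LINT x|lborel. fn n x) \<longlonglongrightarrow> (LINT x|lborel. f x)"
proof -
  note [measurable] = loc1_measurable[OF F] loc1_measurable[OF G] mo_measurable[OF F]
  have [measurable]: "cball (0::'a) R \<in> sets borel" by simp
  let ?g = "\<lambda>x. indicator (cball 0 R) x * (G x + F x)"
  have ig: "integrable lborel ?g" by (rule loc1_integrable[OF loc1_add[OF G F]])
  have g0: "?g x \<ge> 0" for x using F0 G0 by (intro mult_nonneg_nonneg add_nonneg_nonneg) auto
  have fg: "AE x in lborel. \<bar>f x\<bar> \<le> ?g x"
    using lim ae[unfolded aeconv_def]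
  proof eventually_elim
    case (elim x)
    show ?case
    proof (cases "norm x \<le> R")
      case True
      have "(\<lambda>n. \<bar>fn n x\<bar>) \<longlonglongrightarrow> \<bar>f x\<bar>" by (intro tendsto_intros elim)
      moreover have "(\<lambda>n. indicator (cball 0 R) x * (G x + mo (s n) F x)) \<longlonglongrightarrow> ?g x"
        using elim True by (intro tendsto_intros) auto
      ultimately show ?thesis by (rule LIMSEQ_le) (use bound in blast)
    next
      case False
      then have "fn n x = 0" for n using bound[of n x] by simp
      then have "f x = 0" using elim(1) by (simp add: LIMSEQ_const_iff)
      then show ?thesis using False by simp
    qed
  qed
  show if': "integrable lborel f"
    by (rule Bochner_Integration.integrable_bound[OF ig]) (use fg g0 in \<open>auto elim!: eventually_mono\<close>)
  show ifn: "integrable lborel (fn n)" for n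
  proof (rule Bochner_Integration.integrable_bound)
    show "integrable lborel (\<lambda>x. indicator (cball 0 R) x * (G x + mo (s n) F x))"
      by (intro loc1_integrable loc1_add G loc1_continuous smooth_continuous mo_smooth F)
    show "AE x in lborel. norm (fn n x) \<le> norm (indicat_real (cball 0 R) x * (G x + mo (s n) F x))"
      using bound[of n] by (intro always_eventually allI) (smt (verit) real_norm_def)
  qed simp
  \<comment> \<open>Truncation at the fixed limit of the dominating functions. Ordinary dominated
    convergence applies to \<open>h\<close>, and the truncated excess is at most
    \<open>\<bar>mo (s n) F x - F x\<bar>\<close>, which tends to 0 in L1.\<close>
  define h where "h n x = max (- ?g x) (min (?g x) (fn n x))" for n x
  have hm[measurable]: "h n \<in> borel_measurable borel" for n unfolding h_def by measurable
  have hb: "\<bar>h n x\<bar> \<le> ?g x" for n x unfolding h_def using g0[of x] by (simp add: max_def min_def abs_if)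
  have hl: "(\<lambda>n. LINT x|lborel. h n x) \<longlonglongrightarrow> (LINT x|lborel. f x)"
  proof (rule integral_dominated_convergence[where w="?g"])
    show "AE x in lborel. (\<lambda>n. h n x) \<longlonglongrightarrow> f x"
      using lim fg
    proof eventually_elim
      case (elim x)
      have "(\<lambda>n. h n x) \<longlonglongrightarrow> max (- ?g x) (min (?g x) (f x))"
        unfolding h_def by (intro tendsto_intros elim)
      moreover have "max (- ?g x) (min (?g x) (f x)) = f x" using elim(2) by linarith
      ultimately show ?case by simp
    qed
  qed (use ig hb in auto)
  have ih: "integrable lborel (h n)" for n
    by (rule Bochner_Integration.integrable_bound[OF ig]) (use hb[of n] in \<open>auto intro!: always_eventually intro: order_trans[OF _ abs_ge_self]\<close>)
  have "(\<lambda>n. (LINT x|lborel. fn n x) - (LINT x|lborel. h n x)) \<longlonglongrightarrow> 0"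
  proof (rule tendsto_0_le[where K=1])
    show "(\<lambda>n. LINT x|lborel. indicator (cball 0 R) x * \<bar>mo (s n) F x - F x\<bar>) \<longlonglongrightarrow> 0"
      using LIMSEQ_subseq_LIMSEQ[OF mo_L1[OF F] s] by (simp add: o_def)
    show "\<forall>\<^sub>F n in sequentially. norm ((LINT x|lborel. fn n x) - (LINT x|lborel. h n x))
      \<le> norm (LINT x|lborel. indicator (cball 0 R) x * \<bar>mo (s n) F x - F x\<bar>) * 1"
    proof (intro always_eventually allI)
      fix n
      have "norm (LINT x|lborel. fn n x - h n x) \<le> (LINT x|lborel. indicator (cball 0 R) x * \<bar>mo (s n) F x - F x\<bar>)"
      proof (rule Bochner_Integration.integral_norm_bound_integral)
        fix x
        show "norm (fn n x - h n x) \<le> indicator (cball 0 R) x * \<bar>mo (s n) F x - F x\<bar>"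
          using bound[of n x] g0[of x] unfolding h_def by (cases "norm x \<le> R") (auto simp: max_def min_def abs_if split: if_splits)
      qed (use ifn ih mo_diff_integrable[OF F] in auto)
      then show "norm ((LINT x|lborel. fn n x) - (LINT x|lborel. h n x))
      \<le> norm (LINT x|lborel. indicator (cball 0 R) x * \<bar>mo (s n) F x - F x\<bar>) * 1"
        using ifn ih by simp
    qed
  qed
  from tendsto_add[OF this hl] show "(\<lambda>n. LINT x|lborel. fn n x) \<longlonglongrightarrow> (LINT x|lborel. f x)" by simp
qed

section \<open>Limits of products of mollified functions\<close>

lemma Young2:
  fixes a b :: real
  assumes "p > 1" "q > 1" "1 / p + 1 / q = 1"
  shows "\<bar>a * b\<bar> \<le> \<bar>a\<bar> powr p + \<bar>b\<bar> powr q"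
proof -
  have "\<bar>a\<bar> * \<bar>b\<bar> \<le> \<bar>a\<bar> powr p / p + \<bar>b\<bar> powr q / q" by (rule Youngs_inequality) (use assms in auto)
  also have "\<dots> \<le> \<bar>a\<bar> powr p / 1 + \<bar>b\<bar> powr q / 1"
    using assms by (intro add_mono divide_left_mono) auto
  finally show ?thesis by (simp add: abs_mult)
qed

text \<open>\<open>Young2\<close> is used twice: for \<open>a\<close> against \<open>b * c\<close>
  with the exponent \<open>t\<close> conjugate to \<open>p\<close>, and then for the
  \<open>t\<close>-th powers of \<open>b\<close> and \<open>c\<close> with the exponents
  \<open>q / t\<close> and \<open>r / t\<close>.\<close>

lemma Young3:
  fixes a b c :: real
  assumes p: "p > 1" and q: "q > 1" and r: "r > 1" and s: "1 / p + 1 / q + 1 / r = 1"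
  shows "\<bar>a * b * c\<bar> \<le> \<bar>a\<bar> powr p + \<bar>b\<bar> powr q + \<bar>c\<bar> powr r"
proof -
  define t where "t = 1 / (1 - 1 / p)"
  have 1: "1 / p < 1" using p by simp
  have t: "t > 1" using p 1 by (simp add: t_def field_simps)
  have t1: "1 / t = 1 / q + 1 / r" using 1 s by (simp add: t_def)
  have "t / q + t / r = t * (1 / t)" unfolding t1 by (simp add: field_simps)
  then have tt: "t / q + t / r = 1" using t by simp
  have pos: "t / q > 0" "t / r > 0" using t q r by auto
  then have "t / q < 1" "t / r < 1" using tt by linarith+
  then have qt: "q / t > 1" "r / t > 1" using t q r by (auto simp: field_simps)
  have "\<bar>a * (b * c)\<bar> \<le> \<bar>a\<bar> powr p + \<bar>b * c\<bar> powr t"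
    by (rule Young2) (use p t 1 in \<open>auto simp: t_def\<close>)
  also have "\<bar>b * c\<bar> powr t = \<bar>(\<bar>b\<bar> powr t) * (\<bar>c\<bar> powr t)\<bar>" by (simp add: abs_mult powr_mult)
  also have "\<dots> \<le> \<bar>\<bar>b\<bar> powr t\<bar> powr (q / t) + \<bar>\<bar>c\<bar> powr t\<bar> powr (r / t)"
    by (rule Young2) (use qt tt in auto)
  also have "\<dots> = \<bar>b\<bar> powr q + \<bar>c\<bar> powr r" using t by (simp add: powr_powr)
  finally show ?thesis by (simp add: mult.assoc add.assoc)
qed

lemma loc1_powr: "locp p f \<Longrightarrow> loc1 (\<lambda>x. \<bar>f x\<bar> powr p)" by (simp add: locp_def)
lemma locp_measurable: "locp p f \<Longrightarrow> f \<in> borel_measurable borel" by (simp add: locp_def)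

text \<open>Young's inequality splits the product into powers, and Jensen's inequality moves the
  powers inside the mollification. The integrand is thus dominated by the mollification of a fixed
  function, as \<open>mo_dominated_convergence\<close> permits.\<close>

lemma mo_bilinear_limit:
  fixes f g c :: "'a::euclidean_space \<Rightarrow> real"
  assumes s: "strict_mono s" and f: "locp p f" and g: "locp q g"
    and p: "p > 1" "q > 1" "1 / p + 1 / q = 1"
    and ae: "aeconv s R f" "aeconv s R g" "aeconv s R (\<lambda>x. \<bar>f x\<bar> powr p)" "aeconv s R (\<lambda>x. \<bar>g x\<bar> powr q)"
    and [measurable]: "c \<in> borel_measurable borel"
    and C: "\<And>x. \<bar>c x\<bar> \<le> C" and R: "\<And>x. R < norm x \<Longrightarrow> c x = 0"
  shows "integrable lborel (\<lambda>x. c x * (mo (s n) f x * mo (s n) g x))"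
    and "integrable lborel (\<lambda>x. c x * (f x * g x))"
    and "(\<lambda>n. LINT x|lborel. c x * (mo (s n) f x * mo (s n) g x)) \<longlonglongrightarrow> (LINT x|lborel. c x * (f x * g x))"
proof -
  have l: "loc1 f" "loc1 g" using p by (auto intro: locp_loc1[OF f] locp_loc1[OF g])
  note [measurable] = l[THEN mo_measurable] f[THEN locp_measurable] g[THEN locp_measurable]
  note lp = f[THEN loc1_powr] g[THEN loc1_powr]
  have C0: "C \<ge> 0" using C[of 0] by linarith
  let ?F = "\<lambda>x. C * (\<bar>f x\<bar> powr p + \<bar>g x\<bar> powr q)"
  have F: "loc1 ?F" by (intro loc1_cmult loc1_add lp)
  have moF: "mo n ?F x = C * (mo n (\<lambda>x. \<bar>f x\<bar> powr p) x + mo n (\<lambda>x. \<bar>g x\<bar> powr q) x)" for n x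
    using mo_add[OF lp, of n x] by (simp add: mo_def conv_def mult.left_commute[of _ C])
  have aF: "aeconv s R ?F"
    using ae(3,4) unfolding aeconv_def
  proof eventually_elim
    case (elim x)
    then show ?case unfolding moF by (auto intro!: tendsto_intros)
  qed
  have lim: "AE x in lborel. (\<lambda>n. c x * (mo (s n) f x * mo (s n) g x)) \<longlonglongrightarrow> c x * (f x * g x)"
    using ae(1,2) unfolding aeconv_def
  proof eventually_elim
    case (elim x)
    then show ?case by (cases "norm x \<le> R") (auto intro!: tendsto_intros simp: R)
  qed
  have bound: "\<bar>c x * (mo (s n) f x * mo (s n) g x)\<bar> \<le> indicator (cball 0 R) x * (0 + mo (s n) ?F x)" for n x
  proof (cases "norm x \<le> R")
    case True
    have "\<bar>mo (s n) f x * mo (s n) g x\<bar> \<le> \<bar>mo (s n) f x\<bar> powr p + \<bar>mo (s n) g x\<bar> powr q"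
      by (rule Young2[OF p])
    also have "\<dots> \<le> mo (s n) (\<lambda>x. \<bar>f x\<bar> powr p) x + mo (s n) (\<lambda>x. \<bar>g x\<bar> powr q) x"
      using p by (intro add_mono mo_jensen f g) auto
    finally have "\<bar>c x\<bar> * \<bar>mo (s n) f x * mo (s n) g x\<bar> \<le> mo (s n) ?F x"
      unfolding moF using C0 C by (intro mult_mono) auto
    then show ?thesis using True by (simp add: abs_mult)
  qed (simp add: R)
  have F0: "0 \<le> ?F x" for x using C0 by simp
  note * = mo_dominated_convergence[OF s F loc1_const F0 order_refl aF _ _ lim bound]
  show "integrable lborel (\<lambda>x. c x * (mo (s n) f x * mo (s n) g x))"
    "integrable lborel (\<lambda>x. c x * (f x * g x))"
    "(\<lambda>n. LINT x|lborel. c x * (mo (s n) f x * mo (s n) g x)) \<longlonglongrightarrow> (LINT x|lborel. c x * (f x * g x))"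
    by (rule *; measurable)+
qed

text \<open>As in the bilinear case, but \<open>W\<close> is not mollified: its power forms the
  fixed part \<open>?G\<close> of the dominating function.\<close>

lemma mo_trilinear_limit:
  fixes W f g c :: "'a::euclidean_space \<Rightarrow> real"
  assumes s: "strict_mono s" and W: "locp a W" and f: "locp p f" and g: "locp q g"
    and p: "a > 1" "p > 1" "q > 1" "1 / a + 1 / p + 1 / q = 1"
    and ae: "aeconv s R f" "aeconv s R g" "aeconv s R (\<lambda>x. \<bar>f x\<bar> powr p)" "aeconv s R (\<lambda>x. \<bar>g x\<bar> powr q)"
    and [measurable]: "c \<in> borel_measurable borel"
    and C: "\<And>x. \<bar>c x\<bar> \<le> C" and R: "\<And>x. R < norm x \<Longrightarrow> c x = 0"
  shows "integrable lborel (\<lambda>x. c x * (W x * mo (s n) f x * mo (s n) g x))"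
    and "integrable lborel (\<lambda>x. c x * (W x * f x * g x))"
    and "(\<lambda>n. LINT x|lborel. c x * (W x * mo (s n) f x * mo (s n) g x)) \<longlonglongrightarrow> (LINT x|lborel. c x * (W x * f x * g x))"
proof -
  have l: "loc1 f" "loc1 g" using p by (auto intro: locp_loc1[OF f] locp_loc1[OF g])
  note [measurable] = l[THEN mo_measurable] f[THEN locp_measurable] g[THEN locp_measurable] W[THEN locp_measurable]
  note lp = f[THEN loc1_powr] g[THEN loc1_powr]
  have C0: "C \<ge> 0" using C[of 0] by linarith
  let ?F = "\<lambda>x. C * (\<bar>f x\<bar> powr p + \<bar>g x\<bar> powr q)"
  let ?G = "\<lambda>x. C * \<bar>W x\<bar> powr a"
  have F: "loc1 ?F" by (intro loc1_cmult loc1_add lp)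
  have G: "loc1 ?G" by (intro loc1_cmult loc1_powr W)
  have moF: "mo n ?F x = C * (mo n (\<lambda>x. \<bar>f x\<bar> powr p) x + mo n (\<lambda>x. \<bar>g x\<bar> powr q) x)" for n x
    using mo_add[OF lp, of n x] by (simp add: mo_def conv_def mult.left_commute[of _ C])
  have aF: "aeconv s R ?F"
    using ae(3,4) unfolding aeconv_def
  proof eventually_elim
    case (elim x)
    then show ?case unfolding moF by (auto intro!: tendsto_intros)
  qed
  have lim: "AE x in lborel. (\<lambda>n. c x * (W x * mo (s n) f x * mo (s n) g x)) \<longlonglongrightarrow> c x * (W x * f x * g x)"
    using ae(1,2) unfolding aeconv_def
  proof eventually_elim
    case (elim x)
    then show ?case by (cases "norm x \<le> R") (auto intro!: tendsto_intros simp: R)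
  qed
  have bound: "\<bar>c x * (W x * mo (s n) f x * mo (s n) g x)\<bar> \<le> indicator (cball 0 R) x * (?G x + mo (s n) ?F x)" for n x
  proof (cases "norm x \<le> R")
    case True
    have "\<bar>W x * mo (s n) f x * mo (s n) g x\<bar> \<le> \<bar>W x\<bar> powr a + \<bar>mo (s n) f x\<bar> powr p + \<bar>mo (s n) g x\<bar> powr q"
      by (rule Young3[OF p])
    also have "\<dots> \<le> \<bar>W x\<bar> powr a + mo (s n) (\<lambda>x. \<bar>f x\<bar> powr p) x + mo (s n) (\<lambda>x. \<bar>g x\<bar> powr q) x"
      using p by (intro add_mono mo_jensen f g) auto
    finally have "\<bar>c x\<bar> * \<bar>W x * mo (s n) f x * mo (s n) g x\<bar>
        \<le> C * (\<bar>W x\<bar> powr a + mo (s n) (\<lambda>x. \<bar>f x\<bar> powr p) x + mo (s n) (\<lambda>x. \<bar>g x\<bar> powr q) x)"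
      using C0 C by (intro mult_mono) auto
    then show ?thesis using True unfolding moF by (simp add: abs_mult distrib_left add.assoc)
  qed (simp add: R)
  have F0: "0 \<le> ?F x" for x using C0 by simp
  have G0: "0 \<le> ?G x" for x using C0 by simp
  note * = mo_dominated_convergence[OF s F G F0 G0 aF _ _ lim bound]
  show "integrable lborel (\<lambda>x. c x * (W x * mo (s n) f x * mo (s n) g x))"
    "integrable lborel (\<lambda>x. c x * (W x * f x * g x))"
    "(\<lambda>n. LINT x|lborel. c x * (W x * mo (s n) f x * mo (s n) g x)) \<longlonglongrightarrow> (LINT x|lborel. c x * (W x * f x * g x))"
    by (rule *; measurable)+
qed

lemma mo_zero_AE:
  assumes g: "loc1 g" and z: "\<And>n x. mo n g x = 0"
  shows "AE x in lborel. g x = 0"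
proof -
  have "AE x in lborel. norm x \<le> real k \<longrightarrow> g x = 0" for k
  proof -
    have "(\<lambda>n::nat. LINT x|lborel. indicator (cball 0 (real k)) x * \<bar>g x\<bar>) \<longlonglongrightarrow> 0"
      using mo_L1[OF g, of "real k"] by (simp add: z)
    then have "(LINT x|lborel. indicator (cball 0 (real k)) x * \<bar>g x\<bar>) = 0" by (simp add: LIMSEQ_const_iff)
    then have "AE x in lborel. indicator (cball 0 (real k)) x * \<bar>g x\<bar> = 0"
      by (subst (asm) integral_nonneg_eq_0_iff_AE[OF loc1_integrable[OF loc1_abs[OF g]]]) auto
    then show ?thesis by eventually_elim (auto simp: indicator_def)
  qed
  then have "AE x in lborel. \<forall>k::nat. norm x \<le> real k \<longrightarrow> g x = 0" unfolding AE_all_countable by blast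
  then show ?thesis by eventually_elim (use real_arch_simple in blast)
qed

text \<open>Fundamental lemma of the calculus of variations: the values of \<open>mo n g\<close> are
  integrals of \<open>g\<close> against reflected mollifiers, which are test functions.\<close>

lemma loc1_AE_zero:
  fixes g :: "'a::euclidean_space \<Rightarrow> real"
  assumes g: "loc1 g" and z: "\<And>\<phi>. test \<phi> \<Longrightarrow> (LINT x|lborel. \<phi> x * g x) = 0"
  shows "AE x in lborel. g x = 0"
  by (rule mo_zero_AE[OF g]) (unfold mo_def conv_def, rule z[OF test_reflect[OF moll_n]])

lemma cutoff_exists:
  obtains \<eta> :: "'a::euclidean_space \<Rightarrow> real" where "test \<eta>" "\<And>x. 0 \<le> \<eta> x" "\<And>x. \<eta> x \<le> 1"
    "\<And>x. norm x < 1 \<Longrightarrow> \<eta> x = 1"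
proof -
  \<comment> \<open>Mollification with \<open>n = 0\<close> has width 1. Radius 2 therefore
    preserves the value 1 on the unit ball and keeps the support within radius 3.\<close>
  let ?I = "indicator (cball 0 2) :: 'a \<Rightarrow> real"
  let ?x = "mo 0 ?I"
  have I: "loc1 ?I"
    by (rule loc1_bound[OF loc1_const[of 1] borel_measurable_indicator]) (auto simp: indicator_def)
  have one: "mo 0 (\<lambda>_. 1) x = 1" for x :: 'a
    using integral_moll_reflect[of 1 x] by (simp add: mo_def conv_def)
  have "mo 0 ?I x = 0" if "1 + 2 < norm x" for x
    unfolding mo_def by (rule conv_compact_support[OF _ _ that]) (auto intro: moll_zero)
  then have "test ?x" unfolding test_def using mo_smooth[OF I] by (intro conjI exI[of _ 3]) auto
  moreover have "0 \<le> ?x x" for x by (rule mo_nonneg) simp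
  moreover have "?x x \<le> 1" for x
    using mo_mono[OF I loc1_const[of 1], of 0 x] one[of x] by (auto simp: indicator_def)
  moreover have "?x x = 1" if "norm x < 1" for x
    using mo_local[of 1 ?I "\<lambda>_. 1" x 0] that one[of x] by auto
  ultimately show ?thesis by (rule that)
qed

section \<open>The Sobolev inequality\<close>

lemma weighted_am_gm:
  fixes x w :: "'i \<Rightarrow> real"
  assumes fin: "finite J" and w: "\<And>j. j \<in> J \<Longrightarrow> w j > 0" and sw: "(\<Sum>j\<in>J. w j) = 1"
    and x: "\<And>j. j \<in> J \<Longrightarrow> x j \<ge> 0"
  shows "(\<Prod>j\<in>J. x j powr w j) \<le> (\<Sum>j\<in>J. w j * x j)"
proof (cases "\<exists>j\<in>J. x j = 0")
  case True
  then have "(\<Prod>j\<in>J. x j powr w j) = 0" using fin by (intro prod_zero) auto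
  also have "\<dots> \<le> (\<Sum>j\<in>J. w j * x j)" using w x by (intro sum_nonneg mult_nonneg_nonneg) (auto intro: less_imp_le)
  finally show ?thesis .
next
  case False
  then have xp: "x j > 0" if "j \<in> J" for j using x[OF that] that by force
  have ne: "J \<noteq> {}" using sw by auto
  \<comment> \<open>\<open>S\<close> is the weighted arithmetic mean. The inequality
    \<open>ln y \<le> y - 1\<close> at \<open>y = x j / S\<close> has a right-hand side with
    weighted sum 0.\<close>
  define S where "S = (\<Sum>j\<in>J. w j * x j)"
  have S: "S > 0" unfolding S_def using fin ne w xp by (intro sum_pos) auto
  have "(\<Sum>j\<in>J. w j * ln (x j)) - ln S = (\<Sum>j\<in>J. w j * ln (x j)) - (\<Sum>j\<in>J. w j) * ln S"
    by (simp add: sw)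
  also have "\<dots> = (\<Sum>j\<in>J. w j * ln (x j / S))"
    unfolding sum_distrib_right sum_subtractf[symmetric]
  proof (intro sum.cong refl)
    fix j assume "j \<in> J"
    then show "w j * ln (x j) - w j * ln S = w j * ln (x j / S)"
      using xp[of j] S by (simp add: ln_div right_diff_distrib)
  qed
  also have "\<dots> \<le> (\<Sum>j\<in>J. w j * (x j / S - 1))"
    by (intro sum_mono mult_left_mono ln_le_minus_one) (use xp S w in \<open>auto intro: less_imp_le\<close>)
  also have "\<dots> = (\<Sum>j\<in>J. w j * x j) / S - (\<Sum>j\<in>J. w j)"
    by (simp add: right_diff_distrib sum_subtractf sum_divide_distrib)
  also have "\<dots> = 0" using S sw by (simp add: S_def[symmetric])
  finally have "(\<Sum>j\<in>J. w j * ln (x j)) \<le> ln S" by simp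
  then have "exp (\<Sum>j\<in>J. w j * ln (x j)) \<le> S" using S by (metis exp_le_cancel_iff exp_ln)
  moreover have "exp (\<Sum>j\<in>J. w j * ln (x j)) = (\<Prod>j\<in>J. x j powr w j)"
    unfolding exp_sum[OF fin] by (intro prod.cong refl) (use xp less_irrefl in \<open>force simp: powr_def\<close>)
  ultimately show ?thesis by (simp add: S_def)
qed

text \<open>Unlike \<open>powr\<close>, this power satisfies \<open>0\<close> to the \<open>0\<close> equals \<open>1\<close>, so factors with exponent zero may be dropped from products.\<close>

definition epow :: "ennreal \<Rightarrow> real \<Rightarrow> ennreal" where
  "epow x a = (if a = 0 then 1 else if x = top then top else ennreal (enn2real x powr a))"

lemma epow_measurable [measurable]:
  assumes [measurable]: "f \<in> borel_measurable M"
  shows "(\<lambda>x. epow (f x) a) \<in> borel_measurable M"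
  unfolding epow_def by measurable

lemma epow_0 [simp]: "epow x 0 = 1" by (simp add: epow_def)
lemma epow_zero: "a \<noteq> 0 \<Longrightarrow> epow 0 a = 0" by (simp add: epow_def)
lemma epow_top: "a \<noteq> 0 \<Longrightarrow> epow top a = top" by (simp add: epow_def)
lemma epow_ennreal: "x \<ge> 0 \<Longrightarrow> a \<noteq> 0 \<Longrightarrow> epow (ennreal x) a = ennreal (x powr a)"
  by (simp add: epow_def)

lemma epow_add: "a \<ge> 0 \<Longrightarrow> b \<ge> 0 \<Longrightarrow> epow x a * epow x b = epow x (a + b)"
  by (cases x) (auto simp: epow_def powr_add ennreal_mult ennreal_mult_top add_nonneg_eq_0_iff ennreal_top_mult)

lemma epow_mono: "a \<ge> 0 \<Longrightarrow> x \<le> y \<Longrightarrow> epow x a \<le> epow y a"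
proof -
  assume a: "a \<ge> 0" and xy: "x \<le> y"
  show ?thesis
  proof (cases "a = 0 \<or> y = top")
    case False
    then have "x \<noteq> top" "y < top" using xy by (auto simp: less_top neq_top_trans)
    then show ?thesis using False a xy enn2real_mono[OF xy] by (auto simp: epow_def intro!: ennreal_leI powr_mono2)
  qed (auto simp: epow_def)
qed

lemma epow_eq_0: "x \<noteq> 0 \<Longrightarrow> epow x a \<noteq> 0"
  by (cases x) (auto simp: epow_def)

text \<open>The weighted inequality of means is applied to the functions divided by their integrals
  and then integrated. The division needs integrals in the open interval from 0 to infinity: a zero
  integral makes the product vanish almost everywhere, and otherwise an infinite one makes the
  right-hand side infinite. Indices of weight 0 contribute the factor 1 and are removed beforehand
  by passing to \<open>K\<close>.\<close>

lemma holder_family: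
  fixes f :: "'i \<Rightarrow> 'x \<Rightarrow> ennreal"
  assumes fin: "finite J" and w: "\<And>j. j \<in> J \<Longrightarrow> w j \<ge> 0" and sw: "(\<Sum>j\<in>J. w j) = 1"
    and m: "\<And>j. j \<in> J \<Longrightarrow> f j \<in> borel_measurable M"
  shows "(\<integral>\<^sup>+x. (\<Prod>j\<in>J. epow (f j x) (w j)) \<partial>M) \<le> (\<Prod>j\<in>J. epow (\<integral>\<^sup>+x. f j x \<partial>M) (w j))"
proof -
  define K where "K = {j\<in>J. w j > 0}"
  have K: "finite K" "K \<subseteq> J" "\<And>j. j \<in> K \<Longrightarrow> w j > 0" using fin by (auto simp: K_def)
  have w0: "w j = 0" if "j \<in> J - K" for j using that w[of j] by (auto simp: K_def)
  have sK: "(\<Sum>j\<in>K. w j) = 1" using sum.mono_neutral_left[OF fin K(2), of w] w0 sw by auto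
  have pK: "(\<Prod>j\<in>J. epow (g j) (w j)) = (\<Prod>j\<in>K. epow (g j) (w j))" for g
    by (rule prod.mono_neutral_right[OF fin K(2)]) (auto simp: w0)
  define I where "I j = (\<integral>\<^sup>+x. f j x \<partial>M)" for j
  have mK: "j \<in> K \<Longrightarrow> f j \<in> borel_measurable M" for j using m K by auto
  have "(\<integral>\<^sup>+x. (\<Prod>j\<in>K. epow (f j x) (w j)) \<partial>M) \<le> (\<Prod>j\<in>K. epow (I j) (w j))"
  proof (cases "\<exists>j\<in>K. I j = 0")
    case True
    then obtain j where j: "j \<in> K" "I j = 0" by auto
    then have "AE x in M. f j x = 0" using nn_integral_0_iff_AE[OF mK[OF j(1)]] by (simp add: I_def)
    then have "AE x in M. (\<Prod>j\<in>K. epow (f j x) (w j)) = 0"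
    proof eventually_elim
      case (elim x)
      then have "epow (f j x) (w j) = 0" using K(3)[OF j(1)] by (simp add: epow_zero)
      then show ?case using K(1) j(1) by (intro prod_zero) auto
    qed
    then have "(\<integral>\<^sup>+x. (\<Prod>j\<in>K. epow (f j x) (w j)) \<partial>M) = (\<integral>\<^sup>+x. 0 \<partial>M)" by (rule nn_integral_cong_AE)
    then show ?thesis by simp
  next
    case nz: False
    show ?thesis
    proof (cases "\<exists>j\<in>K. I j = top")
      case True
      then obtain j where j: "j \<in> K" "I j = top" by auto
      have "(\<Prod>j\<in>K. epow (I j) (w j)) = epow (I j) (w j) * (\<Prod>j\<in>K-{j}. epow (I j) (w j))"
        using prod.remove[OF K(1) j(1)] .
      moreover have "(\<Prod>j\<in>K-{j}. epow (I j) (w j)) \<noteq> 0"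
        using nz K(1) by (auto simp: prod_zero_iff epow_eq_0)
      ultimately have "(\<Prod>j\<in>K. epow (I j) (w j)) = top"
        using K(3)[OF j(1)] by (simp add: j epow_top ennreal_top_mult)
      then show ?thesis by simp
    next
      case ft: False
      define a where "a j = enn2real (I j)" for j
      have a: "a j > 0" "I j = ennreal (a j)" if "j \<in> K" for j
        using nz ft that by (auto simp: a_def enn2real_positive_iff less_top zero_less_iff_neq_zero)
      have fa: "AE x in M. \<forall>j\<in>K. f j x \<noteq> top"
        unfolding AE_finite_all[OF K(1)]
        using nn_integral_PInf_AE[OF mK] ft by (auto simp: I_def)
      define P where "P = (\<Prod>j\<in>K. a j powr w j)"
      have P: "P \<ge> 0" unfolding P_def by (intro prod_nonneg) auto
      have "(\<integral>\<^sup>+x. (\<Prod>j\<in>K. epow (f j x) (w j)) \<partial>M)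
          \<le> (\<integral>\<^sup>+x. ennreal P * (\<Sum>j\<in>K. ennreal (w j / a j) * f j x) \<partial>M)"
      proof (rule nn_integral_mono_AE)
        show "AE x in M. (\<Prod>j\<in>K. epow (f j x) (w j)) \<le> ennreal P * (\<Sum>j\<in>K. ennreal (w j / a j) * f j x)"
          using fa
        proof eventually_elim
          case (elim x)
          define r where "r j = enn2real (f j x)" for j
          have r: "r j \<ge> 0" "j \<in> K \<Longrightarrow> f j x = ennreal (r j)" for j using elim by (auto simp: r_def less_top)
          have "(\<Prod>j\<in>K. epow (f j x) (w j)) = (\<Prod>j\<in>K. ennreal (r j powr w j))"
            using K(3) r by (intro prod.cong) (auto simp: epow_ennreal less_imp_neq[THEN not_sym])
          also have "\<dots> = ennreal (\<Prod>j\<in>K. r j powr w j)" by (rule prod_ennreal) auto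
          also have "(\<Prod>j\<in>K. r j powr w j) = P * (\<Prod>j\<in>K. (r j / a j) powr w j)"
            unfolding P_def prod.distrib[symmetric]
            by (intro prod.cong refl, subst powr_mult[symmetric]) (use a(1) r(1) in \<open>auto simp: less_imp_le less_imp_neq[THEN not_sym]\<close>)
          also have "ennreal \<dots> \<le> ennreal (P * (\<Sum>j\<in>K. w j * (r j / a j)))"
            by (intro ennreal_leI mult_left_mono weighted_am_gm) (use K a r P sK in \<open>auto simp: less_imp_le\<close>)
          also have "\<dots> = ennreal P * (\<Sum>j\<in>K. ennreal (w j / a j) * f j x)"
          proof -
            have "ennreal (\<Sum>j\<in>K. w j * (r j / a j)) = (\<Sum>j\<in>K. ennreal (w j * (r j / a j)))"
              by (rule sum_ennreal[symmetric]) (use K a r in \<open>auto simp: less_imp_le\<close>)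
            also have "\<dots> = (\<Sum>j\<in>K. ennreal (w j / a j) * f j x)"
            proof (intro sum.cong refl)
              fix j assume j: "j \<in> K"
              have "ennreal (w j * (r j / a j)) = ennreal ((w j / a j) * r j)" by simp
              also have "\<dots> = ennreal (w j / a j) * ennreal (r j)"
                using K(3)[OF j] a(1)[OF j] r(1)[of j] by (intro ennreal_mult) auto
              finally show "ennreal (w j * (r j / a j)) = ennreal (w j / a j) * f j x" using r(2)[OF j] by simp
            qed
            finally show ?thesis using P by (simp add: ennreal_mult')
          qed
          finally show ?case .
        qed
      qed
      also have "\<dots> = ennreal P * (\<Sum>j\<in>K. ennreal (w j / a j) * I j)"
        unfolding I_def using mK by (simp add: nn_integral_cmult nn_integral_sum)
      also have "(\<Sum>j\<in>K. ennreal (w j / a j) * I j) = (\<Sum>j\<in>K. ennreal (w j))"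
      proof (intro sum.cong refl)
        fix j assume j: "j \<in> K"
        have "ennreal (w j / a j) * I j = ennreal ((w j / a j) * a j)"
          unfolding a(2)[OF j] using a(1)[OF j] K(3)[OF j] by (intro ennreal_mult[symmetric]) auto
        then show "ennreal (w j / a j) * I j = ennreal (w j)" using a(1)[OF j] by simp
      qed
      also have "\<dots> = 1" using K sK by (subst sum_ennreal) (auto simp: less_imp_le)
      also have "ennreal P * 1 = (\<Prod>j\<in>K. epow (I j) (w j))"
      proof -
        have "ennreal P = (\<Prod>j\<in>K. ennreal (a j powr w j))" unfolding P_def by (rule prod_ennreal[symmetric]) auto
        also have "\<dots> = (\<Prod>j\<in>K. epow (I j) (w j))"
          using a K(3) by (intro prod.cong) (auto simp: epow_ennreal less_imp_le less_imp_neq[THEN not_sym])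
        finally show ?thesis by simp
      qed
      finally show ?thesis .
    qed
  qed
  then show ?thesis unfolding pK I_def[symmetric] .
qed

text \<open>The index set is extended by \<open>None\<close>, which carries the distinguished factor
  \<open>h\<close> with its own exponent \<open>w\<close>.\<close>

lemma holder_family_insert:
  fixes f :: "'i \<Rightarrow> 'x \<Rightarrow> ennreal"
  assumes fin: "finite S" and p: "p \<ge> 0" "w \<ge> 0" "w + real (card S) * p = 1"
    and h: "h \<in> borel_measurable M" and m: "\<And>j. j \<in> S \<Longrightarrow> f j \<in> borel_measurable M"
  shows "(\<integral>\<^sup>+x. epow (h x) w * (\<Prod>j\<in>S. epow (f j x) p) \<partial>M)
    \<le> epow (\<integral>\<^sup>+x. h x \<partial>M) w * (\<Prod>j\<in>S. epow (\<integral>\<^sup>+x. f j x \<partial>M) p)"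
proof -
  let ?J = "insert None (Some ` S)"
  let ?F = "\<lambda>j. case j of None \<Rightarrow> h | Some j \<Rightarrow> f j"
  let ?w = "\<lambda>j. case j of None \<Rightarrow> w | Some j \<Rightarrow> p"
  have "(\<integral>\<^sup>+x. (\<Prod>j\<in>?J. epow (?F j x) (?w j)) \<partial>M) \<le> (\<Prod>j\<in>?J. epow (\<integral>\<^sup>+x. ?F j x \<partial>M) (?w j))"
    by (rule holder_family) (use fin p h m in \<open>auto simp: sum.reindex\<close>)
  then show ?thesis using fin by (simp add: prod.reindex)
qed

text \<open>The inductive form of the Loomis--Whitney argument: replacing \<open>f\<close> by its marginal in one
  coordinate turns the statement for \<open>insert i S\<close> into the statement for \<open>S\<close>.\<close>

lemma grid_lines:
  fixes f :: "('i \<Rightarrow> real) \<Rightarrow> ennreal"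
  assumes "finite S" "p \<ge> 0" "real (card S) * p \<le> 1 + p"
    "f \<in> borel_measurable (Pi\<^sub>M S (\<lambda>_. lborel))"
  shows "(\<integral>\<^sup>+x. epow (f x) (1 - (real (card S) - 1) * p) * (\<Prod>j\<in>S. epow (\<integral>\<^sup>+t. f (x(j := t)) \<partial>lborel) p) \<partial>(Pi\<^sub>M S (\<lambda>_. lborel)))
     \<le> epow (\<integral>\<^sup>+x. f x \<partial>(Pi\<^sub>M S (\<lambda>_. lborel))) (1 + p)"
  using assms
proof (induction S arbitrary: f rule: finite_induct)
  case empty
  show ?case by (simp add: PiM_empty nn_integral_count_space_finite)
next
  case (insert i S)
  interpret product_sigma_finite "\<lambda>_::'i. lborel :: real measure"
    by (simp add: product_sigma_finite_def sigma_finite_lborel)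
  let ?P = "\<lambda>S. Pi\<^sub>M S (\<lambda>_::'i. lborel :: real measure)"
  note fm[measurable] = insert.prems(3)
  have p: "p \<ge> 0" by fact
  have cp: "real (card S) * p \<le> 1" using insert.prems(2) insert.hyps by (simp add: distrib_right)
  have upd: "(\<lambda>z. (g z)(j := h z)) \<in> measurable N (?P (insert i S))"
    if "g \<in> measurable N (?P T)" "insert j T = insert i S" "h \<in> borel_measurable N" for g h j T and N :: "'b measure"
    by (rule measurable_fun_upd[where J=T]) (use that in auto)
  have updS: "(\<lambda>z. (g z)(j := h z)) \<in> measurable N (?P S)"
    if "g \<in> measurable N (?P S)" "j \<in> S" "h \<in> borel_measurable N" for g h j and N :: "'b measure"
    by (rule measurable_fun_upd[where J=S]) (use that in auto)
  define F where "F x = (\<integral>\<^sup>+t. f (x(i := t)) \<partial>lborel)" for x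
  have Fm[measurable]: "F \<in> borel_measurable (?P S)"
  proof -
    have "(\<lambda>(x, t). f (x(i := t))) \<in> borel_measurable (?P S \<Otimes>\<^sub>M lborel)"
      unfolding split_beta by (rule measurable_compose[OF upd[of fst _ S i snd] fm]) auto
    then show ?thesis unfolding F_def by (rule lborel.borel_measurable_nn_integral)
  qed
  let ?w = "1 - real (card S) * p"
  have card: "1 - (real (card (insert i S)) - 1) * p = ?w" using insert.hyps by simp
  have marg: "(\<lambda>x. \<integral>\<^sup>+t. f (x(j := t)) \<partial>lborel) \<in> borel_measurable (?P (insert i S))" if "j \<in> insert i S" for j
  proof -
    have "(\<lambda>(x, t). f (x(j := t))) \<in> borel_measurable (?P (insert i S) \<Otimes>\<^sub>M lborel)"
      unfolding split_beta by (rule measurable_compose[OF upd[of fst _ "insert i S" j snd] fm]) (use that in auto)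
    then show ?thesis by (rule lborel.borel_measurable_nn_integral)
  qed
  have "(\<integral>\<^sup>+x. epow (f x) ?w * (\<Prod>j\<in>insert i S. epow (\<integral>\<^sup>+t. f (x(j := t)) \<partial>lborel) p) \<partial>?P (insert i S))
    = (\<integral>\<^sup>+x. \<integral>\<^sup>+y. epow (f (x(i := y))) ?w * (\<Prod>j\<in>insert i S. epow (\<integral>\<^sup>+t. f (x(i := y, j := t)) \<partial>lborel) p) \<partial>lborel \<partial>?P S)"
    by (rule product_nn_integral_insert[OF insert.hyps])
       (intro borel_measurable_times_ennreal borel_measurable_prod_ennreal epow_measurable fm marg; simp)
  also have "\<dots> \<le> (\<integral>\<^sup>+x. epow (F x) (1 - (real (card S) - 1) * p) * (\<Prod>j\<in>S. epow (\<integral>\<^sup>+t. F (x(j := t)) \<partial>lborel) p) \<partial>?P S)"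
  proof (rule nn_integral_mono)
    fix x assume x: "x \<in> space (?P S)"
    have xc: "(\<lambda>_. x) \<in> measurable N (?P S)" for N :: "'b measure" using x by simp
    have m1: "(\<lambda>y. f (x(i := y))) \<in> borel_measurable lborel"
      by (rule measurable_compose[OF upd[of "\<lambda>_. x" _ S i "\<lambda>y. y"] fm]) (use x in auto)
    have m2: "(\<lambda>(y, t). f (x(i := y, j := t))) \<in> borel_measurable (lborel \<Otimes>\<^sub>M lborel)" if "j \<in> S" for j
      unfolding split_beta
    proof (rule measurable_compose[OF upd[of "\<lambda>z. x(i := fst z)" _ "insert i S" j snd] fm])
      show "(\<lambda>z. x(i := fst z)) \<in> measurable (lborel \<Otimes>\<^sub>M lborel) (?P (insert i S))"
        by (rule upd[of "\<lambda>_. x" _ S i fst]) (use x in auto)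
    qed (use that in auto)
    have ij: "j \<noteq> i" if "j \<in> S" for j using that insert.hyps by auto
    have "(\<integral>\<^sup>+y. epow (f (x(i := y))) ?w * (\<Prod>j\<in>insert i S. epow (\<integral>\<^sup>+t. f (x(i := y, j := t)) \<partial>lborel) p) \<partial>lborel)
      = (\<integral>\<^sup>+y. epow (F x) p * (epow (f (x(i := y))) ?w * (\<Prod>j\<in>S. epow (\<integral>\<^sup>+t. f (x(i := y, j := t)) \<partial>lborel) p)) \<partial>lborel)"
      using insert.hyps by (intro nn_integral_cong) (simp add: F_def mult_ac)
    also have "\<dots> = epow (F x) p * (\<integral>\<^sup>+y. epow (f (x(i := y))) ?w * (\<Prod>j\<in>S. epow (\<integral>\<^sup>+t. f (x(i := y, j := t)) \<partial>lborel) p) \<partial>lborel)"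
      by (rule nn_integral_cmult)
         (intro borel_measurable_times_ennreal borel_measurable_prod_ennreal epow_measurable m1 lborel.borel_measurable_nn_integral m2)
    \<comment> \<open>Hoelder's inequality in the new variable \<open>y\<close>, where
      \<open>?w\<close> and \<open>card S\<close> times \<open>p\<close> add up to 1. The factor for
      \<open>j = i\<close> does not depend on \<open>y\<close> and has been taken out as
      \<open>epow (F x) p\<close>.\<close>
    also have "\<dots> \<le> epow (F x) p * (epow (\<integral>\<^sup>+y. f (x(i := y)) \<partial>lborel) ?w * (\<Prod>j\<in>S. epow (\<integral>\<^sup>+y. \<integral>\<^sup>+t. f (x(i := y, j := t)) \<partial>lborel \<partial>lborel) p))"
    proof (intro mult_left_mono holder_family_insert lborel.borel_measurable_nn_integral)
      show "(\<lambda>(y, t). f (x(i := y, j := t))) \<in> borel_measurable (lborel \<Otimes>\<^sub>M lborel)" if "j \<in> S" for j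
        by (rule m2[OF that])
    qed (use insert.hyps p cp m1 in auto)
    also have "\<dots> = (epow (F x) p * epow (F x) ?w) * (\<Prod>j\<in>S. epow (\<integral>\<^sup>+t. F (x(j := t)) \<partial>lborel) p)"
    proof -
      have "(\<integral>\<^sup>+y. \<integral>\<^sup>+t. f (x(i := y, j := t)) \<partial>lborel \<partial>lborel) = (\<integral>\<^sup>+t. F (x(j := t)) \<partial>lborel)" if "j \<in> S" for j
      proof -
        have "(\<integral>\<^sup>+y. \<integral>\<^sup>+t. f (x(i := y, j := t)) \<partial>lborel \<partial>lborel) = (\<integral>\<^sup>+t. \<integral>\<^sup>+y. f (x(i := y, j := t)) \<partial>lborel \<partial>lborel)"
          by (rule lborel_pair.Fubini'[OF m2[OF that], symmetric])
        also have "\<dots> = (\<integral>\<^sup>+t. F (x(j := t)) \<partial>lborel)"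
          unfolding F_def using ij[OF that] by (simp add: fun_upd_twist)
        finally show ?thesis .
      qed
      then have "(\<Prod>j\<in>S. epow (\<integral>\<^sup>+y. \<integral>\<^sup>+t. f (x(i := y, j := t)) \<partial>lborel \<partial>lborel) p) = (\<Prod>j\<in>S. epow (\<integral>\<^sup>+t. F (x(j := t)) \<partial>lborel) p)"
        by (intro prod.cong) auto
      then show ?thesis by (simp add: F_def mult.assoc)
    qed
    \<comment> \<open>The factor taken out and the one produced by Hoelder combine to the exponent
      in the induction hypothesis for \<open>F\<close>.\<close>
    also have "epow (F x) p * epow (F x) ?w = epow (F x) (1 - (real (card S) - 1) * p)"
      using p cp by (subst epow_add) (auto simp: algebra_simps)
    finally show "(\<integral>\<^sup>+y. epow (f (x(i := y))) ?w * (\<Prod>j\<in>insert i S. epow (\<integral>\<^sup>+t. f (x(i := y, j := t)) \<partial>lborel) p) \<partial>lborel)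
      \<le> epow (F x) (1 - (real (card S) - 1) * p) * (\<Prod>j\<in>S. epow (\<integral>\<^sup>+t. F (x(j := t)) \<partial>lborel) p)" .
  qed
  also have "\<dots> \<le> epow (\<integral>\<^sup>+x. F x \<partial>?P S) (1 + p)"
    using cp p by (intro insert.IH Fm) auto
  also have "(\<integral>\<^sup>+x. F x \<partial>?P S) = (\<integral>\<^sup>+x. f x \<partial>?P (insert i S))"
    unfolding F_def by (rule product_nn_integral_insert[OF insert.hyps fm, symmetric])
  finally show ?case unfolding card .
qed

text \<open>At \<open>p = 1 / (d - 1)\<close>, with \<open>d\<close> the dimension, the exponent of
  \<open>h\<close> itself in \<open>grid_lines\<close> is 0, so only the line integrals remain.
  Resetting coordinate \<open>j\<close> and moving from the given point describe the same line, by
  translation invariance on the real line.\<close>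

lemma loomis_whitney:
  fixes h :: "'a::euclidean_space \<Rightarrow> ennreal"
  assumes [measurable]: "h \<in> borel_measurable borel" and d: "DIM('a) \<ge> 2"
  shows "(\<integral>\<^sup>+v. (\<Prod>j\<in>Basis. epow (\<integral>\<^sup>+t. h (v + t *\<^sub>R j) \<partial>lborel) (1 / (real DIM('a) - 1))) \<partial>lborel)
    \<le> epow (\<integral>\<^sup>+v. h v \<partial>lborel) (1 + 1 / (real DIM('a) - 1))"
proof -
  let ?p = "1 / (real DIM('a) - 1)"
  let ?P = "Pi\<^sub>M (Basis::'a set) (\<lambda>_. lborel :: real measure)"
  let ?e = "\<lambda>x. \<Sum>b\<in>(Basis::'a set). x b *\<^sub>R b"
  have [measurable]: "?e \<in> measurable ?P borel" by measurable
  have int: "(\<integral>\<^sup>+v. g v \<partial>lborel) = (\<integral>\<^sup>+x. g (?e x) \<partial>?P)" if [measurable]: "g \<in> borel_measurable borel" for g :: "'a \<Rightarrow> ennreal"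
    by (subst lborel_eq) (simp add: nn_integral_distr)
  have marg: "(\<integral>\<^sup>+t. h (?e (x(j := t))) \<partial>lborel) = (\<integral>\<^sup>+t. h (?e x + t *\<^sub>R j) \<partial>lborel)" if j: "j \<in> Basis" for x j
  proof -
    have e: "?e (x(j := t)) = ?e x + (t - x j) *\<^sub>R j" for t
    proof -
      have "?e (x(j := t)) = t *\<^sub>R j + (\<Sum>b\<in>Basis - {j}. x b *\<^sub>R b)"
        using j by (subst sum.remove[of _ j]) auto
      also have "\<dots> = ?e x + (t - x j) *\<^sub>R j"
        using j by (subst (2) sum.remove[of _ j]) (auto simp: algebra_simps)
      finally show ?thesis .
    qed
    have "(\<integral>\<^sup>+t. h (?e x + (t - x j) *\<^sub>R j) \<partial>lborel) = (\<integral>\<^sup>+t. h (?e x + t *\<^sub>R j) \<partial>lborel)"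
      using nn_integral_real_affine[of "\<lambda>t. h (?e x + t *\<^sub>R j)" 1 "- x j"] by simp
    then show ?thesis unfolding e .
  qed
  have dd: "real DIM('a) - 1 > 0" using d by simp
  have "(\<integral>\<^sup>+x. epow (h (?e x)) (1 - (real (card (Basis::'a set)) - 1) * ?p) *
       (\<Prod>j\<in>Basis. epow (\<integral>\<^sup>+t. h (?e (x(j := t))) \<partial>lborel) ?p) \<partial>?P) \<le> epow (\<integral>\<^sup>+x. h (?e x) \<partial>?P) (1 + ?p)"
  proof (rule grid_lines)
    show "real (card (Basis::'a set)) * ?p \<le> 1 + ?p" using dd by (simp add: field_simps)
  qed (use dd in auto)
  moreover have "epow (h (?e x)) (1 - (real (card (Basis::'a set)) - 1) * ?p) * (\<Prod>j\<in>Basis. epow (\<integral>\<^sup>+t. h (?e (x(j := t))) \<partial>lborel) ?p)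
      = (\<Prod>j\<in>Basis. epow (\<integral>\<^sup>+t. h (?e x + t *\<^sub>R j) \<partial>lborel) ?p)" for x
    using dd marg by (simp del: fun_upd_apply cong: prod.cong)
  ultimately have "(\<integral>\<^sup>+x. (\<Prod>j\<in>Basis. epow (\<integral>\<^sup>+t. h (?e x + t *\<^sub>R j) \<partial>lborel) ?p) \<partial>?P) \<le> epow (\<integral>\<^sup>+v. h v \<partial>lborel) (1 + ?p)"
    unfolding int[OF assms(1)] by simp
  then show ?thesis by (subst int) simp_all
qed

section \<open>The Gagliardo-Nirenberg-Sobolev inequality for test functions\<close>

lemma DERIV_pos_powr:
  fixes \<gamma> :: real
  assumes g: "\<gamma> > 1"
  shows "((\<lambda>s. max s 0 powr \<gamma>) has_real_derivative \<gamma> * max s 0 powr (\<gamma> - 1)) (at s)"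
proof -
  consider "s > 0" | "s < 0" | "s = 0" by linarith
  then show ?thesis
  proof cases
    case 1
    have "((\<lambda>s. s powr \<gamma>) has_real_derivative \<gamma> * max s 0 powr (\<gamma> - 1)) (at s)"
      using 1 has_real_derivative_powr[OF 1, of \<gamma>] by simp
    then show ?thesis
      by (rule has_field_derivative_transform_within_open[where S="{0<..}"]) (use 1 in auto)
  next
    case 2
    have "((\<lambda>s. 0) has_real_derivative \<gamma> * max s 0 powr (\<gamma> - 1)) (at s)" using 2 by simp
    then show ?thesis
      by (rule has_field_derivative_transform_within_open[where S="{..<0}"]) (use 2 in auto)
  next
    case 3
    \<comment> \<open>The difference quotient at 0 is at most
      \<open>\<bar>h\<bar> powr (\<gamma> - 1)\<close>; here \<open>\<gamma> > 1\<close> is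
      used.\<close>
    have "((\<lambda>h. max h 0 powr \<gamma> / h) \<longlongrightarrow> 0) (at 0)"
    proof (rule tendsto_0_le[where K=1])
      have "((\<lambda>h::real. \<bar>h\<bar> powr (\<gamma> - 1)) \<longlongrightarrow> \<bar>0\<bar> powr (\<gamma> - 1)) (at 0)"
        by (rule tendsto_powr'[OF tendsto_rabs[OF tendsto_ident_at] tendsto_const]) (use g in auto)
      then show "((\<lambda>h::real. \<bar>h\<bar> powr (\<gamma> - 1)) \<longlongrightarrow> 0) (at 0)" by simp
      show "\<forall>\<^sub>F h in at 0. norm (max h 0 powr \<gamma> / h) \<le> norm (\<bar>h\<bar> powr (\<gamma> - 1)) * 1"
      proof (intro always_eventually allI)
        fix h :: real
        show "norm (max h 0 powr \<gamma> / h) \<le> norm (\<bar>h\<bar> powr (\<gamma> - 1)) * 1"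
        proof (cases "h > 0")
          case False
          then have "max h 0 = 0" by simp
          then show ?thesis by simp
        qed (simp add: powr_diff)
      qed
    qed
    then show ?thesis using 3 by (simp add: DERIV_def)
  qed
qed

lemma abs_powr_split: "\<gamma> > 0 \<Longrightarrow> \<bar>s\<bar> powr \<gamma> = max s 0 powr \<gamma> + max (- s) 0 powr (\<gamma> :: real)"
  by (cases "s \<ge> 0") (auto simp: max_def)

text \<open>The fundamental theorem of calculus for \<open>\<bar>u\<bar> powr \<gamma>\<close> along
  the line through \<open>v\<close> in direction \<open>j\<close>, starting at a point outside the
  support of \<open>u\<close>. The power is differentiated through the positive and negative parts
  of \<open>u\<close>.\<close>

lemma test_powr_line_bound:
  fixes u :: "'a::euclidean_space \<Rightarrow> real"
  assumes u: "test u" and j: "j \<in> Basis" and g: "\<gamma> > 1"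
  shows "ennreal (\<bar>u v\<bar> powr \<gamma>) \<le> (\<integral>\<^sup>+t. ennreal (\<gamma> * \<bar>u (v + t *\<^sub>R j)\<bar> powr (\<gamma> - 1) * \<bar>pd j u (v + t *\<^sub>R j)\<bar>) \<partial>lborel)"
proof -
  obtain R where R: "R > 0" "\<And>x. R < norm x \<Longrightarrow> u x = 0" using test_bound[OF u] by blast
  define T where "T = R + norm v + 1"
  have T: "T > 0" using R(1) norm_ge_zero[of v] unfolding T_def by linarith
  define a where "a t = u (v + t *\<^sub>R j)" for t
  define b where "b t = pd j u (v + t *\<^sub>R j)" for t
  have ab: "(a has_real_derivative b t) (at t)" for t
    unfolding a_def b_def by (rule smooth_line_derivative[OF test_smooth[OF u] j])
  have ca: "continuous_on UNIV a" unfolding a_def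
    by (rule continuous_on_compose2[OF smooth_continuous[OF test_smooth[OF u]]]) (auto intro!: continuous_intros)
  have cb: "continuous_on UNIV b" unfolding b_def
    by (rule continuous_on_compose2[OF smooth_continuous[OF smooth_pd[OF test_smooth[OF u] j]]]) (auto intro!: continuous_intros)
  define F where "F t = \<bar>a t\<bar> powr \<gamma>" for t
  define f where "f t = \<gamma> * (max (a t) 0 powr (\<gamma> - 1) - max (- a t) 0 powr (\<gamma> - 1)) * b t" for t
  have Ff: "(F has_real_derivative f t) (at t)" for t
  proof -
    have 1: "((\<lambda>t. max (a t) 0 powr \<gamma>) has_real_derivative \<gamma> * max (a t) 0 powr (\<gamma> - 1) * b t) (at t)"
      by (rule DERIV_chain2[OF DERIV_pos_powr[OF g] ab])
    have 2: "((\<lambda>t. max (- a t) 0 powr \<gamma>) has_real_derivative \<gamma> * max (- a t) 0 powr (\<gamma> - 1) * (- b t)) (at t)"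
      by (rule DERIV_chain2[OF DERIV_pos_powr[OF g] DERIV_minus[OF ab]])
    have "F = (\<lambda>t. max (a t) 0 powr \<gamma> + max (- a t) 0 powr \<gamma>)"
      using g by (auto simp: F_def abs_powr_split)
    then show ?thesis unfolding f_def using DERIV_add[OF 1 2] by (simp add: algebra_simps)
  qed
  have cp: "continuous_on S (\<lambda>t. max (h t) 0 powr (\<gamma> - 1))" if "continuous_on UNIV h" for h S
    by (rule continuous_on_powr') (use g that continuous_on_subset in \<open>auto intro!: continuous_intros\<close>)
  have cm: "continuous_on UNIV (\<lambda>t. - a t)" using ca by (rule continuous_on_minus)
  have cf: "continuous_on S f" for S unfolding f_def
    using cb by (intro continuous_on_mult continuous_on_const continuous_on_diff cp ca cm) (auto intro: continuous_on_subset)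
  have int: "(LINT t|lborel. indicator {-T..0} t *\<^sub>R f t) = F 0 - F (-T)"
    by (rule integral_FTC_atLeastAtMost)
       (use T Ff cf in \<open>auto simp: has_real_derivative_iff_has_vector_derivative[symmetric] intro: DERIV_subset\<close>)
  have "norm (v + (-T) *\<^sub>R j) > R"
  proof -
    have "norm ((-T) *\<^sub>R j) \<le> norm (v + (-T) *\<^sub>R j) + norm v"
      using norm_triangle_ineq4[of "v + (-T) *\<^sub>R j" v] by simp
    then show ?thesis using T j by (simp add: T_def)
  qed
  then have "F (-T) = 0" using R(2) by (simp add: F_def a_def)
  then have F0: "F 0 = (LINT t|lborel. indicator {-T..0} t *\<^sub>R f t)" using int by simp
  have if': "integrable lborel (\<lambda>t. indicator {-T..0} t *\<^sub>R f t)"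
    by (rule borel_integrable_compact[OF compact_Icc cf])
  have "ennreal (\<bar>u v\<bar> powr \<gamma>) = ennreal (norm (LINT t|lborel. indicator {-T..0} t *\<^sub>R f t))"
    using F0[symmetric] by (simp add: F_def a_def)
  also have "\<dots> \<le> (\<integral>\<^sup>+t. norm (indicator {-T..0} t *\<^sub>R f t) \<partial>lborel)"
    by (rule integral_norm_bound_ennreal[OF if'])
  also have "\<dots> \<le> (\<integral>\<^sup>+t. ennreal (\<gamma> * \<bar>a t\<bar> powr (\<gamma> - 1) * \<bar>b t\<bar>) \<partial>lborel)"
  proof (intro nn_integral_mono ennreal_leI)
    fix t
    have "\<bar>max (a t) 0 powr (\<gamma> - 1) - max (- a t) 0 powr (\<gamma> - 1)\<bar> = \<bar>a t\<bar> powr (\<gamma> - 1)"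
      using g by (cases "a t \<ge> 0") (auto simp: max_def)
    then have "\<bar>f t\<bar> = \<gamma> * \<bar>a t\<bar> powr (\<gamma> - 1) * \<bar>b t\<bar>" using g by (simp add: f_def abs_mult)
    then show "norm (indicator {-T..0} t *\<^sub>R f t) \<le> \<gamma> * \<bar>a t\<bar> powr (\<gamma> - 1) * \<bar>b t\<bar>"
      by (auto simp: indicator_def)
  qed
  finally show ?thesis unfolding a_def b_def .
qed

lemma powr_continuous:
  assumes "continuous_on S f" "p > 0"
  shows "continuous_on S (\<lambda>x. \<bar>f x\<bar> powr (p::real))"
  by (rule continuous_on_powr') (use assms in \<open>auto intro!: continuous_intros\<close>)

text \<open>Taking the \<open>d\<close>-th root-type product of the line bounds over all directions,
  Loomis-Whitney controls the integral of \<open>\<bar>u\<bar> powr q\<close> by a power of the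
  integral of \<open>G\<close>, and Hoelder separates \<open>u\<close> from its gradient. The choice
  of \<open>\<gamma>\<close> satisfies \<open>\<gamma> * d / (d - 1) = q\<close> and
  \<open>\<gamma> - 1 = q * (1 - 1 / p)\<close>, with \<open>d\<close> the dimension, so the same
  integral \<open>A\<close> appears on both sides, on the right with an exponent
  \<open>\<theta> < 1\<close>. The bound depends on \<open>u\<close> only through \<open>B\<close>,
  which makes it uniform along approximating sequences.\<close>

lemma sobolev_test:
  fixes p :: real
  assumes p: "1 < p" "p < real DIM('a::euclidean_space)"
  shows "\<exists>C. \<forall>u. test u \<longrightarrow> (LINT x|lborel. (\<Sum>i\<in>Basis. \<bar>pd i u x\<bar>) powr p) \<le> B \<longrightarrow>
     (LINT x|lborel. \<bar>u (x::'a)\<bar> powr (p * real DIM('a) / (real DIM('a) - p))) \<le> C"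
proof -
  let ?d = "real DIM('a)"
  define q where "q = p * ?d / (?d - p)"
  define \<gamma> where "\<gamma> = p * (?d - 1) / (?d - p)"
  have d1: "?d > 1" using p by simp
  have d2: "DIM('a) \<ge> 2" using d1 by simp
  have \<gamma>: "\<gamma> > 1"
  proof -
    have "?d < p * ?d" using p d1 by simp
    then show ?thesis using p by (simp add: \<gamma>_def field_simps)
  qed
  have q: "q > 0" using p d1 by (simp add: q_def)
  have e1: "1 + 1 / (?d - 1) = ?d / (?d - 1)" using d1 by (simp add: field_simps)
  have e2: "\<gamma> * (?d / (?d - 1)) = q" using d1 p by (simp add: \<gamma>_def q_def)
  have e3: "(\<gamma> - 1) = q * (1 - 1 / p)" using d1 p by (simp add: \<gamma>_def q_def field_simps)
  define \<theta> where "\<theta> = (1 - 1 / p) * (?d / (?d - 1))"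
  define \<delta> where "\<delta> = (1 / p) * (?d / (?d - 1))"
  have \<theta>: "\<theta> < 1"
  proof -
    have "\<theta> = (p * ?d - ?d) / (p * ?d - p)" using p d1 by (simp add: \<theta>_def field_simps)
    also have "\<dots> < 1" using p d1 by (simp add: field_simps)
    finally show ?thesis .
  qed
  have \<delta>: "\<delta> > 0" using p d1 by (simp add: \<delta>_def)
  define K where "K = \<gamma> powr (?d / (?d - 1))"
  have K: "K > 0" using \<gamma> by (simp add: K_def)
  show ?thesis
  proof (intro exI[of _ "(K * (max B 0) powr \<delta>) powr (1 / (1 - \<theta>))"] allI impI)
    fix u :: "'a \<Rightarrow> real"
    let ?N = "\<lambda>x. \<Sum>i\<in>(Basis::'a set). \<bar>pd i u x\<bar>"
    assume u: "test u" and B: "(LINT x|lborel. ?N x powr p) \<le> B"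
    obtain R where R: "R > 0" "\<And>x. R < norm x \<Longrightarrow> u x = 0" using test_bound[OF u] by blast
    have cu: "continuous_on UNIV u" by (rule smooth_continuous[OF test_smooth[OF u]])
    have cN: "continuous_on UNIV ?N"
      by (intro continuous_on_sum continuous_on_rabs smooth_continuous smooth_pd test_smooth[OF u])
    have [measurable]: "u \<in> borel_measurable borel" "?N \<in> borel_measurable borel"
      using cu cN by (auto intro: borel_measurable_continuous_onI)
    have N0: "?N x \<ge> 0" for x by (intro sum_nonneg) auto
    define A where "A = (LINT x|lborel. \<bar>u x\<bar> powr q)"
    define b where "b = (LINT x|lborel. ?N x powr p)"
    have A0: "A \<ge> 0" and b0: "b \<ge> 0" by (auto simp: A_def b_def)
    have iA: "integrable lborel (\<lambda>x. \<bar>u x\<bar> powr q)"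
      by (rule compact_support_integrable[OF powr_continuous[OF cu q], of R]) (use R q in auto)
    have ib: "integrable lborel (\<lambda>x. ?N x powr p)"
    proof (rule compact_support_integrable[of _ R])
      have "continuous_on UNIV (\<lambda>x. \<bar>?N x\<bar> powr p)" by (rule powr_continuous[OF cN]) (use p in auto)
      then show "continuous_on UNIV (\<lambda>x. ?N x powr p)" using N0 by simp
      show "?N x powr p = 0" if "R < norm x" for x using pd_zero_outside[OF R(2) that] by simp
    qed
    have nA: "(\<integral>\<^sup>+x. ennreal (\<bar>u x\<bar> powr q) \<partial>lborel) = ennreal A"
      unfolding A_def by (rule nn_integral_eq_integral[OF iA]) auto
    have nb: "(\<integral>\<^sup>+x. ennreal (?N x powr p) \<partial>lborel) = ennreal b"
      unfolding b_def by (rule nn_integral_eq_integral[OF ib]) auto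
    define G where "G x = ennreal (\<gamma> * \<bar>u x\<bar> powr (\<gamma> - 1) * ?N x)" for x
    have [measurable]: "G \<in> borel_measurable borel" unfolding G_def by measurable
    have dp: "1 / (?d - 1) > 0" using d1 by simp
    have "ennreal A \<le> (\<integral>\<^sup>+v. (\<Prod>j\<in>Basis. epow (\<integral>\<^sup>+t. G (v + t *\<^sub>R j) \<partial>lborel) (1 / (?d - 1))) \<partial>lborel)"
      unfolding nA[symmetric]
    proof (rule nn_integral_mono)
      fix v
      have "ennreal (\<bar>u v\<bar> powr q) = ennreal (\<Prod>j\<in>(Basis::'a set). (\<bar>u v\<bar> powr \<gamma>) powr (1 / (?d - 1)))"
      proof -
        have "(\<Prod>j\<in>(Basis::'a set). (\<bar>u v\<bar> powr \<gamma>) powr (1 / (?d - 1))) = (\<bar>u v\<bar> powr (\<gamma> * (1 / (?d - 1)))) ^ DIM('a)"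
          by (simp add: powr_powr)
        also have "\<dots> = \<bar>u v\<bar> powr (?d * (\<gamma> * (1 / (?d - 1))))"
        proof (cases "u v = 0")
          case False
          show ?thesis by (rule powr_power) (use False in simp)
        qed simp
        also have "?d * (\<gamma> * (1 / (?d - 1))) = q" using e2 by (simp add: mult_ac)
        finally show ?thesis by (simp only:)
      qed
      also have "\<dots> = (\<Prod>j\<in>(Basis::'a set). epow (ennreal (\<bar>u v\<bar> powr \<gamma>)) (1 / (?d - 1)))"
        using dp by (subst prod_ennreal[symmetric]) (auto simp: epow_ennreal)
      also have "\<dots> \<le> (\<Prod>j\<in>Basis. epow (\<integral>\<^sup>+t. G (v + t *\<^sub>R j) \<partial>lborel) (1 / (?d - 1)))"
      proof (intro prod_mono_ennreal epow_mono)
        fix j :: 'a assume j: "j \<in> Basis"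
        have "ennreal (\<bar>u v\<bar> powr \<gamma>) \<le> (\<integral>\<^sup>+t. ennreal (\<gamma> * \<bar>u (v + t *\<^sub>R j)\<bar> powr (\<gamma> - 1) * \<bar>pd j u (v + t *\<^sub>R j)\<bar>) \<partial>lborel)"
          by (rule test_powr_line_bound[OF u j \<gamma>])
        also have "\<dots> \<le> (\<integral>\<^sup>+t. G (v + t *\<^sub>R j) \<partial>lborel)"
          unfolding G_def
          by (intro nn_integral_mono ennreal_leI mult_left_mono member_le_sum j) (use \<gamma> in auto)
        finally show "ennreal (\<bar>u v\<bar> powr \<gamma>) \<le> (\<integral>\<^sup>+t. G (v + t *\<^sub>R j) \<partial>lborel)" .
      qed (use dp in auto)
      finally show "ennreal (\<bar>u v\<bar> powr q) \<le> (\<Prod>j\<in>Basis. epow (\<integral>\<^sup>+t. G (v + t *\<^sub>R j) \<partial>lborel) (1 / (?d - 1)))" .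
    qed
    also have "\<dots> \<le> epow (\<integral>\<^sup>+v. G v \<partial>lborel) (1 + 1 / (?d - 1))"
      by (rule loomis_whitney[OF _ d2]) measurable
    \<comment> \<open>Hoelder's inequality with weights \<open>1 - 1 / p\<close> and
      \<open>1 / p\<close>, the two factors being indexed by booleans.\<close>
    also have "\<dots> \<le> epow (ennreal (\<gamma> * (A powr (1 - 1 / p) * b powr (1 / p)))) (1 + 1 / (?d - 1))"
    proof (intro epow_mono)
      have "G x = ennreal \<gamma> * ennreal (\<bar>u x\<bar> powr (\<gamma> - 1) * ?N x)" for x
        unfolding G_def mult.assoc by (rule ennreal_mult) (use \<gamma> N0 in auto)
      then have G_eq: "(\<integral>\<^sup>+v. G v \<partial>lborel) = ennreal \<gamma> * (\<integral>\<^sup>+x. ennreal (\<bar>u x\<bar> powr (\<gamma> - 1) * ?N x) \<partial>lborel)"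
        by (simp add: nn_integral_cmult)
      have "(\<integral>\<^sup>+x. ennreal (\<bar>u x\<bar> powr (\<gamma> - 1) * ?N x) \<partial>lborel)
         = (\<integral>\<^sup>+x. (\<Prod>j\<in>{True,False}. epow (if j then ennreal (\<bar>u x\<bar> powr q) else ennreal (?N x powr p)) (if j then 1 - 1 / p else 1 / p)) \<partial>lborel)"
      proof (rule nn_integral_cong)
        fix x
        have p': "1 - 1 / p \<noteq> 0" "1 / p \<noteq> 0" using p by auto
        have "(\<bar>u x\<bar> powr q) powr (1 - 1 / p) = \<bar>u x\<bar> powr (\<gamma> - 1)" unfolding e3 by (rule powr_powr)
        then have 1: "epow (ennreal (\<bar>u x\<bar> powr q)) (1 - 1 / p) = ennreal (\<bar>u x\<bar> powr (\<gamma> - 1))"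
          by (subst epow_ennreal[OF _ p'(1)]) auto
        have "(?N x powr p) powr (1 / p) = ?N x" using p N0[of x] by (simp add: powr_powr)
        then have 2: "epow (ennreal (?N x powr p)) (1 / p) = ennreal (?N x)"
          by (subst epow_ennreal[OF _ p'(2)]) auto
        have "ennreal (\<bar>u x\<bar> powr (\<gamma> - 1) * ?N x) = ennreal (\<bar>u x\<bar> powr (\<gamma> - 1)) * ennreal (?N x)"
          by (rule ennreal_mult) (use N0 in auto)
        also have "\<dots> = (\<Prod>j\<in>{True,False}. epow (if j then ennreal (\<bar>u x\<bar> powr q) else ennreal (?N x powr p)) (if j then 1 - 1 / p else 1 / p))"
          unfolding 1[symmetric] 2[symmetric] by simp
        finally show "ennreal (\<bar>u x\<bar> powr (\<gamma> - 1) * ?N x) = (\<Prod>j\<in>{True,False}. epow (if j then ennreal (\<bar>u x\<bar> powr q) else ennreal (?N x powr p)) (if j then 1 - 1 / p else 1 / p))" .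
      qed
      also have "\<dots> \<le> (\<Prod>j\<in>{True,False}. epow (\<integral>\<^sup>+x. (if j then ennreal (\<bar>u x\<bar> powr q) else ennreal (?N x powr p)) \<partial>lborel) (if j then 1 - 1 / p else 1 / p))"
        by (rule holder_family) (use p in auto)
      also have "\<dots> = ennreal (A powr (1 - 1 / p) * b powr (1 / p))"
      proof -
        have p': "1 - 1 / p \<noteq> 0" "1 / p \<noteq> 0" using p by auto
        have "(\<Prod>j\<in>{True,False}. epow (\<integral>\<^sup>+x. (if j then ennreal (\<bar>u x\<bar> powr q) else ennreal (?N x powr p)) \<partial>lborel) (if j then 1 - 1 / p else 1 / p))
          = epow (ennreal A) (1 - 1 / p) * epow (ennreal b) (1 / p)"
          by (simp only: prod.insert finite.intros prod.empty insert_iff empty_iff simp_thms if_True if_False nA nb mult_1_right)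
        also have "\<dots> = ennreal (A powr (1 - 1 / p)) * ennreal (b powr (1 / p))"
          unfolding epow_ennreal[OF A0 p'(1)] epow_ennreal[OF b0 p'(2)] ..
        also have "\<dots> = ennreal (A powr (1 - 1 / p) * b powr (1 / p))"
          by (rule ennreal_mult[symmetric]) auto
        finally show ?thesis .
      qed
      finally have "(\<integral>\<^sup>+x. ennreal (\<bar>u x\<bar> powr (\<gamma> - 1) * ?N x) \<partial>lborel) \<le> ennreal (A powr (1 - 1 / p) * b powr (1 / p))" .
      then have "ennreal \<gamma> * (\<integral>\<^sup>+x. ennreal (\<bar>u x\<bar> powr (\<gamma> - 1) * ?N x) \<partial>lborel) \<le> ennreal \<gamma> * ennreal (A powr (1 - 1 / p) * b powr (1 / p))"
        by (rule mult_left_mono) auto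
      also have "\<dots> = ennreal (\<gamma> * (A powr (1 - 1 / p) * b powr (1 / p)))"
        by (rule ennreal_mult[symmetric]) (use \<gamma> in auto)
      finally show "(\<integral>\<^sup>+v. G v \<partial>lborel) \<le> ennreal (\<gamma> * (A powr (1 - 1 / p) * b powr (1 / p)))"
        unfolding G_eq .
    qed (use d1 in auto)
    also have "\<dots> = ennreal ((\<gamma> * (A powr (1 - 1 / p) * b powr (1 / p))) powr (?d / (?d - 1)))"
      unfolding e1 using \<gamma> d1 by (subst epow_ennreal) auto
    also have "\<dots> = ennreal (K * (A powr \<theta> * b powr \<delta>))"
      unfolding K_def \<theta>_def \<delta>_def using \<gamma> by (simp add: powr_mult powr_powr)
    finally have AA: "A \<le> K * (A powr \<theta> * b powr \<delta>)" using K by (simp add: ennreal_le_iff)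
    \<comment> \<open>Since \<open>\<theta> < 1\<close>, the power of \<open>A\<close> on the right
      is absorbed by division; \<open>A\<close> is a finite number because \<open>u\<close> is a
      test function.\<close>
    have "A \<le> (K * (max B 0) powr \<delta>) powr (1 / (1 - \<theta>))"
    proof (cases "A = 0")
      case False
      then have Ap: "A > 0" using A0 by simp
      have "A powr (1 - \<theta>) = A / A powr \<theta>" using Ap by (simp add: powr_diff)
      also have "\<dots> \<le> K * b powr \<delta>" using AA Ap by (simp add: field_simps)
      also have "\<dots> \<le> K * (max B 0) powr \<delta>"
        using K B b0 \<delta> by (intro mult_left_mono powr_mono2) (auto simp: b_def)
      finally have "(A powr (1 - \<theta>)) powr (1 / (1 - \<theta>)) \<le> (K * (max B 0) powr \<delta>) powr (1 / (1 - \<theta>))"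
        using \<theta> by (intro powr_mono2) auto
      then show ?thesis using \<theta> Ap by (simp add: powr_powr)
    qed auto
    then show "(LINT x|lborel. \<bar>u x\<bar> powr (p * ?d / (?d - p))) \<le> (K * (max B 0) powr \<delta>) powr (1 / (1 - \<theta>))"
      unfolding A_def q_def .
  qed
qed

section \<open>Sobolev's inequality for weak derivatives, localised\<close>

lemma powr_sum_le:
  fixes a :: "'i \<Rightarrow> real"
  assumes fin: "finite K" and p: "p > 0" and a: "\<And>k. k \<in> K \<Longrightarrow> a k \<ge> 0"
  shows "(\<Sum>k\<in>K. a k) powr p \<le> real (card K) powr p * (\<Sum>k\<in>K. a k powr p)"
proof -
  define m where "m = (\<Sum>k\<in>K. a k powr p)"
  have m: "m \<ge> 0" unfolding m_def by (intro sum_nonneg) auto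
  \<comment> \<open>Each summand is bounded by the root of the sum of all powers; this works for
    every \<open>p > 0\<close>, without convexity.\<close>
  have "a k \<le> m powr (1 / p)" if "k \<in> K" for k
  proof -
    have "a k powr p \<le> m" unfolding m_def using fin that by (intro member_le_sum) auto
    then have "(a k powr p) powr (1 / p) \<le> m powr (1 / p)" using p by (intro powr_mono2) auto
    then show ?thesis using p a[OF that] by (simp add: powr_powr)
  qed
  then have "(\<Sum>k\<in>K. a k) \<le> real (card K) * m powr (1 / p)" using sum_bounded_above by blast
  then have "(\<Sum>k\<in>K. a k) powr p \<le> (real (card K) * m powr (1 / p)) powr p"
    using p a by (intro powr_mono2 sum_nonneg) auto
  also have "\<dots> = real (card K) powr p * m" using p m by (simp add: powr_mult powr_powr)
  finally show ?thesis by (simp add: m_def)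
qed

lemma powr_add_le:
  fixes x y :: real
  assumes "p > 0" "x \<ge> 0" "y \<ge> 0"
  shows "(x + y) powr p \<le> 2 powr p * (x powr p + y powr p)"
  using powr_sum_le[of "{True, False}" p "\<lambda>b. if b then x else y"] assms by simp

text \<open>The L1 errors of the mollification converge and are therefore bounded in
  \<open>n\<close>.\<close>

lemma mo_integral_bounded:
  fixes F :: "'a::euclidean_space \<Rightarrow> real"
  assumes F: "loc1 F"
  obtains M where "\<And>n. (LINT x|lborel. indicator (cball 0 R) x * mo n F x) \<le> M"
proof -
  have "Bseq (\<lambda>n. LINT x|lborel. indicator (cball 0 R) x * \<bar>mo n F x - F x\<bar>)"
    by (rule convergent_imp_Bseq[OF convergentI[OF mo_L1[OF F]]])
  then obtain K where K: "\<And>n. norm (LINT x|lborel. indicator (cball 0 R) x * \<bar>mo n F x - F x\<bar>) \<le> K"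
    by (auto simp: Bseq_def)
  have "(LINT x|lborel. indicator (cball 0 R) x * mo n F x) \<le> K + (LINT x|lborel. indicator (cball 0 R) x * F x)" for n
  proof -
    have "(LINT x|lborel. indicator (cball 0 R) x * mo n F x)
        \<le> (LINT x|lborel. indicator (cball 0 R) x * \<bar>mo n F x - F x\<bar> + indicator (cball 0 R) x * F x)"
      by (intro integral_mono Bochner_Integration.integrable_add mo_diff_integrable loc1_integrable F
            loc1_continuous smooth_continuous mo_smooth) (auto simp: indicator_def)
    also have "\<dots> = (LINT x|lborel. indicator (cball 0 R) x * \<bar>mo n F x - F x\<bar>) + (LINT x|lborel. indicator (cball 0 R) x * F x)"
      by (intro Bochner_Integration.integral_add mo_diff_integrable loc1_integrable F)
    finally show ?thesis using K[of n] by simp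
  qed
  then show ?thesis by (rule that)
qed

text \<open>The functions \<open>\<eta> * mo n f\<close> are test functions whose gradients are
  bounded in L^p uniformly in \<open>n\<close>, by Jensen's inequality. \<open>sobolev_test\<close>
  bounds them uniformly in L^q, and Fatou's lemma along an almost everywhere convergent subsequence
  transfers the bound to \<open>f\<close> on the ball where \<open>\<eta>\<close> is 1.\<close>

lemma sobolev_loc:
  fixes f :: "'a::euclidean_space \<Rightarrow> real"
  assumes p: "1 < p" "p < real DIM('a)"
    and f: "locp p f" and wd: "\<And>i. i \<in> Basis \<Longrightarrow> wd i f (g i)" and g: "\<And>i. i \<in> Basis \<Longrightarrow> locp p (g i)"
  shows "locp (p * real DIM('a) / (real DIM('a) - p)) f"
proof -
  define q where "q = p * real DIM('a) / (real DIM('a) - p)"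
  have q: "q > 0" using p by (simp add: q_def)
  have p0: "p > 0" "p \<ge> 1" using p by auto
  have lf: "loc1 f" using locp_loc1[OF f] p by simp
  have lg: "loc1 (g i)" if "i \<in> Basis" for i using locp_loc1[OF g[OF that]] p by simp
  note [measurable] = locp_measurable[OF f]
  have "integrable lborel (\<lambda>x. indicator (cball 0 R) x * \<bar>f x\<bar> powr q)" for R
  proof -
    obtain \<eta>0 :: "'a \<Rightarrow> real" where \<eta>0: "test \<eta>0" "\<And>x. norm x < 1 \<Longrightarrow> \<eta>0 x = 1"
      by (rule cutoff_exists) blast
    \<comment> \<open>\<open>R\<close> is an arbitrary real number. With
      \<open>\<bar>R\<bar> + 1\<close> the scaling factor is positive and the closed ball of radius
      \<open>R\<close> is mapped into the open unit ball.\<close>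
    define \<eta> where "\<eta> x = \<eta>0 ((1 / (\<bar>R\<bar> + 1)) *\<^sub>R x)" for x
    have \<eta>: "test \<eta>" unfolding \<eta>_def[abs_def] using test_affine[OF \<eta>0(1), of "1 / (\<bar>R\<bar> + 1)" 0] by simp
    have \<eta>1: "\<eta> x = 1" if "norm x \<le> R" for x
      unfolding \<eta>_def using that by (intro \<eta>0(2)) (simp add: field_simps)
    obtain S where S: "\<And>x. S < norm x \<Longrightarrow> \<eta> x = 0" using test_bound[OF \<eta>] by blast
    have "\<exists>C>0. \<forall>x. \<bar>pd i \<eta> x\<bar> \<le> C" if "i \<in> Basis" for i using test_bounded[OF test_pd[OF \<eta> that]] by metis
    then obtain C1 where C1: "\<And>i x. i \<in> Basis \<Longrightarrow> C1 i > 0" "\<And>i x. i \<in> Basis \<Longrightarrow> \<bar>pd i \<eta> x\<bar> \<le> C1 i" by metis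
    obtain C2 where C2: "C2 > 0" "\<And>x. \<bar>\<eta> x\<bar> \<le> C2" using test_bounded[OF \<eta>] by blast
    define C where "C = C2 + (\<Sum>i\<in>Basis. C1 i)"
    have C: "\<bar>\<eta> x\<bar> \<le> C" "i \<in> Basis \<Longrightarrow> \<bar>pd i \<eta> x\<bar> \<le> C" for x i
    proof -
      have "0 \<le> (\<Sum>i\<in>Basis. C1 i)" using C1(1) by (intro sum_nonneg) (auto intro: less_imp_le)
      then show "\<bar>\<eta> x\<bar> \<le> C" using C2(2)[of x] by (simp add: C_def)
      assume i: "i \<in> Basis"
      have "C1 i \<le> (\<Sum>i\<in>Basis. C1 i)" using C1(1) i by (intro member_le_sum) (auto intro: less_imp_le)
      then show "\<bar>pd i \<eta> x\<bar> \<le> C" using C1(2)[OF i, of x] C2(1) by (simp add: C_def)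
    qed
    have C0: "C \<ge> 0" using C(1)[of 0] by linarith
    let ?F = "\<lambda>x. \<Sum>i\<in>(Basis::'a set). \<bar>g i x\<bar> powr p + \<bar>f x\<bar> powr p"
    have lF: "loc1 ?F" by (intro loc1_sum loc1_add loc1_powr f g)
    have moF: "mo n ?F x = (\<Sum>i\<in>(Basis::'a set). mo n (\<lambda>x. \<bar>g i x\<bar> powr p) x + mo n (\<lambda>x. \<bar>f x\<bar> powr p) x)" for n x
    proof -
      have "mo n ?F x = (\<Sum>i\<in>(Basis::'a set). mo n (\<lambda>x. \<bar>g i x\<bar> powr p + \<bar>f x\<bar> powr p) x)"
        unfolding mo_def conv_def sum_distrib_left
        by (rule Bochner_Integration.integral_sum) (intro mo_integrable loc1_add loc1_powr f g)
      then show ?thesis using mo_add[OF loc1_powr[OF g] loc1_powr[OF f]] by simp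
    qed
    define u where "u n x = \<eta> x * mo n f x" for n x
    have u: "test (u n)" for n unfolding u_def[abs_def] by (intro test_mult \<eta> mo_smooth lf)
    have pu: "pd i (u n) x = \<eta> x * mo n (g i) x + pd i \<eta> x * mo n f x" if "i \<in> Basis" for i n x
      unfolding u_def[abs_def] using that
      by (simp add: smooth_pd_mult test_smooth[OF \<eta>] mo_smooth[OF lf] mo_wd[OF wd])
    define K where "K = real DIM('a) powr p * (C powr p * 2 powr p)"
    have bound: "(\<Sum>i\<in>Basis. \<bar>pd i (u n) x\<bar>) powr p \<le> K * (indicator (cball 0 S) x * mo n ?F x)" for n x
    proof (cases "S < norm x")
      case True
      then have "pd i (u n) x = 0" for i by (rule pd_zero_outside[rotated]) (simp add: u_def S)
      then show ?thesis using p True by simp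
    next
      case False
      have "(\<Sum>i\<in>Basis. \<bar>pd i (u n) x\<bar>) powr p \<le> real DIM('a) powr p * (\<Sum>i\<in>Basis. \<bar>pd i (u n) x\<bar> powr p)"
        by (rule powr_sum_le) (use p in auto)
      also have "(\<Sum>i\<in>Basis. \<bar>pd i (u n) x\<bar> powr p)
         \<le> (\<Sum>i\<in>(Basis::'a set). (C powr p * 2 powr p) * (mo n (\<lambda>x. \<bar>g i x\<bar> powr p) x + mo n (\<lambda>x. \<bar>f x\<bar> powr p) x))"
      proof (rule sum_mono)
        fix i :: 'a assume i: "i \<in> Basis"
        have "\<bar>pd i (u n) x\<bar> \<le> \<bar>\<eta> x\<bar> * \<bar>mo n (g i) x\<bar> + \<bar>pd i \<eta> x\<bar> * \<bar>mo n f x\<bar>"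
          unfolding pu[OF i] abs_mult[symmetric] by (rule abs_triangle_ineq)
        also have "\<dots> \<le> C * \<bar>mo n (g i) x\<bar> + C * \<bar>mo n f x\<bar>"
          using C i by (intro add_mono mult_right_mono) auto
        finally have "\<bar>pd i (u n) x\<bar> powr p \<le> (C * (\<bar>mo n (g i) x\<bar> + \<bar>mo n f x\<bar>)) powr p"
          using p by (intro powr_mono2) (auto simp: distrib_left)
        also have "\<dots> = C powr p * (\<bar>mo n (g i) x\<bar> + \<bar>mo n f x\<bar>) powr p" using C0 by (simp add: powr_mult)
        also have "\<dots> \<le> C powr p * (2 powr p * (\<bar>mo n (g i) x\<bar> powr p + \<bar>mo n f x\<bar> powr p))"
          by (intro mult_left_mono powr_add_le) (use p in auto)
        also have "\<dots> \<le> C powr p * (2 powr p * (mo n (\<lambda>x. \<bar>g i x\<bar> powr p) x + mo n (\<lambda>x. \<bar>f x\<bar> powr p) x))"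
          by (intro mult_left_mono add_mono mo_jensen f g i p0) auto
        finally show "\<bar>pd i (u n) x\<bar> powr p \<le> (C powr p * 2 powr p) * (mo n (\<lambda>x. \<bar>g i x\<bar> powr p) x + mo n (\<lambda>x. \<bar>f x\<bar> powr p) x)"
          by (simp add: mult.assoc)
      qed
      also have "\<dots> = (C powr p * 2 powr p) * mo n ?F x" unfolding moF sum_distrib_left ..
      finally show ?thesis using False by (simp add: K_def mult.assoc mult_left_mono)
    qed
    obtain M where M: "\<And>n. (LINT x|lborel. indicator (cball 0 S) x * mo n ?F x) \<le> M"
      using mo_integral_bounded[OF lF] by blast
    have "(LINT x|lborel. (\<Sum>i\<in>Basis. \<bar>pd i (u n) x\<bar>) powr p) \<le> K * M" for n
    proof -
      have i1: "integrable lborel (\<lambda>x. K * (indicator (cball 0 S) x * mo n ?F x))"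
        by (intro integrable_mult_right loc1_integrable loc1_continuous smooth_continuous mo_smooth lF)
      have "(LINT x|lborel. (\<Sum>i\<in>Basis. \<bar>pd i (u n) x\<bar>) powr p) \<le> (LINT x|lborel. K * (indicator (cball 0 S) x * mo n ?F x))"
      proof (rule integral_mono'[OF i1])
        show "0 \<le> K * (indicator (cball 0 S) x * mo n ?F x)" for x
          using bound[of n x] by (rule order_trans[rotated]) simp
      qed (rule bound)
      also have "\<dots> = K * (LINT x|lborel. indicator (cball 0 S) x * mo n ?F x)" by simp
      also have "\<dots> \<le> K * M" using M by (intro mult_left_mono) (auto simp: K_def)
      finally show ?thesis .
    qed
    then obtain A where A: "\<And>n. (LINT x|lborel. \<bar>u n x\<bar> powr q) \<le> A"
      using sobolev_test[OF p, of "K * M"] u unfolding q_def by blast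
    obtain s where s: "strict_mono s" "aeconv s R f"
      using aeconv_subseq[of "{f}" R] lf by auto
    have mu[measurable]: "u n \<in> borel_measurable borel" for n by (intro smooth_measurable test_smooth u)
    have iu: "integrable lborel (\<lambda>x. \<bar>u n x\<bar> powr q)" for n
    proof (rule compact_support_integrable[of _ S])
      show "continuous_on UNIV (\<lambda>x. \<bar>u n x\<bar> powr q)"
        by (rule powr_continuous[OF smooth_continuous[OF test_smooth[OF u]] q])
    qed (use S q in \<open>auto simp: u_def\<close>)
    have "(\<integral>\<^sup>+x. ennreal (indicator (cball 0 R) x * \<bar>f x\<bar> powr q) \<partial>lborel)
       \<le> (\<integral>\<^sup>+x. liminf (\<lambda>n. ennreal (\<bar>u (s n) x\<bar> powr q)) \<partial>lborel)"
    proof (rule nn_integral_mono_AE)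
      show "AE x in lborel. ennreal (indicator (cball 0 R) x * \<bar>f x\<bar> powr q) \<le> liminf (\<lambda>n. ennreal (\<bar>u (s n) x\<bar> powr q))"
        using s(2) unfolding aeconv_def
      proof eventually_elim
        case (elim x)
        show ?case
        proof (cases "norm x \<le> R")
          case True
          have "(\<lambda>n. \<bar>u (s n) x\<bar> powr q) \<longlonglongrightarrow> \<bar>f x\<bar> powr q"
            unfolding u_def using elim True \<eta>1[OF True] q
            by (intro tendsto_powr' tendsto_rabs) auto
          then have "(\<lambda>n. ennreal (\<bar>u (s n) x\<bar> powr q)) \<longlonglongrightarrow> ennreal (\<bar>f x\<bar> powr q)" by (rule tendsto_ennrealI)
          then have "liminf (\<lambda>n. ennreal (\<bar>u (s n) x\<bar> powr q)) = ennreal (\<bar>f x\<bar> powr q)"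
            by (intro lim_imp_Liminf) auto
          then show ?thesis using True by simp
        qed simp
      qed
    qed
    also have "\<dots> \<le> liminf (\<lambda>n. \<integral>\<^sup>+x. ennreal (\<bar>u (s n) x\<bar> powr q) \<partial>lborel)"
      by (rule nn_integral_liminf) measurable
    also have "\<dots> \<le> liminf (\<lambda>n. ennreal A)"
    proof (intro Liminf_mono always_eventually allI)
      fix n
      show "(\<integral>\<^sup>+x. ennreal (\<bar>u (s n) x\<bar> powr q) \<partial>lborel) \<le> ennreal A"
        using A[of "s n"] by (subst nn_integral_eq_integral[OF iu]) (auto intro: ennreal_leI)
    qed
    also have "\<dots> < \<infinity>" by (simp add: Liminf_const)
    finally have "(\<integral>\<^sup>+x. ennreal (norm (indicator (cball 0 R) x * \<bar>f x\<bar> powr q)) \<partial>lborel) < \<infinity>" by simp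
    moreover have [measurable]: "cball (0::'a) R \<in> sets borel" by simp
    ultimately show ?thesis by (intro integrableI_bounded) measurable
  qed
  then show ?thesis unfolding locp_def loc1_def q_def[symmetric] by auto
qed

section \<open>The virial identity\<close>

definition lap :: "('a::euclidean_space \<Rightarrow> real) \<Rightarrow> 'a \<Rightarrow> real" where
  "lap f x = (\<Sum>i\<in>Basis. pd i (pd i f) x)"

definition euler :: "('a::euclidean_space \<Rightarrow> real) \<Rightarrow> 'a \<Rightarrow> real" where
  "euler f x = (\<Sum>i\<in>Basis. (x \<bullet> i) * pd i f x)"

definition divx :: "('a::euclidean_space \<Rightarrow> real) \<Rightarrow> 'a \<Rightarrow> real" where
  "divx \<eta> x = (\<Sum>i\<in>Basis. pd i (\<lambda>x. (x \<bullet> i) * \<eta> x) x)"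

lemma smooth_lap [intro]: "smooth f \<Longrightarrow> smooth (lap f)"
  unfolding lap_def[abs_def] by (intro smooth_sum smooth_pd)
lemma smooth_euler [intro]: "smooth f \<Longrightarrow> smooth (euler f)"
  unfolding euler_def[abs_def] by (intro smooth_sum smooth_mult smooth_inner smooth_pd)
lemma smooth_divx [intro]: "smooth f \<Longrightarrow> smooth (divx f)"
  unfolding divx_def[abs_def] by (intro smooth_sum smooth_mult smooth_inner smooth_pd)
lemma test_lap: "test f \<Longrightarrow> test (lap f)"
  unfolding lap_def[abs_def] by (intro test_sum test_pd)
lemma test_divx: "test f \<Longrightarrow> test (divx f)"
  unfolding divx_def[abs_def] by (intro test_sum test_pd test_mult2 smooth_inner)

lemma lap_add: "smooth f \<Longrightarrow> smooth g \<Longrightarrow> lap (\<lambda>x. f x + g x) x = lap f x + lap g x"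
  by (simp add: lap_def smooth_pd_add smooth_pd sum.distrib)

lemma lap_mult:
  assumes "smooth f" "smooth g"
  shows "lap (\<lambda>x. f x * g x) x = f x * lap g x + 2 * (\<Sum>i\<in>Basis. pd i f x * pd i g x) + g x * lap f x"
proof -
  have "pd i (pd i (\<lambda>x. f x * g x)) x = f x * pd i (pd i g) x + 2 * (pd i f x * pd i g x) + g x * pd i (pd i f) x"
    if "i \<in> Basis" for i
  proof -
    have "pd i (pd i (\<lambda>x. f x * g x)) = pd i (\<lambda>x. f x * pd i g x + pd i f x * g x)"
      using assms by (simp add: smooth_pd_mult)
    also have "\<dots> = (\<lambda>x. (f x * pd i (pd i g) x + pd i f x * pd i g x) + (pd i f x * pd i g x + pd i (pd i f) x * g x))"
      using assms that by (subst smooth_pd_add) (auto simp: smooth_pd_mult smooth_pd intro!: smooth_mult)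
    finally show ?thesis by (simp add: algebra_simps)
  qed
  then show ?thesis by (simp add: lap_def sum.distrib sum_distrib_left)
qed

lemma pd_euler:
  assumes "smooth w" "j \<in> Basis"
  shows "pd j (euler w) = (\<lambda>x. pd j w x + (\<Sum>i\<in>Basis. (x \<bullet> i) * pd j (pd i w) x))"
proof (rule ext)
  fix x
  have "pd j (euler w) x = (\<Sum>i\<in>Basis. (x \<bullet> i) * pd j (pd i w) x + (j \<bullet> i) * pd i w x)"
    unfolding euler_def[abs_def] using assms(1)
    by (subst smooth_pd_sum) (auto simp: smooth_pd_mult smooth_pd intro!: smooth_mult)
  also have "\<dots> = (\<Sum>i\<in>Basis. (x \<bullet> i) * pd j (pd i w) x) + (\<Sum>i\<in>Basis. if i = j then pd i w x else 0)"
    unfolding sum.distrib using assms(2) by (intro arg_cong2[where f="(+)"] sum.cong) (auto simp: inner_Basis)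
  finally show "pd j (euler w) x = pd j w x + (\<Sum>i\<in>Basis. (x \<bullet> i) * pd j (pd i w) x)"
    using assms(2) by simp
qed

text \<open>The commutator of the Laplacian with \<open>x \<bullet> \<nabla>\<close> is twice the
  Laplacian. Together with the factor 2 in \<open>mult_fun\<close> it produces the factor 4 in the
  virial identity.\<close>

lemma lap_euler:
  assumes w: "smooth w"
  shows "lap (euler w) x = 2 * lap w x + (\<Sum>i\<in>Basis. (x \<bullet> i) * pd i (lap w) x)"
proof -
  have "pd j (pd j (euler w)) x = 2 * pd j (pd j w) x + (\<Sum>i\<in>Basis. (x \<bullet> i) * pd i (pd j (pd j w)) x)"
    if j: "j \<in> Basis" for j
  proof -
    have sm: "smooth (\<lambda>x. (x \<bullet> i) * pd j (pd i w) x)" if "i \<in> Basis" for i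
      using w j that by (intro smooth_mult smooth_inner smooth_pd)
    have "pd j (pd j (euler w)) x = pd j (pd j w) x + pd j (\<lambda>x. \<Sum>i\<in>Basis. (x \<bullet> i) * pd j (pd i w) x) x"
      unfolding pd_euler[OF w j] using w j sm by (subst smooth_pd_add) (auto intro: smooth_sum)
    also have "pd j (\<lambda>x. \<Sum>i\<in>Basis. (x \<bullet> i) * pd j (pd i w) x) x
        = (\<Sum>i\<in>Basis. (x \<bullet> i) * pd j (pd j (pd i w)) x + (j \<bullet> i) * pd j (pd i w) x)"
      using w j sm by (subst smooth_pd_sum) (auto simp: smooth_pd_mult smooth_pd)
    also have "\<dots> = (\<Sum>i\<in>Basis. (x \<bullet> i) * pd i (pd j (pd j w)) x) + (\<Sum>i\<in>Basis. if i = j then pd j (pd i w) x else 0)"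
      unfolding sum.distrib
    proof (intro arg_cong2[where f="(+)"] sum.cong refl)
      fix i :: 'a assume i: "i \<in> Basis"
      show "(x \<bullet> i) * pd j (pd j (pd i w)) x = (x \<bullet> i) * pd i (pd j (pd j w)) x"
        using pd_commute[OF w i j] pd_commute[OF smooth_pd[OF w j] i j] by simp
      show "(j \<bullet> i) * pd j (pd i w) x = (if i = j then pd j (pd i w) x else 0)"
        using i j by (auto simp: inner_Basis)
    qed
    finally show ?thesis using j by simp
  qed
  then have "lap (euler w) x = 2 * lap w x + (\<Sum>j\<in>Basis. \<Sum>i\<in>Basis. (x \<bullet> i) * pd i (pd j (pd j w)) x)"
    by (simp add: lap_def sum.distrib sum_distrib_left)
  also have "(\<Sum>j\<in>Basis. \<Sum>i\<in>Basis. (x \<bullet> i) * pd i (pd j (pd j w)) x) = (\<Sum>i\<in>Basis. (x \<bullet> i) * pd i (lap w) x)"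
    unfolding lap_def[abs_def] using w
    by (subst sum.swap) (intro sum.cong refl, subst smooth_pd_sum, auto simp: sum_distrib_left)
  finally show ?thesis .
qed

text \<open>Used for two functions: with \<open>g = w\<close> it shows that the spectral term is a
  divergence, and with \<open>g = lap w\<close> it disposes of the third derivatives.\<close>

lemma div_square:
  assumes "smooth \<eta>" "smooth g"
  shows "(\<Sum>i\<in>Basis. pd i (\<lambda>x. ((x \<bullet> i) * \<eta> x) * (g x * g x)) x) = 2 * \<eta> x * g x * euler g x + divx \<eta> x * (g x * g x)"
proof -
  have "pd i (\<lambda>x. ((x \<bullet> i) * \<eta> x) * (g x * g x)) x
     = (2 * \<eta> x * g x) * ((x \<bullet> i) * pd i g x) + pd i (\<lambda>x. (x \<bullet> i) * \<eta> x) x * (g x * g x)" for i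
  proof -
    have "pd i (\<lambda>x. ((x \<bullet> i) * \<eta> x) * (g x * g x)) x
      = ((x \<bullet> i) * \<eta> x) * (g x * pd i g x + pd i g x * g x) + pd i (\<lambda>x. (x \<bullet> i) * \<eta> x) x * (g x * g x)"
      using assms smooth_pd_mult[of "\<lambda>x. (x \<bullet> i) * \<eta> x" "\<lambda>x. g x * g x" i] by (simp add: smooth_mult smooth_pd_mult[of g g])
    then show ?thesis by (simp add: algebra_simps)
  qed
  then show ?thesis by (simp add: euler_def divx_def sum.distrib sum_distrib_left sum_distrib_right)
qed

text \<open>Twice the cut-off generator of dilations, in antisymmetrised form: by \<open>div_square\<close>, \<open>w * mult_fun \<eta> w\<close> is a divergence.\<close>

definition mult_fun :: "('a::euclidean_space \<Rightarrow> real) \<Rightarrow> ('a \<Rightarrow> real) \<Rightarrow> 'a \<Rightarrow> real" where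
  "mult_fun \<eta> w x = 2 * \<eta> x * euler w x + divx \<eta> x * w x"

lemma test_cmult: "test f \<Longrightarrow> test (\<lambda>x. c * f x)"
  using test_mult2[of f "\<lambda>x. c"] by simp

lemma test_mult_fun: "test \<eta> \<Longrightarrow> smooth w \<Longrightarrow> test (mult_fun \<eta> w)"
  unfolding mult_fun_def[abs_def]
  by (intro test_add test_mult[OF test_cmult] test_mult[OF test_divx] smooth_euler)

text \<open>Coefficients of the error terms in \<open>lap_mult_fun\<close>; they vanish wherever \<open>\<eta>\<close> is locally constant.\<close>

definition coefA :: "('a::euclidean_space \<Rightarrow> real) \<Rightarrow> 'a \<Rightarrow> 'a \<Rightarrow> real" where
  "coefA \<eta> j x = 4 * pd j \<eta> x + 2 * pd j (divx \<eta>) x + 2 * ((x \<bullet> j) * lap \<eta> x)"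
definition coefB :: "('a::euclidean_space \<Rightarrow> real) \<Rightarrow> 'a \<Rightarrow> 'a \<Rightarrow> 'a \<Rightarrow> real" where
  "coefB \<eta> i j x = 4 * ((x \<bullet> i) * pd j \<eta> x)"

lemma test_coefA: "test \<eta> \<Longrightarrow> j \<in> Basis \<Longrightarrow> test (coefA \<eta> j)"
  unfolding coefA_def[abs_def]
  by (intro test_add test_cmult test_pd test_divx test_mult2[OF test_lap] smooth_inner)
lemma test_coefB: "test \<eta> \<Longrightarrow> j \<in> Basis \<Longrightarrow> test (coefB \<eta> i j)"
  unfolding coefB_def[abs_def] by (intro test_cmult test_mult2[OF test_pd] smooth_inner)

text \<open>Third derivatives of \<open>w\<close> enter only through
  \<open>2 * \<eta> x * lap (euler w) x\<close>. Multiplied by \<open>lap w x\<close> and joined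
  with \<open>divx \<eta> x * (lap w x * lap w x)\<close>, they form the divergence of
  \<open>div_square\<close>. All remaining terms except the leading one carry derivatives of
  \<open>\<eta>\<close> or of \<open>divx \<eta>\<close>.\<close>

lemma lap_mult_fun:
  assumes e: "smooth \<eta>" and w: "smooth w"
  shows "lap w x * lap (mult_fun \<eta> w) x = 4 * (\<eta> x * (lap w x * lap w x))
     + (\<Sum>i\<in>Basis. pd i (\<lambda>x. ((x \<bullet> i) * \<eta> x) * (lap w x * lap w x)) x)
     + ((\<Sum>j\<in>Basis. coefA \<eta> j x * (lap w x * pd j w x))
     + (\<Sum>j\<in>Basis. \<Sum>i\<in>Basis. coefB \<eta> i j x * (lap w x * pd j (pd i w) x))
     + lap (divx \<eta>) x * (lap w x * w x))"
proof -
  have s2: "smooth (\<lambda>x. 2 * \<eta> x)" using e by auto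
  have l2: "lap (\<lambda>x. 2 * \<eta> x) x = 2 * lap \<eta> x" using lap_mult[of "\<lambda>x. 2" \<eta> x] e by (simp add: lap_def)
  have p2: "pd j (\<lambda>x. 2 * \<eta> x) x = 2 * pd j \<eta> x" for j using e by (simp add: smooth_pd_mult)
  have "lap (mult_fun \<eta> w) x = lap (\<lambda>x. 2 * \<eta> x * euler w x) x + lap (\<lambda>x. divx \<eta> x * w x) x"
    unfolding mult_fun_def[abs_def]
    using w by (intro lap_add smooth_mult[OF s2] smooth_mult[OF smooth_divx[OF e]] smooth_euler)
  also have "lap (\<lambda>x. 2 * \<eta> x * euler w x) x
     = 2 * \<eta> x * lap (euler w) x + 4 * (\<Sum>j\<in>Basis. pd j \<eta> x * pd j (euler w) x) + 2 * (euler w x * lap \<eta> x)"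
    unfolding lap_mult[OF s2 smooth_euler[OF w]] l2 p2 by (simp add: sum_distrib_left)
  also have "lap (\<lambda>x. divx \<eta> x * w x) x
     = divx \<eta> x * lap w x + 2 * (\<Sum>j\<in>Basis. pd j (divx \<eta>) x * pd j w x) + w x * lap (divx \<eta>) x"
    by (rule lap_mult[OF smooth_divx[OF e] w])
  also have "(\<Sum>j\<in>Basis. pd j \<eta> x * pd j (euler w) x)
     = (\<Sum>j\<in>Basis. pd j \<eta> x * pd j w x) + (\<Sum>j\<in>Basis. \<Sum>i\<in>Basis. ((x \<bullet> i) * pd j \<eta> x) * pd j (pd i w) x)"
    using w by (simp add: pd_euler distrib_left sum.distrib sum_distrib_left mult_ac)
  finally have 1: "lap (mult_fun \<eta> w) x = 2 * \<eta> x * lap (euler w) x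
     + 4 * ((\<Sum>j\<in>Basis. pd j \<eta> x * pd j w x) + (\<Sum>j\<in>Basis. \<Sum>i\<in>Basis. ((x \<bullet> i) * pd j \<eta> x) * pd j (pd i w) x))
     + 2 * (euler w x * lap \<eta> x)
     + (divx \<eta> x * lap w x + 2 * (\<Sum>j\<in>Basis. pd j (divx \<eta>) x * pd j w x) + w x * lap (divx \<eta>) x)" .
  have A: "(\<Sum>j\<in>Basis. coefA \<eta> j x * (lap w x * pd j w x))
     = lap w x * (4 * (\<Sum>j\<in>Basis. pd j \<eta> x * pd j w x) + 2 * (\<Sum>j\<in>Basis. pd j (divx \<eta>) x * pd j w x) + 2 * (euler w x * lap \<eta> x))"
    unfolding coefA_def euler_def sum_distrib_left sum_distrib_right sum.distrib[symmetric]
    by (intro sum.cong) (auto simp: algebra_simps)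
  have B: "(\<Sum>j\<in>Basis. \<Sum>i\<in>Basis. coefB \<eta> i j x * (lap w x * pd j (pd i w) x))
     = lap w x * (4 * (\<Sum>j\<in>Basis. \<Sum>i\<in>Basis. ((x \<bullet> i) * pd j \<eta> x) * pd j (pd i w) x))"
    unfolding coefB_def sum_distrib_left by (intro sum.cong) (auto simp: algebra_simps)
  have D: "(\<Sum>i\<in>Basis. pd i (\<lambda>x. ((x \<bullet> i) * \<eta> x) * (lap w x * lap w x)) x)
     = 2 * \<eta> x * lap w x * (\<Sum>i\<in>Basis. (x \<bullet> i) * pd i (lap w) x) + divx \<eta> x * (lap w x * lap w x)"
    using div_square[OF e smooth_lap[OF w]] by (simp add: euler_def)
  show ?thesis unfolding 1 A B D lap_euler[OF w] by (simp add: algebra_simps)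
qed

lemma integral_div_zero:
  fixes \<eta> g :: "'a::euclidean_space \<Rightarrow> real"
  assumes "test \<eta>" "smooth g"
  shows "(LINT x|lborel. (\<Sum>i\<in>Basis. pd i (\<lambda>x. ((x \<bullet> i) * \<eta> x) * g x) x)) = 0"
    "integrable lborel (\<lambda>x. \<Sum>i\<in>Basis. pd i (\<lambda>x. ((x \<bullet> i) * \<eta> x) * g x) x)"
proof -
  have t: "test (\<lambda>x. ((x \<bullet> i) * \<eta> x) * g x)" for i
    using assms by (intro test_mult test_mult2 smooth_inner)
  show "integrable lborel (\<lambda>x. \<Sum>i\<in>Basis. pd i (\<lambda>x. ((x \<bullet> i) * \<eta> x) * g x) x)"
    by (intro Bochner_Integration.integrable_sum test_integrable test_pd t)
  show "(LINT x|lborel. (\<Sum>i\<in>Basis. pd i (\<lambda>x. ((x \<bullet> i) * \<eta> x) * g x) x)) = 0"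
    using t by (subst Bochner_Integration.integral_sum) (auto intro: test_integrable test_pd simp: integral_pd_zero)
qed

section \<open>Local integrability of the solution, its derivatives and the potential\<close>

lemma mo_cong_AE: "AE x in lborel. f x = g x \<Longrightarrow> f \<in> borel_measurable borel \<Longrightarrow> g \<in> borel_measurable borel \<Longrightarrow> mo n f x = mo n g x"
  unfolding mo_def conv_def
  by (rule integral_cong_AE)
     (auto intro!: borel_measurable_times measurable_compose[OF _ smooth_measurable[OF test_smooth[OF moll_n]]] elim: eventually_mono)

lemma mo_sum:
  assumes "finite I" "\<And>i. i \<in> I \<Longrightarrow> loc1 (f i)"
  shows "mo n (\<lambda>x. \<Sum>i\<in>I. f i x) x = (\<Sum>i\<in>I. mo n (f i) x)"
  unfolding mo_def conv_def sum_distrib_left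
  by (rule Bochner_Integration.integral_sum) (intro mo_integrable assms)

lemma square_locp2:
  assumes [measurable]: "f \<in> borel_measurable borel" and i: "integrable lborel (\<lambda>x. (f x)\<^sup>2)"
  shows "locp 2 f"
  unfolding locp_def loc1_def
proof (intro conjI allI)
  show "integrable lborel (\<lambda>x. indicator (cball 0 R) x * \<bar>f x\<bar> powr 2)" for R
    using integrable_real_mult_indicator[OF _ i, of "cball 0 R"] by (simp add: mult.commute)
qed measurable

lemma integrable_mult_squares:
  fixes f g :: "'a::euclidean_space \<Rightarrow> real"
  assumes [measurable]: "f \<in> borel_measurable borel" "g \<in> borel_measurable borel"
    and "integrable lborel (\<lambda>x. (f x)\<^sup>2)" "integrable lborel (\<lambda>x. (g x)\<^sup>2)"
  shows "integrable lborel (\<lambda>x. f x * g x)"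
proof (rule Bochner_Integration.integrable_bound)
  show "integrable lborel (\<lambda>x. (f x)\<^sup>2 + (g x)\<^sup>2)" using assms by simp
  have "\<bar>f x * g x\<bar> \<le> (f x)\<^sup>2 + (g x)\<^sup>2" for x
    using Young2[of 2 2 "f x" "g x"] by simp
  then show "AE x in lborel. norm (f x * g x) \<le> norm ((f x)\<^sup>2 + (g x)\<^sup>2)" by (intro always_eventually) simp
qed measurable

text \<open>Here \<open>d i\<close>, \<open>dd i j\<close> and \<open>L\<close> are the weak first and second derivatives and the weak Laplacian of \<open>r\<close>.
  The Sobolev exponents of the first derivatives and of \<open>r\<close> are \<open>s\<close> and \<open>q\<close>, and \<open>s'\<close> is the conjugate exponent
  of \<open>s\<close>.  The assumption on \<open>V\<close> puts \<open>V\<close> locally into \<open>L^p\<close> with \<open>p = D/3\<close>, so that \<open>V r\<close> is locally in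
  \<open>L^s'\<close> and can be paired with the first derivatives of \<open>r\<close>.\<close>

locale sobolev_setting =
  fixes V r L :: "'a::euclidean_space \<Rightarrow> real" and d dV :: "'a \<Rightarrow> 'a \<Rightarrow> real"
    and dd :: "'a \<Rightarrow> 'a \<Rightarrow> 'a \<Rightarrow> real" and D s s' q :: real
  assumes DIM_D: "real DIM('a) = D"
    and D: "D \<ge> 5"
    and s_def: "s = 2 * D / (D - 2)"
    and s'_def: "s' = 2 * D / (D + 2)"
    and q_def: "q = 2 * D / (D - 4)"
    and r_wd: "\<And>i. i \<in> Basis \<Longrightarrow> wd i r (d i)"
    and d_wd: "\<And>i j. i \<in> Basis \<Longrightarrow> j \<in> Basis \<Longrightarrow> wd j (d i) (dd i j)"
    and r_sq: "integrable lborel (\<lambda>x. (r x)\<^sup>2)"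
    and d_sq: "\<And>i. i \<in> Basis \<Longrightarrow> integrable lborel (\<lambda>x. (d i x)\<^sup>2)"
    and dd_sq: "\<And>i j. i \<in> Basis \<Longrightarrow> j \<in> Basis \<Longrightarrow> integrable lborel (\<lambda>x. (dd i j x)\<^sup>2)"
    and L_def: "\<And>x. L x = (\<Sum>i\<in>Basis. dd i i x)"
    and V_loc: "locp (D / 4) V"
    and V_wd: "\<And>i. i \<in> Basis \<Longrightarrow> wd i V (dV i)"
    and dV_loc: "\<And>i. i \<in> Basis \<Longrightarrow> locp (D / 4) (dV i)"
begin

lemmas sobolev_loc_D = sobolev_loc[where 'a='a, unfolded DIM_D]

lemma loc1s:
  "loc1 r" "loc1 V" "i \<in> Basis \<Longrightarrow> loc1 (d i)" "i \<in> Basis \<Longrightarrow> loc1 (dV i)"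
  "i \<in> Basis \<Longrightarrow> j \<in> Basis \<Longrightarrow> loc1 (dd i j)"
proof -
  obtain b :: 'a where "b \<in> Basis" using nonempty_Basis by blast
  then show "loc1 r" "loc1 V" using r_wd V_wd by (auto simp: wd_def)
qed (use r_wd V_wd d_wd in \<open>auto simp: wd_def\<close>)

lemma loc2s:
  "locp 2 r" "i \<in> Basis \<Longrightarrow> locp 2 (d i)" "i \<in> Basis \<Longrightarrow> j \<in> Basis \<Longrightarrow> locp 2 (dd i j)"
  using r_sq d_sq dd_sq loc1s by (auto intro!: square_locp2 loc1_measurable)

lemma L_measurable [measurable]: "L \<in> borel_measurable borel"
proof -
  have "(\<lambda>x. \<Sum>i\<in>Basis. dd i i x) \<in> borel_measurable borel"
    by (intro borel_measurable_sum loc1_measurable loc1s)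
  then show ?thesis using L_def by presburger
qed

lemma L_loc1: "loc1 L"
proof -
  have "L = (\<lambda>x. \<Sum>i\<in>Basis. dd i i x)" using L_def by blast
  then show ?thesis using loc1s by (auto intro!: loc1_sum)
qed

lemma L_sq: "integrable lborel (\<lambda>x. (L x)\<^sup>2)"
proof -
  have "(L x)\<^sup>2 = (\<Sum>i\<in>Basis. \<Sum>j\<in>Basis. dd i i x * dd j j x)" for x
    by (simp add: L_def power2_eq_square sum_product)
  then show ?thesis using loc1s dd_sq
    by (auto intro!: Bochner_Integration.integrable_sum integrable_mult_squares loc1_measurable)
qed

lemma L_loc2: "locp 2 L" by (rule square_locp2[OF L_measurable L_sq])

text \<open>In reciprocals, \<open>1 / s = 1/2 - 1/D\<close>, \<open>1 / s' = 1/2 + 1/D\<close> and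
  \<open>1 / q = 1/2 - 2/D\<close>. The sums of three terms are the balances for
  \<open>V * r * d i\<close> and for \<open>dV i * r * r\<close>.\<close>

lemma exps: "s > 1" "s' > 1" "q > 1" "1 / s' + 1 / s = 1" "1 / (D / 3) + 1 / q + 1 / s = 1"
  "1 / (D / 4) + 1 / q + 1 / q = 1" "1 / (D / 3) + 1 / s + 1 / q = 1"
  using D by (auto simp: s_def s'_def q_def field_simps)

lemma r_loc_s: "locp s r" and d_loc_s: "i \<in> Basis \<Longrightarrow> locp s (d i)"
  using sobolev_loc_D[of 2 r d] sobolev_loc_D[of 2 "d i" "dd i"] D r_wd d_wd loc2s by (auto simp: s_def)

text \<open>A second use of the Sobolev inequality: \<open>r\<close> and its first derivatives are
  locally in L^s, and \<open>1 / s - 1 / D = 1 / q\<close>.\<close>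

lemma r_loc_q: "locp q r"
proof -
  have "s < D" using D by (simp add: s_def field_simps)
  moreover have "s * D / (D - s) = q"
  proof -
    have "D - s = D * (D - 4) / (D - 2)" using D by (simp add: s_def field_simps)
    moreover have "q * (D * (D - 4) / (D - 2)) = s * D"
    proof -
      have "q * (D - 4) = 2 * D" using D by (simp add: q_def)
      then have "q * (D * (D - 4) / (D - 2)) = D * (2 * D) / (D - 2)" by (simp add: mult_ac)
      then show ?thesis by (simp add: s_def mult_ac)
    qed
    ultimately have "q * (D - s) = s * D" by simp
    moreover have "D - s > 0" using \<open>s < D\<close> by simp
    ultimately show ?thesis by (simp add: nonzero_divide_eq_eq)
  qed
  ultimately show ?thesis using sobolev_loc_D[of s r d] exps r_wd r_loc_s d_loc_s by auto
qed

text \<open>The weak gradient of \<open>V\<close> improves its reciprocal exponent from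
  \<open>4 / D\<close> to \<open>3 / D\<close>; that \<open>D / 4\<close> exceeds 1 comes from
  \<open>D \<ge> 5\<close>.\<close>

lemma V_loc_3: "locp (D / 3) V"
proof -
  have "(D / 4) * D / (D - D / 4) = D / 3" using D by (simp add: field_simps)
  then show ?thesis using sobolev_loc_D[of "D / 4" V dV] D V_loc V_wd dV_loc by auto
qed

text \<open>Since \<open>3 / D + 1 / q = 1 / s'\<close>, Young's inequality applies to the
  \<open>s'\<close>-th powers of the factors. This exponent makes Jensen's inequality available for
  the mollification of the product \<open>V * r\<close> as a whole.\<close>

lemma Vr_loc: "locp s' (\<lambda>x. V x * r x)"
proof -
  have [measurable]: "V \<in> borel_measurable borel" "r \<in> borel_measurable borel"
    using loc1s by (auto intro: loc1_measurable)
  have P: "(D / 3) / s' > 1" "q / s' > 1" "1 / ((D / 3) / s') + 1 / (q / s') = 1"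
  proof -
    have e: "(D / 3) / s' = (D + 2) / 6" "q / s' = (D + 2) / (D - 4)"
      using D by (auto simp: s'_def q_def)
    show "(D / 3) / s' > 1" "q / s' > 1" "1 / ((D / 3) / s') + 1 / (q / s') = 1"
      unfolding e using D by (auto simp flip: add_divide_distrib)
  qed
  have s0: "s' > 0" using exps by simp
  have "\<bar>V x * r x\<bar> powr s' \<le> \<bar>V x\<bar> powr (D / 3) + \<bar>r x\<bar> powr q" for x
  proof -
    have "\<bar>V x * r x\<bar> powr s' = \<bar>\<bar>V x\<bar> powr s' * \<bar>r x\<bar> powr s'\<bar>" by (simp add: abs_mult powr_mult)
    also have "\<dots> \<le> \<bar>\<bar>V x\<bar> powr s'\<bar> powr ((D / 3) / s') + \<bar>\<bar>r x\<bar> powr s'\<bar> powr (q / s')"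
      by (rule Young2[OF P])
    also have "\<dots> = \<bar>V x\<bar> powr (D / 3) + \<bar>r x\<bar> powr q" using s0 by (simp add: powr_powr)
    finally show ?thesis .
  qed
  then have "loc1 (\<lambda>x. \<bar>V x * r x\<bar> powr s')"
    by (intro loc1_bound[OF loc1_add[OF loc1_powr[OF V_loc_3] loc1_powr[OF r_loc_q]]]) auto
  then show ?thesis by (simp add: locp_def)
qed

lemma Vr_loc1: "loc1 (\<lambda>x. V x * r x)" using locp_loc1[OF Vr_loc] exps by simp

lemma mo_r: "i \<in> Basis \<Longrightarrow> pd i (mo n r) = mo n (d i)"
  "i \<in> Basis \<Longrightarrow> j \<in> Basis \<Longrightarrow> pd j (pd i (mo n r)) = mo n (dd i j)"
  "lap (mo n r) = mo n L"
proof -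
  show 1: "i \<in> Basis \<Longrightarrow> pd i (mo n r) = mo n (d i)" for i by (intro mo_wd r_wd)
  then show 2: "i \<in> Basis \<Longrightarrow> j \<in> Basis \<Longrightarrow> pd j (pd i (mo n r)) = mo n (dd i j)" for i j
    by (simp add: mo_wd d_wd)
  show "lap (mo n r) = mo n L"
  proof (rule ext)
    fix x
    have "mo n L x = mo n (\<lambda>x. \<Sum>i\<in>Basis. dd i i x) x" by (simp add: L_def[abs_def])
    also have "\<dots> = (\<Sum>i\<in>Basis. mo n (dd i i) x)" using loc1s by (intro mo_sum) auto
    finally show "lap (mo n r) x = mo n L x" by (simp add: lap_def 2)
  qed
qed

lemma mo_lap: assumes "test g" shows "lap (mo n g) = mo n (lap g)"
proof (rule ext)
  fix x
  have "pd i (pd i (mo n g)) = mo n (pd i (pd i g))" if "i \<in> Basis" for i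
    using that assms by (simp add: mo_pd test_smooth smooth_pd)
  moreover have "loc1 (pd i (pd i g))" if "i \<in> Basis" for i
    using assms that by (intro test_loc1 test_pd)
  ultimately show "lap (mo n g) x = mo n (lap g) x"
    unfolding lap_def[abs_def] by (simp add: mo_sum)
qed

lemma r_smooth: "smooth (mo n r)" by (rule mo_smooth[OF loc1s(1)])

text \<open>The functions whose mollifications have to converge almost everywhere along one common sequence.\<close>

definition family :: "('a \<Rightarrow> real) set" where
  "family = {r, (\<lambda>x. V x * r x), L, (\<lambda>x. \<bar>r x\<bar> powr 2), (\<lambda>x. \<bar>r x\<bar> powr s), (\<lambda>x. \<bar>r x\<bar> powr q),
     (\<lambda>x. \<bar>V x * r x\<bar> powr s'), (\<lambda>x. \<bar>L x\<bar> powr 2)}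
   \<union> d ` Basis \<union> (\<lambda>i x. \<bar>d i x\<bar> powr 2) ` Basis \<union> (\<lambda>i x. \<bar>d i x\<bar> powr s) ` Basis
   \<union> (\<lambda>(i, j). dd i j) ` (Basis \<times> Basis) \<union> (\<lambda>(i, j) x. \<bar>dd i j x\<bar> powr 2) ` (Basis \<times> Basis)"

lemma family_conv: "\<exists>t. strict_mono t \<and> (\<forall>f\<in>family. aeconv t R f)"
proof (rule aeconv_subseq)
  show "finite family" by (simp add: family_def)
  show "loc1 f" if "f \<in> family" for f
    using that loc1s Vr_loc1 L_loc1 loc2s[THEN loc1_powr] r_loc_s[THEN loc1_powr] d_loc_s[THEN loc1_powr]
      r_loc_q[THEN loc1_powr] Vr_loc[THEN loc1_powr] L_loc2[THEN loc1_powr]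
    by (auto simp: family_def)
qed

lemma familyI:
  "r \<in> family" "(\<lambda>x. V x * r x) \<in> family" "L \<in> family" "(\<lambda>x. \<bar>r x\<bar> powr 2) \<in> family"
  "(\<lambda>x. \<bar>r x\<bar> powr s) \<in> family" "(\<lambda>x. \<bar>r x\<bar> powr q) \<in> family"
  "(\<lambda>x. \<bar>V x * r x\<bar> powr s') \<in> family" "(\<lambda>x. \<bar>L x\<bar> powr 2) \<in> family"
  "i \<in> Basis \<Longrightarrow> d i \<in> family" "i \<in> Basis \<Longrightarrow> (\<lambda>x. \<bar>d i x\<bar> powr 2) \<in> family"
  "i \<in> Basis \<Longrightarrow> (\<lambda>x. \<bar>d i x\<bar> powr s) \<in> family"
  "i \<in> Basis \<Longrightarrow> j \<in> Basis \<Longrightarrow> dd i j \<in> family"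
  "i \<in> Basis \<Longrightarrow> j \<in> Basis \<Longrightarrow> (\<lambda>x. \<bar>dd i j x\<bar> powr 2) \<in> family"
  unfolding family_def by auto

lemma L2_limit:
  assumes t: "strict_mono t" and R: "\<And>x. R < norm x \<Longrightarrow> c x = 0" and c: "test c"
    and f: "locp 2 f" "aeconv t R f" "aeconv t R (\<lambda>x. \<bar>f x\<bar> powr 2)"
    and g: "locp 2 g" "aeconv t R g" "aeconv t R (\<lambda>x. \<bar>g x\<bar> powr 2)"
  shows "integrable lborel (\<lambda>x. c x * (mo (t n) f x * mo (t n) g x))"
    and "(\<lambda>n. LINT x|lborel. c x * (mo (t n) f x * mo (t n) g x)) \<longlonglongrightarrow> (LINT x|lborel. c x * (f x * g x))"
proof -
  obtain C where C: "\<And>x. \<bar>c x\<bar> \<le> C" using test_bounded[OF c] by blast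
  note * = mo_bilinear_limit[OF t f(1) g(1) _ _ _ f(2) g(2) f(3) g(3) smooth_measurable[OF test_smooth[OF c]] C R]
  show "integrable lborel (\<lambda>x. c x * (mo (t n) f x * mo (t n) g x))" by (rule *(1)) auto
  show "(\<lambda>n. LINT x|lborel. c x * (mo (t n) f x * mo (t n) g x)) \<longlonglongrightarrow> (LINT x|lborel. c x * (f x * g x))"
    by (rule *(3)) auto
qed

text \<open>The multiplier in the shape required by the product limits: a fixed coefficient times
  \<open>w\<close> or times a single first derivative.\<close>

lemma mult_fun_expand:
  "smooth w \<Longrightarrow> mult_fun \<eta> w x = (\<Sum>i\<in>Basis. (2 * ((x \<bullet> i) * \<eta> x)) * pd i w x) + divx \<eta> x * w x"
  by (simp add: mult_fun_def euler_def sum_distrib_left mult_ac)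

end

text \<open>\<open>eq\<close> is the eigenvalue equation for one real component, tested with real
  functions, and \<open>hardy\<close> is the assumed inequality at \<open>r\<close> alone,
  multiplied by 4. Its finite right-hand side supplies the integrability of the integrand on the
  left.\<close>

locale virial = sobolev_setting +
  fixes z a :: real
  assumes eq: "\<And>\<phi>. test \<phi> \<Longrightarrow> (LINT x|lborel. L x * lap \<phi> x) + (LINT x|lborel. (V x * r x) * \<phi> x)
        = z * (LINT x|lborel. r x * \<phi> x)"
    and a: "0 \<le> a" "a < 1"
    and hardy: "(\<integral>\<^sup>+x. ennreal (max (\<Sum>i\<in>Basis. (x \<bullet> i) * dV i x) 0 * (r x)\<^sup>2) \<partial>lborel)
        \<le> ennreal (4 * a * (LINT x|lborel. (L x)\<^sup>2))"
begin

text \<open>The equation is tested with \<open>mo (t n) (T n)\<close>. In the potential term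
  symmetry produces \<open>mo (t n) (V * r)\<close>, whereas integration by parts needs
  \<open>V * mo (t n) r\<close>. The two versions are not compared for fixed \<open>n\<close>; both
  tend to \<open>?lim\<close>, and the second is evaluated through the weak derivatives of
  \<open>V\<close>.\<close>

lemma virial_cutoff:
  assumes \<eta>: "test \<eta>"
  shows "4 * (LINT x|lborel. \<eta> x * (L x * L x))
     + ((\<Sum>j\<in>Basis. LINT x|lborel. coefA \<eta> j x * (L x * d j x))
     + (\<Sum>j\<in>Basis. \<Sum>i\<in>Basis. LINT x|lborel. coefB \<eta> i j x * (L x * dd i j x))
     + (LINT x|lborel. lap (divx \<eta>) x * (L x * r x)))
     = (\<Sum>i\<in>Basis. LINT x|lborel. ((x \<bullet> i) * \<eta> x) * (dV i x * r x * r x))"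
proof -
  obtain R where R: "\<And>x. R < norm x \<Longrightarrow> \<eta> x = 0" using test_bound[OF \<eta>] by blast
  \<comment> \<open>Every coefficient below vanishes outside the same ball, so almost everywhere
    convergence on that ball suffices.\<close>
  have R1: "pd j \<eta> x = 0" "lap \<eta> x = 0" "divx \<eta> x = 0" "pd j (divx \<eta>) x = 0" "lap (divx \<eta>) x = 0"
    if "R < norm x" for x j
  proof -
    have p: "R < norm x \<Longrightarrow> pd i f x = 0" if "\<And>x. R < norm x \<Longrightarrow> f x = 0" for i f x
      by (rule pd_zero_outside[OF that])
    show "pd j \<eta> x = 0" by (rule p[OF R that])
    show "lap \<eta> x = 0" unfolding lap_def by (intro sum.neutral ballI p[OF p[OF R]] that)
    have d0: "divx \<eta> x = 0" if "R < norm x" for x unfolding divx_def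
      by (intro sum.neutral ballI p[OF _ that]) (simp add: R)
    then show "divx \<eta> x = 0" using that .
    show "pd j (divx \<eta>) x = 0" by (rule p[OF d0 that])
    show "lap (divx \<eta>) x = 0" unfolding lap_def by (intro sum.neutral ballI p[OF p[OF d0]] that)
  qed
  obtain t where t: "strict_mono t" and fam: "\<And>f. f \<in> family \<Longrightarrow> aeconv t R f"
    using family_conv[of R] by blast
  define w where "w n = mo (t n) r" for n
  have w: "smooth (w n)" for n unfolding w_def by (rule r_smooth)
  have pw: "i \<in> Basis \<Longrightarrow> pd i (w n) = mo (t n) (d i)"
     "i \<in> Basis \<Longrightarrow> j \<in> Basis \<Longrightarrow> pd j (pd i (w n)) = mo (t n) (dd i j)" "lap (w n) = mo (t n) L" for n i j
    unfolding w_def by (simp_all add: mo_r(1,3) mo_wd d_wd)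
  define T where "T n = mult_fun \<eta> (w n)" for n
  have T: "test (T n)" for n unfolding T_def by (rule test_mult_fun[OF \<eta> w])
  have tA: "test (coefA \<eta> j)" if "j \<in> Basis" for j using test_coefA[OF \<eta> that] .
  have tB: "test (coefB \<eta> i j)" if "j \<in> Basis" for i j using test_coefB[OF \<eta> that] .
  have tC: "test (lap (divx \<eta>))" by (intro test_lap test_divx \<eta>)
  have RA: "R < norm x \<Longrightarrow> coefA \<eta> j x = 0" for x j by (simp add: coefA_def R1)
  have RB: "R < norm x \<Longrightarrow> coefB \<eta> i j x = 0" for x i j by (simp add: coefB_def R1)
  let ?M = "\<lambda>n f g x. mo (t n) f x * mo (t n) g x"
  note lims = L2_limit[OF t _ _ L_loc2 fam[OF familyI(3)] fam[OF familyI(8)]]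
  have l1: "(\<lambda>n. LINT x|lborel. \<eta> x * ?M n L L x) \<longlonglongrightarrow> (LINT x|lborel. \<eta> x * (L x * L x))"
    and i1: "\<And>n. integrable lborel (\<lambda>x. \<eta> x * ?M n L L x)"
    by (rule lims[OF R \<eta> L_loc2 fam[OF familyI(3)] fam[OF familyI(8)]]; assumption)+
  have l2: "(\<lambda>n. LINT x|lborel. coefA \<eta> j x * ?M n L (d j) x) \<longlonglongrightarrow> (LINT x|lborel. coefA \<eta> j x * (L x * d j x))"
    and i2: "\<And>n. integrable lborel (\<lambda>x. coefA \<eta> j x * ?M n L (d j) x)" if j: "j \<in> Basis" for j
    by (rule lims[OF RA tA[OF j] loc2s(2)[OF j] fam[OF familyI(9)[OF j]] fam[OF familyI(10)[OF j]]]; assumption)+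
  have l3: "(\<lambda>n. LINT x|lborel. coefB \<eta> i j x * ?M n L (dd i j) x) \<longlonglongrightarrow> (LINT x|lborel. coefB \<eta> i j x * (L x * dd i j x))"
    and i3: "\<And>n. integrable lborel (\<lambda>x. coefB \<eta> i j x * ?M n L (dd i j) x)" if i: "i \<in> Basis" and j: "j \<in> Basis" for i j
    by (rule lims[OF RB tB[OF j] loc2s(3)[OF i j] fam[OF familyI(12)[OF i j]] fam[OF familyI(13)[OF i j]]]; assumption)+
  have l4: "(\<lambda>n. LINT x|lborel. lap (divx \<eta>) x * ?M n L r x) \<longlonglongrightarrow> (LINT x|lborel. lap (divx \<eta>) x * (L x * r x))"
    and i4: "\<And>n. integrable lborel (\<lambda>x. lap (divx \<eta>) x * ?M n L r x)"
    by (rule lims[OF R1(5) tC loc2s(1) fam[OF familyI(1)] fam[OF familyI(4)]]; assumption)+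
  have biLap: "(LINT x|lborel. L x * lap (mo (t n) (T n)) x)
     = 4 * (LINT x|lborel. \<eta> x * ?M n L L x) + ((\<Sum>j\<in>Basis. LINT x|lborel. coefA \<eta> j x * ?M n L (d j) x)
     + (\<Sum>j\<in>Basis. \<Sum>i\<in>Basis. LINT x|lborel. coefB \<eta> i j x * ?M n L (dd i j) x)
     + (LINT x|lborel. lap (divx \<eta>) x * ?M n L r x))" for n
  proof -
    have dv: "integrable lborel (\<lambda>x. \<Sum>i\<in>Basis. pd i (\<lambda>x. ((x \<bullet> i) * \<eta> x) * (lap (w n) x * lap (w n) x)) x)"
      "(LINT x|lborel. (\<Sum>i\<in>Basis. pd i (\<lambda>x. ((x \<bullet> i) * \<eta> x) * (lap (w n) x * lap (w n) x)) x)) = 0"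
      using integral_div_zero[OF \<eta> smooth_mult[OF smooth_lap smooth_lap], OF w w] by auto
    \<comment> \<open>The Laplacian commutes with the mollification, which symmetry then moves onto
      \<open>L\<close>; and \<open>mo (t n) L\<close> is \<open>lap (w n)\<close>.\<close>
    have "(LINT x|lborel. L x * lap (mo (t n) (T n)) x) = (LINT x|lborel. mo (t n) L x * lap (T n) x)"
      unfolding mo_lap[OF T] by (rule mo_symmetric[OF L_loc1 test_lap[OF T], symmetric])
    also have "\<dots> = (LINT x|lborel. 4 * (\<eta> x * ?M n L L x)
     + (\<Sum>i\<in>Basis. pd i (\<lambda>x. ((x \<bullet> i) * \<eta> x) * (lap (w n) x * lap (w n) x)) x)
     + ((\<Sum>j\<in>Basis. coefA \<eta> j x * ?M n L (d j) x)
     + (\<Sum>j\<in>Basis. \<Sum>i\<in>Basis. coefB \<eta> i j x * ?M n L (dd i j) x)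
     + lap (divx \<eta>) x * ?M n L r x))"
    proof (rule Bochner_Integration.integral_cong[OF refl])
      fix x
      have "mo (t n) L x * lap (T n) x = lap (w n) x * lap (mult_fun \<eta> (w n)) x"
        by (simp add: pw T_def)
      also have "\<dots> = 4 * (\<eta> x * (lap (w n) x * lap (w n) x))
     + (\<Sum>i\<in>Basis. pd i (\<lambda>x. ((x \<bullet> i) * \<eta> x) * (lap (w n) x * lap (w n) x)) x)
     + ((\<Sum>j\<in>Basis. coefA \<eta> j x * (lap (w n) x * pd j (w n) x))
     + (\<Sum>j\<in>Basis. \<Sum>i\<in>Basis. coefB \<eta> i j x * (lap (w n) x * pd j (pd i (w n)) x))
     + lap (divx \<eta>) x * (lap (w n) x * w n x))"
        by (rule lap_mult_fun[OF test_smooth[OF \<eta>] w])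
      finally show "mo (t n) L x * lap (T n) x = 4 * (\<eta> x * ?M n L L x)
     + (\<Sum>i\<in>Basis. pd i (\<lambda>x. ((x \<bullet> i) * \<eta> x) * (lap (w n) x * lap (w n) x)) x)
     + ((\<Sum>j\<in>Basis. coefA \<eta> j x * ?M n L (d j) x)
     + (\<Sum>j\<in>Basis. \<Sum>i\<in>Basis. coefB \<eta> i j x * ?M n L (dd i j) x)
     + lap (divx \<eta>) x * ?M n L r x)"
        by (simp add: pw mo_wd[OF d_wd] w_def[symmetric] cong: sum.cong)
    qed
    also have "\<dots> = 4 * (LINT x|lborel. \<eta> x * ?M n L L x)
     + (LINT x|lborel. (\<Sum>i\<in>Basis. pd i (\<lambda>x. ((x \<bullet> i) * \<eta> x) * (lap (w n) x * lap (w n) x)) x))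
     + ((\<Sum>j\<in>Basis. LINT x|lborel. coefA \<eta> j x * ?M n L (d j) x)
     + (\<Sum>j\<in>Basis. \<Sum>i\<in>Basis. LINT x|lborel. coefB \<eta> i j x * ?M n L (dd i j) x)
     + (LINT x|lborel. lap (divx \<eta>) x * ?M n L r x))"
    proof -
      note I = Bochner_Integration.integrable_add Bochner_Integration.integrable_sum integrable_mult_right
      have j1: "integrable lborel (\<lambda>x. 4 * (\<eta> x * ?M n L L x))" by (intro I i1)
      have j2: "integrable lborel (\<lambda>x. \<Sum>j\<in>Basis. coefA \<eta> j x * ?M n L (d j) x)" by (intro I i2)
      have j3: "integrable lborel (\<lambda>x. \<Sum>i\<in>Basis. coefB \<eta> i j x * ?M n L (dd i j) x)" if "j \<in> Basis" for j
        by (intro I i3 that)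
      have j4: "integrable lborel (\<lambda>x. \<Sum>j\<in>Basis. \<Sum>i\<in>Basis. coefB \<eta> i j x * ?M n L (dd i j) x)"
        by (intro Bochner_Integration.integrable_sum[OF j3])
      have k2: "(LINT x|lborel. (\<Sum>j\<in>Basis. coefA \<eta> j x * ?M n L (d j) x))
         = (\<Sum>j\<in>Basis. LINT x|lborel. coefA \<eta> j x * ?M n L (d j) x)"
        by (intro Bochner_Integration.integral_sum i2)
      have k3: "(LINT x|lborel. (\<Sum>i\<in>Basis. coefB \<eta> i j x * ?M n L (dd i j) x))
         = (\<Sum>i\<in>Basis. LINT x|lborel. coefB \<eta> i j x * ?M n L (dd i j) x)" if "j \<in> Basis" for j
        by (intro Bochner_Integration.integral_sum i3 that)
      have k4: "(LINT x|lborel. (\<Sum>j\<in>Basis. \<Sum>i\<in>Basis. coefB \<eta> i j x * ?M n L (dd i j) x))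
         = (\<Sum>j\<in>Basis. \<Sum>i\<in>Basis. LINT x|lborel. coefB \<eta> i j x * ?M n L (dd i j) x)"
        using k3 by (subst Bochner_Integration.integral_sum[OF j3]) auto
      show ?thesis
        unfolding Bochner_Integration.integral_add[OF Bochner_Integration.integrable_add[OF j1 dv(1)]
            Bochner_Integration.integrable_add[OF Bochner_Integration.integrable_add[OF j2 j4] i4]]
          Bochner_Integration.integral_add[OF j1 dv(1)]
          Bochner_Integration.integral_add[OF Bochner_Integration.integrable_add[OF j2 j4] i4]
          Bochner_Integration.integral_add[OF j2 j4] k2 k4
        by simp
    qed
    finally show ?thesis unfolding dv(2) by simp
  qed
  have tX: "test (\<lambda>x. 2 * ((x \<bullet> i) * \<eta> x))" for i by (intro test_cmult test_mult2[OF \<eta>] smooth_inner)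
  have tX1: "test (\<lambda>x. (x \<bullet> i) * \<eta> x)" for i by (intro test_mult2[OF \<eta>] smooth_inner)
  have tD: "test (divx \<eta>)" by (rule test_divx[OF \<eta>])
  have RX: "R < norm x \<Longrightarrow> 2 * ((x \<bullet> i) * \<eta> x) = 0" "R < norm x \<Longrightarrow> (x \<bullet> i) * \<eta> x = 0" for x i by (simp_all add: R)
  \<comment> \<open>Here the product of \<open>V\<close> and \<open>r\<close> is mollified as one
    function, with the dual exponents \<open>s'\<close> and \<open>s\<close>.\<close>
  have bil: "(\<lambda>n. LINT x|lborel. c x * ?M n (\<lambda>x. V x * r x) g x) \<longlonglongrightarrow> (LINT x|lborel. c x * ((V x * r x) * g x))"
      "\<And>n. integrable lborel (\<lambda>x. c x * ?M n (\<lambda>x. V x * r x) g x)"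
    if c: "test c" "\<And>x. R < norm x \<Longrightarrow> c x = 0" and g: "locp s g" "g \<in> family" "(\<lambda>x. \<bar>g x\<bar> powr s) \<in> family" for c g
  proof -
    obtain C where C: "\<And>x. \<bar>c x\<bar> \<le> C" using test_bounded[OF c(1)] by blast
    note * = mo_bilinear_limit[OF t Vr_loc g(1) exps(2,1,4) fam[OF familyI(2)] fam[OF g(2)] fam[OF familyI(7)] fam[OF g(3)]
        smooth_measurable[OF test_smooth[OF c(1)]] C c(2)]
    show "(\<lambda>n. LINT x|lborel. c x * ?M n (\<lambda>x. V x * r x) g x) \<longlonglongrightarrow> (LINT x|lborel. c x * ((V x * r x) * g x))"
      by (rule *(3))
    show "\<And>n. integrable lborel (\<lambda>x. c x * ?M n (\<lambda>x. V x * r x) g x)" by (rule *(1))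
  qed
  have D3: "D / 3 > 1" "D / 4 > 1" using D by auto
  \<comment> \<open>Here \<open>V\<close> stays outside the mollification, with the exponents
    \<open>D / 3\<close>, \<open>q\<close> and \<open>s\<close>; the limit is the same as in
    \<open>bil\<close>.\<close>
  have tril: "(\<lambda>n. LINT x|lborel. c x * (V x * mo (t n) r x * mo (t n) g x)) \<longlonglongrightarrow> (LINT x|lborel. c x * ((V x * r x) * g x))"
      "\<And>n. integrable lborel (\<lambda>x. c x * (V x * mo (t n) r x * mo (t n) g x))"
    if c: "test c" "\<And>x. R < norm x \<Longrightarrow> c x = 0" and g: "locp s g" "g \<in> family" "(\<lambda>x. \<bar>g x\<bar> powr s) \<in> family" for c g
  proof -
    obtain C where C: "\<And>x. \<bar>c x\<bar> \<le> C" using test_bounded[OF c(1)] by blast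
    note * = mo_trilinear_limit[OF t V_loc_3 r_loc_q g(1) D3(1) exps(3,1,5) fam[OF familyI(1)] fam[OF g(2)] fam[OF familyI(6)] fam[OF g(3)]
        smooth_measurable[OF test_smooth[OF c(1)]] C c(2)]
    show "(\<lambda>n. LINT x|lborel. c x * (V x * mo (t n) r x * mo (t n) g x)) \<longlonglongrightarrow> (LINT x|lborel. c x * ((V x * r x) * g x))"
      by (rule *(3))
    show "\<And>n. integrable lborel (\<lambda>x. c x * (V x * mo (t n) r x * mo (t n) g x))" by (rule *(1))
  qed
  have trilV: "(\<lambda>n. LINT x|lborel. c x * (dV i x * mo (t n) r x * mo (t n) r x)) \<longlonglongrightarrow> (LINT x|lborel. c x * (dV i x * r x * r x))"
    if c: "test c" "\<And>x. R < norm x \<Longrightarrow> c x = 0" and i: "i \<in> Basis" for c i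
  proof -
    obtain C where C: "\<And>x. \<bar>c x\<bar> \<le> C" using test_bounded[OF c(1)] by blast
    show ?thesis
      by (rule mo_trilinear_limit(3)[OF t dV_loc[OF i] r_loc_q r_loc_q D3(2) exps(3,3,6) fam[OF familyI(1)] fam[OF familyI(1)]
         fam[OF familyI(6)] fam[OF familyI(6)] smooth_measurable[OF test_smooth[OF c(1)]] C c(2)])
  qed
  let ?lim = "(\<Sum>i\<in>Basis. LINT x|lborel. (2 * ((x \<bullet> i) * \<eta> x)) * ((V x * r x) * d i x)) + (LINT x|lborel. divx \<eta> x * ((V x * r x) * r x))"
  have pot1: "(\<lambda>n. LINT x|lborel. (V x * r x) * mo (t n) (T n) x) \<longlonglongrightarrow> ?lim"
  proof -
    have e: "(LINT x|lborel. (V x * r x) * mo (t n) (T n) x)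
      = (\<Sum>i\<in>Basis. LINT x|lborel. (2 * ((x \<bullet> i) * \<eta> x)) * ?M n (\<lambda>x. V x * r x) (d i) x) + (LINT x|lborel. divx \<eta> x * ?M n (\<lambda>x. V x * r x) r x)" for n
    proof -
      note b = bil(2)[OF tX RX(1) d_loc_s familyI(9) familyI(11)] bil(2)[OF tD R1(3) r_loc_s familyI(1,5)]
      have "(LINT x|lborel. (V x * r x) * mo (t n) (T n) x) = (LINT x|lborel. mo (t n) (\<lambda>x. V x * r x) x * T n x)"
        by (rule mo_symmetric[OF Vr_loc1 T, symmetric])
      also have "\<dots> = (LINT x|lborel. (\<Sum>i\<in>Basis. (2 * ((x \<bullet> i) * \<eta> x)) * ?M n (\<lambda>x. V x * r x) (d i) x) + divx \<eta> x * ?M n (\<lambda>x. V x * r x) r x)"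
        unfolding T_def mult_fun_expand[OF w]
        by (intro Bochner_Integration.integral_cong refl) (simp add: pw w_def[symmetric] sum_distrib_left distrib_left mult_ac cong: sum.cong)
      also have "\<dots> = (\<Sum>i\<in>Basis. LINT x|lborel. (2 * ((x \<bullet> i) * \<eta> x)) * ?M n (\<lambda>x. V x * r x) (d i) x) + (LINT x|lborel. divx \<eta> x * ?M n (\<lambda>x. V x * r x) r x)"
        using b by (subst Bochner_Integration.integral_add) (auto intro!: Bochner_Integration.integrable_sum Bochner_Integration.integral_sum)
      finally show ?thesis .
    qed
    show ?thesis unfolding e
      by (intro tendsto_add tendsto_sum bil(1)[OF tX RX(1) d_loc_s familyI(9) familyI(11)] bil(1)[OF tD R1(3) r_loc_s familyI(1,5)])
  qed
  have pot2: "(\<lambda>n. LINT x|lborel. V x * (w n x * T n x)) \<longlonglongrightarrow> ?lim"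
  proof -
    have e: "(LINT x|lborel. V x * (w n x * T n x))
      = (\<Sum>i\<in>Basis. LINT x|lborel. (2 * ((x \<bullet> i) * \<eta> x)) * (V x * mo (t n) r x * mo (t n) (d i) x)) + (LINT x|lborel. divx \<eta> x * (V x * mo (t n) r x * mo (t n) r x))" for n
    proof -
      note b = tril(2)[OF tX RX(1) d_loc_s familyI(9) familyI(11)] tril(2)[OF tD R1(3) r_loc_s familyI(1,5)]
      have "(LINT x|lborel. V x * (w n x * T n x)) = (LINT x|lborel. (\<Sum>i\<in>Basis. (2 * ((x \<bullet> i) * \<eta> x)) * (V x * mo (t n) r x * mo (t n) (d i) x)) + divx \<eta> x * (V x * mo (t n) r x * mo (t n) r x))"
        unfolding T_def mult_fun_expand[OF w]
        by (intro Bochner_Integration.integral_cong refl) (simp add: pw w_def[symmetric] sum_distrib_left distrib_left mult_ac cong: sum.cong)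
      also have "\<dots> = (\<Sum>i\<in>Basis. LINT x|lborel. (2 * ((x \<bullet> i) * \<eta> x)) * (V x * mo (t n) r x * mo (t n) (d i) x)) + (LINT x|lborel. divx \<eta> x * (V x * mo (t n) r x * mo (t n) r x))"
        using b by (subst Bochner_Integration.integral_add) (auto intro!: Bochner_Integration.integrable_sum Bochner_Integration.integral_sum)
      finally show ?thesis .
    qed
    show ?thesis unfolding e
      by (intro tendsto_add tendsto_sum tril(1)[OF tX RX(1) d_loc_s familyI(9) familyI(11)] tril(1)[OF tD R1(3) r_loc_s familyI(1,5)])
  qed
  have wT: "w n x * T n x = (\<Sum>i\<in>Basis. pd i (\<lambda>x. ((x \<bullet> i) * \<eta> x) * (w n x * w n x)) x)" for n x
    unfolding div_square[OF test_smooth[OF \<eta>] w] T_def mult_fun_def by (simp add: algebra_simps)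
  \<comment> \<open>By \<open>wT\<close> the product \<open>w n * T n\<close> is a sum of partial
    derivatives of test functions, which may be moved onto \<open>V\<close>.\<close>
  have pot3: "(LINT x|lborel. V x * (w n x * T n x)) = - (\<Sum>i\<in>Basis. LINT x|lborel. ((x \<bullet> i) * \<eta> x) * (dV i x * mo (t n) r x * mo (t n) r x))" for n
  proof -
    have tt: "test (\<lambda>x. ((x \<bullet> i) * \<eta> x) * (w n x * w n x))" for i
      by (intro test_mult[OF tX1] smooth_mult w)
    have "(LINT x|lborel. V x * (w n x * T n x)) = (LINT x|lborel. (\<Sum>i\<in>Basis. pd i (\<lambda>x. ((x \<bullet> i) * \<eta> x) * (w n x * w n x)) x * V x))"
      unfolding wT by (simp add: sum_distrib_left mult_ac)
    also have "\<dots> = (\<Sum>i\<in>Basis. LINT x|lborel. pd i (\<lambda>x. ((x \<bullet> i) * \<eta> x) * (w n x * w n x)) x * V x)"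
      by (intro Bochner_Integration.integral_sum test_integrable_loc1[OF test_pd[OF tt] loc1s(2)])
    also have "\<dots> = (\<Sum>i\<in>Basis. - (LINT x|lborel. (((x \<bullet> i) * \<eta> x) * (w n x * w n x)) * dV i x))"
      using V_wd tt by (intro sum.cong) (auto simp: wd_def)
    finally show ?thesis by (simp add: sum_negf w_def mult_ac)
  qed
  have zero: "(LINT x|lborel. r x * mo (t n) (T n) x) = 0" for n
  proof -
    have "(LINT x|lborel. r x * mo (t n) (T n) x) = (LINT x|lborel. w n x * T n x)"
      unfolding w_def by (rule mo_symmetric[OF loc1s(1) T, symmetric])
    also have "\<dots> = 0" unfolding wT by (rule integral_div_zero(1)[OF \<eta> smooth_mult[OF w w]])
    finally show ?thesis .
  qed
  have "(LINT x|lborel. L x * lap (mo (t n) (T n)) x) + (LINT x|lborel. (V x * r x) * mo (t n) (T n) x) = 0" for n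
    using eq[OF mo_test[OF T], of "t n" n] zero by simp
  then have main: "4 * (LINT x|lborel. \<eta> x * ?M n L L x) + ((\<Sum>j\<in>Basis. LINT x|lborel. coefA \<eta> j x * ?M n L (d j) x)
     + (\<Sum>j\<in>Basis. \<Sum>i\<in>Basis. LINT x|lborel. coefB \<eta> i j x * ?M n L (dd i j) x)
     + (LINT x|lborel. lap (divx \<eta>) x * ?M n L r x))
    = - (LINT x|lborel. (V x * r x) * mo (t n) (T n) x)" for n
    unfolding biLap by (simp add: eq_neg_iff_add_eq_0)
  have "(\<lambda>n. 4 * (LINT x|lborel. \<eta> x * ?M n L L x) + ((\<Sum>j\<in>Basis. LINT x|lborel. coefA \<eta> j x * ?M n L (d j) x)
     + (\<Sum>j\<in>Basis. \<Sum>i\<in>Basis. LINT x|lborel. coefB \<eta> i j x * ?M n L (dd i j) x)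
     + (LINT x|lborel. lap (divx \<eta>) x * ?M n L r x)))
    \<longlonglongrightarrow> 4 * (LINT x|lborel. \<eta> x * (L x * L x))
     + ((\<Sum>j\<in>Basis. LINT x|lborel. coefA \<eta> j x * (L x * d j x))
     + (\<Sum>j\<in>Basis. \<Sum>i\<in>Basis. LINT x|lborel. coefB \<eta> i j x * (L x * dd i j x))
     + (LINT x|lborel. lap (divx \<eta>) x * (L x * r x)))"
    by (intro tendsto_add tendsto_mult tendsto_const tendsto_sum l1 l2 l3 l4)
  then have "- ?lim = 4 * (LINT x|lborel. \<eta> x * (L x * L x))
     + ((\<Sum>j\<in>Basis. LINT x|lborel. coefA \<eta> j x * (L x * d j x))
     + (\<Sum>j\<in>Basis. \<Sum>i\<in>Basis. LINT x|lborel. coefB \<eta> i j x * (L x * dd i j x))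
     + (LINT x|lborel. lap (divx \<eta>) x * (L x * r x)))"
    unfolding main by (rule LIMSEQ_unique[OF tendsto_minus[OF pot1]])
  moreover have "?lim = - (\<Sum>i\<in>Basis. LINT x|lborel. ((x \<bullet> i) * \<eta> x) * (dV i x * r x * r x))"
  proof (rule LIMSEQ_unique[OF pot2])
    show "(\<lambda>n. LINT x|lborel. V x * (w n x * T n x)) \<longlonglongrightarrow> - (\<Sum>i\<in>Basis. LINT x|lborel. ((x \<bullet> i) * \<eta> x) * (dV i x * r x * r x))"
      unfolding pot3 by (intro tendsto_minus tendsto_sum trilV tX1 RX(2))
  qed
  ultimately show ?thesis by simp
qed

end

section \<open>Removal of the cut-off by scaling\<close>

lemma pd_cong_ball:
  assumes "\<And>x. norm x < 1 \<Longrightarrow> f x = g x" "smooth g" "norm x < 1"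
  shows "pd i f x = pd i g x"
proof -
  have "(g has_derivative frechet_derivative g (at x)) (at x)"
    by (rule has_derivative_frechet[OF smooth_differentiable[OF assms(2)]])
  then have "(f has_derivative frechet_derivative g (at x)) (at x)"
    by (rule has_derivative_transform_within_open[of _ _ _ _ "ball 0 1"]) (use assms in auto)
  then show ?thesis using pd_eqI by (metis pd_def)
qed

lemma scale_pd: "smooth f \<Longrightarrow> pd i (\<lambda>x. f (c *\<^sub>R x)) = (\<lambda>x. c * pd i f (c *\<^sub>R x))"
  using smooth_pd_affine[of f i c 0] by simp

lemma scale_smooth: "smooth f \<Longrightarrow> smooth (\<lambda>x. f (c *\<^sub>R x))"
  using smooth_affine[of f c 0] by simp

lemma scale_test: "test f \<Longrightarrow> c \<noteq> 0 \<Longrightarrow> test (\<lambda>x. f (c *\<^sub>R x))"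
  using test_affine[of f c 0] by simp

lemma smooth_pd_cmult: "smooth f \<Longrightarrow> pd i (\<lambda>x. c * f x) = (\<lambda>x. c * pd i f x)"
  by (simp add: smooth_pd_mult)

lemma scale_lap:
  assumes "smooth f" shows "lap (\<lambda>x. f (c *\<^sub>R x)) x = c\<^sup>2 * lap f (c *\<^sub>R x)"
proof -
  have "pd i (pd i (\<lambda>x. f (c *\<^sub>R x))) x = c\<^sup>2 * pd i (pd i f) (c *\<^sub>R x)" if "i \<in> Basis" for i
    using assms that by (simp add: scale_pd smooth_pd_cmult scale_smooth smooth_pd power2_eq_square)
  then show ?thesis by (simp add: lap_def sum_distrib_left)
qed

text \<open>The field \<open>x\<close> is homogeneous of degree one, so the chain rule factor
  \<open>c\<close> is compensated by rescaling the coordinate.\<close>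

lemma scale_divx:
  assumes "smooth f" "c \<noteq> 0" shows "divx (\<lambda>x. f (c *\<^sub>R x)) = (\<lambda>x. divx f (c *\<^sub>R x))"
proof (rule ext)
  fix x
  have "pd i (\<lambda>x. (x \<bullet> i) * f (c *\<^sub>R x)) x = pd i (\<lambda>y. (y \<bullet> i) * f y) (c *\<^sub>R x)" for i
  proof -
    have sm: "smooth (\<lambda>y. (y \<bullet> i) * f y)" using assms by auto
    have "(\<lambda>x. (x \<bullet> i) * f (c *\<^sub>R x)) = (\<lambda>x. (1 / c) * ((\<lambda>y. (y \<bullet> i) * f y) (c *\<^sub>R x)))"
      using assms(2) by auto
    then have "pd i (\<lambda>x. (x \<bullet> i) * f (c *\<^sub>R x)) x = (1 / c) * (c * pd i (\<lambda>y. (y \<bullet> i) * f y) (c *\<^sub>R x))"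
      using scale_pd[OF sm, of i c] smooth_pd_cmult[OF scale_smooth[OF sm], of i "1 / c" c] by simp
    then show ?thesis using assms(2) by simp
  qed
  then show "divx (\<lambda>x. f (c *\<^sub>R x)) x = divx f (c *\<^sub>R x)" by (simp add: divx_def)
qed

text \<open>The case \<open>m = 0\<close> is included: smallness comes from \<open>k\<close>
  vanishing on the unit ball, so that the scaled integrand is eventually 0 at each point while
  \<open>C * \<bar>f x\<bar>\<close> dominates it.\<close>

lemma scaled_integral_limit:
  fixes f k :: "'a::euclidean_space \<Rightarrow> real"
  assumes f: "integrable lborel f" and k: "test k" and k0: "\<And>x. norm x < 1 \<Longrightarrow> k x = 0"
  shows "(\<lambda>n. LINT x|lborel. ((1 / (real n + 1)) ^ m * k ((1 / (real n + 1)) *\<^sub>R x)) * f x) \<longlonglongrightarrow> 0"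
proof -
  obtain C where C: "C > 0" "\<And>x. \<bar>k x\<bar> \<le> C" using test_bounded[OF k] by blast
  note [measurable] = borel_measurable_integrable[OF f] smooth_measurable[OF scale_smooth[OF test_smooth[OF k]]]
  have "(\<lambda>n. LINT x|lborel. ((1 / (real n + 1)) ^ m * k ((1 / (real n + 1)) *\<^sub>R x)) * f x)
      \<longlonglongrightarrow> integral\<^sup>L lborel (\<lambda>x::'a. 0)"
  proof (rule integral_dominated_convergence[where w="\<lambda>x. C * \<bar>f x\<bar>"])
    show "AE x in lborel. (\<lambda>n. ((1 / (real n + 1)) ^ m * k ((1 / (real n + 1)) *\<^sub>R x)) * f x) \<longlonglongrightarrow> 0"
    proof (intro always_eventually allI)
      fix x :: 'a
      obtain N where N: "norm x < real N" using reals_Archimedean2 by blast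
      have "((1 / (real n + 1)) ^ m * k ((1 / (real n + 1)) *\<^sub>R x)) * f x = 0" if "n \<ge> N" for n
      proof -
        have "norm ((1 / (real n + 1)) *\<^sub>R x) < 1" using N that by (simp add: field_simps)
        then show ?thesis using k0 by simp
      qed
      then show "(\<lambda>n. ((1 / (real n + 1)) ^ m * k ((1 / (real n + 1)) *\<^sub>R x)) * f x) \<longlonglongrightarrow> 0"
        by (intro tendsto_eventually) (auto simp: eventually_sequentially)
    qed
    show "AE x in lborel. norm (((1 / (real n + 1)) ^ m * k ((1 / (real n + 1)) *\<^sub>R x)) * f x) \<le> C * \<bar>f x\<bar>" for n
    proof (intro always_eventually allI)
      fix x :: 'a
      have "\<bar>(1 / (real n + 1)) ^ m\<bar> \<le> 1" by (auto intro!: power_le_one)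
      then have "\<bar>(1 / (real n + 1)) ^ m\<bar> * \<bar>k ((1 / (real n + 1)) *\<^sub>R x)\<bar> \<le> 1 * C"
        using C by (intro mult_mono) auto
      then show "norm (((1 / (real n + 1)) ^ m * k ((1 / (real n + 1)) *\<^sub>R x)) * f x) \<le> C * \<bar>f x\<bar>"
        unfolding real_norm_def abs_mult by (intro mult_right_mono) auto
    qed
    show "integrable lborel (\<lambda>x. C * \<bar>f x\<bar>)" using f by simp
  qed measurable
  then show ?thesis by simp
qed

lemma scaled_cutoff_limit:
  fixes f k :: "'a::euclidean_space \<Rightarrow> real"
  assumes f: "integrable lborel f" and k: "test k" and k0: "\<And>x. norm x < 1 \<Longrightarrow> k x = 1"
  shows "(\<lambda>n. LINT x|lborel. k ((1 / (real n + 1)) *\<^sub>R x) * f x) \<longlonglongrightarrow> (LINT x|lborel. f x)"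
proof -
  obtain C where C: "C > 0" "\<And>x. \<bar>k x\<bar> \<le> C" using test_bounded[OF k] by blast
  note [measurable] = borel_measurable_integrable[OF f] smooth_measurable[OF scale_smooth[OF test_smooth[OF k]]]
  show ?thesis
  proof (rule integral_dominated_convergence[where w="\<lambda>x. C * \<bar>f x\<bar>"])
    show "AE x in lborel. (\<lambda>n. k ((1 / (real n + 1)) *\<^sub>R x) * f x) \<longlonglongrightarrow> f x"
    proof (intro always_eventually allI)
      fix x :: 'a
      obtain N where N: "norm x < real N" using reals_Archimedean2 by blast
      have "k ((1 / (real n + 1)) *\<^sub>R x) * f x = f x" if "n \<ge> N" for n
      proof -
        have "norm ((1 / (real n + 1)) *\<^sub>R x) < 1" using N that by (simp add: field_simps)
        then show ?thesis using k0 by simp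
      qed
      then show "(\<lambda>n. k ((1 / (real n + 1)) *\<^sub>R x) * f x) \<longlonglongrightarrow> f x"
        by (intro tendsto_eventually) (auto simp: eventually_sequentially)
    qed
    show "AE x in lborel. norm (k ((1 / (real n + 1)) *\<^sub>R x) * f x) \<le> C * \<bar>f x\<bar>" for n
      using C unfolding real_norm_def abs_mult by (intro always_eventually allI mult_right_mono) auto
    show "integrable lborel (\<lambda>x. C * \<bar>f x\<bar>)" using f by simp
  qed measurable
qed

text \<open>The supports of the translated kernels leave every bounded set, so dominated convergence
  applies. This later excludes nonzero constants.\<close>

lemma moll_integral_at_infinity:
  fixes g :: "'a::euclidean_space \<Rightarrow> real"
  assumes g: "integrable lborel g" and b: "b \<in> Basis"
  shows "(\<lambda>k. mo n g (real k *\<^sub>R b)) \<longlonglongrightarrow> 0"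
proof -
  let ?m = "moll (1 / (real n + 1)) :: 'a \<Rightarrow> real"
  obtain C where C: "C > 0" "\<And>x. \<bar>?m x\<bar> \<le> C" using test_bounded[OF moll_n] by blast
  note [measurable] = borel_measurable_integrable[OF g] smooth_measurable[OF test_smooth[OF test_reflect[OF moll_n]]]
  have "(\<lambda>k. LINT y|lborel. ?m (real k *\<^sub>R b - y) * g y) \<longlonglongrightarrow> integral\<^sup>L lborel (\<lambda>x::'a. 0)"
  proof (rule integral_dominated_convergence[where w="\<lambda>x. C * \<bar>g x\<bar>"])
    show "AE y in lborel. (\<lambda>k. ?m (real k *\<^sub>R b - y) * g y) \<longlonglongrightarrow> 0"
    proof (intro always_eventually allI)
      fix y :: 'a
      obtain N where N: "norm y + 1 < real N" using reals_Archimedean2 by blast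
      have "?m (real k *\<^sub>R b - y) * g y = 0" if "k \<ge> N" for k
      proof -
        have "norm (real k *\<^sub>R b) = real k" using b by simp
        then have "real k - norm y \<le> norm (real k *\<^sub>R b - y)"
          using norm_triangle_ineq2[of "real k *\<^sub>R b" y] by (simp only:)
        moreover have "real N \<le> real k" using that by simp
        ultimately have 1: "1 \<le> norm (real k *\<^sub>R b - y)" using N by linarith
        have "1 / (real n + 1) \<le> 1" by simp
        then have "?m (real k *\<^sub>R b - y) = 0" by (intro moll_zero order_trans[OF _ 1]) auto
        then show ?thesis by simp
      qed
      then show "(\<lambda>k. ?m (real k *\<^sub>R b - y) * g y) \<longlonglongrightarrow> 0"
        by (intro tendsto_eventually) (auto simp: eventually_sequentially)
    qed
    show "AE y in lborel. norm (?m (real k *\<^sub>R b - y) * g y) \<le> C * \<bar>g y\<bar>" for k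
      using C unfolding real_norm_def abs_mult by (intro always_eventually allI mult_right_mono) auto
    show "integrable lborel (\<lambda>x. C * \<bar>g x\<bar>)" using g by simp
  qed measurable
  then show ?thesis by (simp add: mo_def conv_def)
qed

lemma square_integral_zero:
  assumes "integrable M (\<lambda>x. (f x)\<^sup>2)" "(LINT x|M. (f x)\<^sup>2) = (0::real)"
  shows "AE x in M. f x = 0"
  using integral_nonneg_eq_0_iff_AE[OF assms(1)] assms(2) by auto

context virial
begin

lemma dV_integrable:
  assumes c: "test c" and i: "i \<in> Basis"
  shows "integrable lborel (\<lambda>x. c x * (dV i x * r x * r x))"
proof -
  obtain R where R: "\<And>x. R < norm x \<Longrightarrow> c x = 0" using test_bound[OF c] by blast
  obtain C where C: "\<And>x. \<bar>c x\<bar> \<le> C" using test_bounded[OF c] by blast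
  \<comment> \<open>The sequence is auxiliary: integrability is a by-product of
    \<open>mo_trilinear_limit\<close>.\<close>
  obtain t where t: "strict_mono t" and fam: "\<And>f. f \<in> family \<Longrightarrow> aeconv t R f"
    using family_conv[of R] by blast
  have "D / 4 > 1" using D by simp
  then show ?thesis
    by (rule mo_trilinear_limit(2)[OF t dV_loc[OF i] r_loc_q r_loc_q _ exps(3,3,6) fam[OF familyI(1)] fam[OF familyI(1)]
         fam[OF familyI(6)] fam[OF familyI(6)] smooth_measurable[OF test_smooth[OF c]] C R])
qed

lemma measurables [measurable]: "r \<in> borel_measurable borel"
  "i \<in> Basis \<Longrightarrow> d i \<in> borel_measurable borel" "i \<in> Basis \<Longrightarrow> dV i \<in> borel_measurable borel"
  "i \<in> Basis \<Longrightarrow> j \<in> Basis \<Longrightarrow> dd i j \<in> borel_measurable borel"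
  using loc1s by (auto intro: loc1_measurable)

text \<open>As \<open>0 \<le> \<eta> x \<le> 1\<close>, the cut-off radial derivative of
  \<open>V\<close> is at most its positive part without cut-off. The negative part is integrated
  only under the cut-off, so no global integrability of it is involved.\<close>

lemma virial_bound:
  assumes \<eta>: "test \<eta>" and b: "\<And>x. 0 \<le> \<eta> x" "\<And>x. \<eta> x \<le> 1"
  shows "(\<Sum>i\<in>Basis. LINT x|lborel. ((x \<bullet> i) * \<eta> x) * (dV i x * r x * r x)) \<le> 4 * a * (LINT x|lborel. (L x)\<^sup>2)"
proof -
  let ?W = "\<lambda>x. \<Sum>i\<in>Basis. (x \<bullet> i) * dV i x"
  let ?P = "\<lambda>x. max (?W x) 0 * (r x)\<^sup>2"
  have t: "test (\<lambda>x. (x \<bullet> i) * \<eta> x)" for i by (intro test_mult2[OF \<eta>] smooth_inner)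
  have mW: "?W \<in> borel_measurable borel" by (intro borel_measurable_sum borel_measurable_times) auto
  then have mP: "?P \<in> borel_measurable lborel" by simp
  have fin: "(\<integral>\<^sup>+x. ennreal (?P x) \<partial>lborel) < \<infinity>" by (rule le_less_trans[OF hardy]) simp
  have iP: "integrable lborel ?P" by (rule integrableI_nonneg[OF mP _ fin]) auto
  have "ennreal (LINT x|lborel. ?P x) \<le> ennreal (4 * a * (LINT x|lborel. (L x)\<^sup>2))"
    using nn_integral_eq_integral[OF iP] hardy by simp
  then have P: "(LINT x|lborel. ?P x) \<le> 4 * a * (LINT x|lborel. (L x)\<^sup>2)"
    using a by (subst (asm) ennreal_le_iff) auto
  have "(\<Sum>i\<in>Basis. LINT x|lborel. ((x \<bullet> i) * \<eta> x) * (dV i x * r x * r x))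
     = (LINT x|lborel. (\<Sum>i\<in>Basis. ((x \<bullet> i) * \<eta> x) * (dV i x * r x * r x)))"
    by (rule Bochner_Integration.integral_sum[symmetric]) (intro dV_integrable t)
  also have "\<dots> \<le> (LINT x|lborel. ?P x)"
  proof (rule integral_mono[OF _ iP])
    show "integrable lborel (\<lambda>x. \<Sum>i\<in>Basis. ((x \<bullet> i) * \<eta> x) * (dV i x * r x * r x))"
      by (intro Bochner_Integration.integrable_sum dV_integrable t)
    fix x
    have "(\<Sum>i\<in>Basis. ((x \<bullet> i) * \<eta> x) * (dV i x * r x * r x)) = (\<eta> x * ?W x) * (r x)\<^sup>2"
      by (simp add: sum_distrib_left sum_distrib_right power2_eq_square mult_ac)
    also have "\<dots> \<le> max (?W x) 0 * (r x)\<^sup>2"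
    proof (rule mult_right_mono)
      have "\<eta> x * ?W x \<le> \<eta> x * max (?W x) 0" using b by (intro mult_left_mono) auto
      also have "\<dots> \<le> 1 * max (?W x) 0" using b by (intro mult_right_mono) auto
      finally show "\<eta> x * ?W x \<le> max (?W x) 0" by simp
    qed simp
    finally show "(\<Sum>i\<in>Basis. ((x \<bullet> i) * \<eta> x) * (dV i x * r x * r x)) \<le> ?P x" .
  qed
  finally show ?thesis using P by simp
qed

text \<open>As the cut-off widens, all error terms of \<open>virial_cutoff\<close> tend to 0, and
  \<open>virial_bound\<close> leaves \<open>4 * (1 - a)\<close> times the integral of the square of
  \<open>L\<close> at most 0.\<close>

lemma L_zero: "AE x in lborel. L x = 0"
proof -
  obtain \<eta> :: "'a \<Rightarrow> real" where \<eta>: "test \<eta>" "\<And>x. 0 \<le> \<eta> x" "\<And>x. \<eta> x \<le> 1" "\<And>x. norm x < 1 \<Longrightarrow> \<eta> x = 1"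
    using cutoff_exists by blast
  note sm = test_smooth[OF \<eta>(1)]
  have p0: "pd j \<eta> x = 0" if "norm x < 1" for j x
    using pd_cong_ball[of \<eta> "\<lambda>_. 1" x j] \<eta>(4) that by simp
  have pp0: "pd j (pd i \<eta>) x = 0" if "norm x < 1" for i j x
    using pd_cong_ball[of "pd i \<eta>" "\<lambda>_. 0" x j] p0 that by simp
  have l0: "lap \<eta> x = 0" if "norm x < 1" for x using pp0 that by (simp add: lap_def)
  have dx: "divx \<eta> x = real DIM('a)" if "norm x < 1" for x
  proof -
    have "pd i (\<lambda>x. (x \<bullet> i) * \<eta> x) x = 1" if "i \<in> Basis" for i
      using pd_cong_ball[of "\<lambda>x. (x \<bullet> i) * \<eta> x" "\<lambda>x. x \<bullet> i" x i] \<eta>(4) \<open>norm x < 1\<close> that by simp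
    then show ?thesis by (simp add: divx_def)
  qed
  have pd0: "pd j (divx \<eta>) x = 0" if "norm x < 1" for j x
    using pd_cong_ball[of "divx \<eta>" "\<lambda>_. real DIM('a)" x j] dx that by simp
  have ppd0: "pd j (pd i (divx \<eta>)) x = 0" if "norm x < 1" for i j x
    using pd_cong_ball[of "pd i (divx \<eta>)" "\<lambda>_. 0" x j] pd0 that by simp
  have ld0: "lap (divx \<eta>) x = 0" if "norm x < 1" for x using ppd0 that by (simp add: lap_def)
  \<comment> \<open>Under this scaling the three kinds of error coefficient acquire the powers 1, 0
    and 2 of \<open>c n\<close>. The scale-invariant \<open>coefB\<close> is harmless because it
    vanishes on growing balls.\<close>
  define c where "c n = 1 / (real n + 1)" for n
  define e where "e n x = \<eta> (c n *\<^sub>R x)" for n x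
  have c0: "c n \<noteq> 0" for n by (simp add: c_def)
  have te: "test (e n)" for n unfolding e_def[abs_def] by (rule scale_test[OF \<eta>(1) c0])
  have A: "coefA (e n) j x = c n ^ 1 * coefA \<eta> j (c n *\<^sub>R x)" if "j \<in> Basis" for n j x
    unfolding coefA_def e_def[abs_def] scale_lap[OF sm]
    using sm c0[of n] by (simp add: scale_pd scale_divx smooth_divx power2_eq_square algebra_simps)
  have B: "coefB (e n) i j x = c n ^ 0 * coefB \<eta> i j (c n *\<^sub>R x)" for n i j x
    unfolding coefB_def e_def[abs_def] using sm by (simp add: scale_pd)
  have C: "lap (divx (e n)) x = c n ^ 2 * lap (divx \<eta>) (c n *\<^sub>R x)" for n x
    unfolding e_def[abs_def] scale_divx[OF sm c0] by (rule scale_lap[OF smooth_divx[OF sm]])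
  have iLf: "integrable lborel (\<lambda>x. L x * f x)" if "f \<in> borel_measurable borel" "integrable lborel (\<lambda>x. (f x)\<^sup>2)" for f
    by (rule integrable_mult_squares[OF L_measurable that(1) L_sq that(2)])
  have lA: "(\<lambda>n. LINT x|lborel. coefA (e n) j x * (L x * d j x)) \<longlonglongrightarrow> 0" if j: "j \<in> Basis" for j
    unfolding A[OF j] c_def
    by (rule scaled_integral_limit[OF iLf[OF measurables(2)[OF j] d_sq[OF j]] test_coefA[OF \<eta>(1) j]])
       (simp add: coefA_def p0 pd0 l0)
  have lB: "(\<lambda>n. LINT x|lborel. coefB (e n) i j x * (L x * dd i j x)) \<longlonglongrightarrow> 0" if i: "i \<in> Basis" and j: "j \<in> Basis" for i j
    unfolding B c_def
    by (rule scaled_integral_limit[OF iLf[OF measurables(4)[OF i j] dd_sq[OF i j]] test_coefB[OF \<eta>(1) j]])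
       (simp add: coefB_def p0)
  have lC: "(\<lambda>n. LINT x|lborel. lap (divx (e n)) x * (L x * r x)) \<longlonglongrightarrow> 0"
    unfolding C c_def
    by (rule scaled_integral_limit[OF iLf[OF measurables(1) r_sq] test_lap[OF test_divx[OF \<eta>(1)]] ld0])
  have lM: "(\<lambda>n. LINT x|lborel. e n x * (L x * L x)) \<longlonglongrightarrow> (LINT x|lborel. L x * L x)"
    unfolding e_def c_def by (rule scaled_cutoff_limit[OF iLf[OF L_measurable L_sq] \<eta>(1,4)])
  have "(\<lambda>n. 4 * (LINT x|lborel. e n x * (L x * L x))
     + ((\<Sum>j\<in>Basis. LINT x|lborel. coefA (e n) j x * (L x * d j x))
     + (\<Sum>j\<in>Basis. \<Sum>i\<in>Basis. LINT x|lborel. coefB (e n) i j x * (L x * dd i j x))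
     + (LINT x|lborel. lap (divx (e n)) x * (L x * r x))))
    \<longlonglongrightarrow> 4 * (LINT x|lborel. L x * L x) + ((\<Sum>j\<in>(Basis::'a set). 0) + (\<Sum>j\<in>(Basis::'a set). \<Sum>i\<in>(Basis::'a set). 0) + 0)"
    by (intro tendsto_add tendsto_mult tendsto_const tendsto_sum lM lA lB lC)
  moreover have "4 * (LINT x|lborel. e n x * (L x * L x))
     + ((\<Sum>j\<in>Basis. LINT x|lborel. coefA (e n) j x * (L x * d j x))
     + (\<Sum>j\<in>Basis. \<Sum>i\<in>Basis. LINT x|lborel. coefB (e n) i j x * (L x * dd i j x))
     + (LINT x|lborel. lap (divx (e n)) x * (L x * r x))) \<le> 4 * a * (LINT x|lborel. (L x)\<^sup>2)" for n
    unfolding virial_cutoff[OF te] by (rule virial_bound[OF te]) (auto simp: e_def \<eta>)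
  ultimately have "4 * (LINT x|lborel. L x * L x) + ((\<Sum>j\<in>(Basis::'a set). 0) + (\<Sum>j\<in>(Basis::'a set). \<Sum>i\<in>(Basis::'a set). 0) + 0)
     \<le> 4 * a * (LINT x|lborel. (L x)\<^sup>2)"
    by (intro LIMSEQ_le_const2) auto
  then have "4 * (1 - a) * (LINT x|lborel. (L x)\<^sup>2) \<le> 0" by (simp add: power2_eq_square algebra_simps)
  moreover have "(LINT x|lborel. (L x)\<^sup>2) \<ge> 0" by simp
  ultimately have "(LINT x|lborel. (L x)\<^sup>2) = 0" using a by (simp add: mult_le_0_iff)
  then show ?thesis by (rule square_integral_zero[OF L_sq])
qed

section \<open>Square integrable harmonic functions vanish\<close>

lemma gradient_cutoff:
  assumes \<eta>: "test \<eta>"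
  shows "(\<Sum>i\<in>Basis. LINT x|lborel. pd i \<eta> x * (r x * d i x)) + (\<Sum>i\<in>Basis. LINT x|lborel. \<eta> x * (d i x * d i x)) = 0"
proof -
  obtain R where R: "\<And>x. R < norm x \<Longrightarrow> \<eta> x = 0" using test_bound[OF \<eta>] by blast
  obtain t where t: "strict_mono t" and fam: "\<And>f. f \<in> family \<Longrightarrow> aeconv t R f"
    using family_conv[of R] by blast
  \<comment> \<open>\<open>L\<close> vanishes only almost everywhere, but its mollifications vanish
    everywhere, so the mollified \<open>r\<close> is classically harmonic.\<close>
  have L0: "mo n L x = 0" for n x
    using mo_cong_AE[of L "\<lambda>_. 0" n x] L_zero by (simp add: mo_def conv_def)
  let ?M = "\<lambda>n f g x. mo (t n) f x * mo (t n) g x"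
  note lims = L2_limit[OF t _ _ _ _ _ loc2s(2) fam[OF familyI(9)] fam[OF familyI(10)]]
  have l1: "(\<lambda>n. LINT x|lborel. pd i \<eta> x * ?M n r (d i) x) \<longlonglongrightarrow> (LINT x|lborel. pd i \<eta> x * (r x * d i x))"
    and i1: "\<And>n. integrable lborel (\<lambda>x. pd i \<eta> x * ?M n r (d i) x)" if i: "i \<in> Basis" for i
    by (rule lims[OF pd_zero_outside[OF R] test_pd[OF \<eta> i] loc2s(1) fam[OF familyI(1)] fam[OF familyI(4)] i i i]; assumption)+
  have l2: "(\<lambda>n. LINT x|lborel. \<eta> x * ?M n (d i) (d i) x) \<longlonglongrightarrow> (LINT x|lborel. \<eta> x * (d i x * d i x))"
    and i2: "\<And>n. integrable lborel (\<lambda>x. \<eta> x * ?M n (d i) (d i) x)" if i: "i \<in> Basis" for i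
    by (rule lims[OF R \<eta> loc2s(2)[OF i] fam[OF familyI(9)[OF i]] fam[OF familyI(10)[OF i]] i i i]; assumption)+
  have "(\<Sum>i\<in>Basis. LINT x|lborel. pd i \<eta> x * ?M n r (d i) x) + (\<Sum>i\<in>Basis. LINT x|lborel. \<eta> x * ?M n (d i) (d i) x) = 0" for n
  proof -
    define w where "w = mo (t n) r"
    have w: "smooth w" unfolding w_def by (rule r_smooth)
    have pw: "i \<in> Basis \<Longrightarrow> pd i w = mo (t n) (d i)" for i unfolding w_def by (rule mo_r(1))
    have lw: "lap w x = 0" for x unfolding w_def mo_r(3) by (rule L0)
    have te: "test (\<lambda>x. (\<eta> x * w x) * pd i w x)" if "i \<in> Basis" for i
      by (intro test_mult \<eta> w smooth_pd that)
    have pt: "pd i (\<lambda>x. (\<eta> x * w x) * pd i w x) x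
        = (pd i \<eta> x * ?M n r (d i) x + \<eta> x * ?M n (d i) (d i) x) + (\<eta> x * w x) * pd i (pd i w) x" if i: "i \<in> Basis" for i x
      using smooth_pd_mult[OF smooth_mult[OF test_smooth[OF \<eta>] w] smooth_pd[OF w i], of i]
        smooth_pd_mult[OF test_smooth[OF \<eta>] w, of i] pw[OF i] by (simp add: w_def[symmetric] algebra_simps)
    \<comment> \<open>The divergence of \<open>\<eta> w \<nabla>w\<close> integrates to 0, and its
      term with the Laplacian of \<open>w\<close> is absent.\<close>
    have "0 = (\<Sum>i\<in>Basis. LINT x|lborel. pd i (\<lambda>x. (\<eta> x * w x) * pd i w x) x)"
      using te by (simp add: integral_pd_zero)
    also have "\<dots> = (LINT x|lborel. (\<Sum>i\<in>Basis. pd i (\<lambda>x. (\<eta> x * w x) * pd i w x) x))"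
      by (rule Bochner_Integration.integral_sum[symmetric]) (intro test_integrable test_pd te)
    also have "\<dots> = (LINT x|lborel. (\<Sum>i\<in>Basis. pd i \<eta> x * ?M n r (d i) x + \<eta> x * ?M n (d i) (d i) x))"
    proof (intro Bochner_Integration.integral_cong refl)
      fix x
      have "(\<Sum>i\<in>Basis. pd i (\<lambda>x. (\<eta> x * w x) * pd i w x) x)
        = (\<Sum>i\<in>Basis. pd i \<eta> x * ?M n r (d i) x + \<eta> x * ?M n (d i) (d i) x) + (\<eta> x * w x) * lap w x"
        unfolding lap_def sum_distrib_left sum.distrib[symmetric] by (intro sum.cong refl pt)
      then show "(\<Sum>i\<in>Basis. pd i (\<lambda>x. (\<eta> x * w x) * pd i w x) x)
        = (\<Sum>i\<in>Basis. pd i \<eta> x * ?M n r (d i) x + \<eta> x * ?M n (d i) (d i) x)" by (simp add: lw)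
    qed
    also have "\<dots> = (\<Sum>i\<in>Basis. (LINT x|lborel. pd i \<eta> x * ?M n r (d i) x) + (LINT x|lborel. \<eta> x * ?M n (d i) (d i) x))"
      by (subst Bochner_Integration.integral_sum)
         (auto intro!: i1 i2 Bochner_Integration.integrable_add sum.cong Bochner_Integration.integral_add)
    finally show ?thesis by (simp add: sum.distrib)
  qed
  moreover have "(\<lambda>n. (\<Sum>i\<in>Basis. LINT x|lborel. pd i \<eta> x * ?M n r (d i) x) + (\<Sum>i\<in>Basis. LINT x|lborel. \<eta> x * ?M n (d i) (d i) x))
    \<longlonglongrightarrow> (\<Sum>i\<in>Basis. LINT x|lborel. pd i \<eta> x * (r x * d i x)) + (\<Sum>i\<in>Basis. LINT x|lborel. \<eta> x * (d i x * d i x))"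
    by (intro tendsto_add tendsto_sum l1 l2)
  ultimately show ?thesis by (simp add: LIMSEQ_const_iff)
qed

text \<open>For a widening cut-off the mixed terms of \<open>gradient_cutoff\<close> tend to 0
  because \<open>r * d j\<close> is integrable; what remains is the full gradient energy.\<close>

lemma d_zero: assumes i: "i \<in> Basis" shows "AE x in lborel. d i x = 0"
proof -
  obtain \<eta> :: "'a \<Rightarrow> real" where \<eta>: "test \<eta>" "\<And>x. norm x < 1 \<Longrightarrow> \<eta> x = 1"
    by (rule cutoff_exists) blast
  note sm = test_smooth[OF \<eta>(1)]
  have p0: "pd j \<eta> x = 0" if "norm x < 1" for j x
    using pd_cong_ball[of \<eta> "\<lambda>_. 1" x j] \<eta>(2) that by simp
  define c where "c n = 1 / (real n + 1)" for n
  define e where "e n x = \<eta> (c n *\<^sub>R x)" for n x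
  have c0: "c n \<noteq> 0" for n by (simp add: c_def)
  have te: "test (e n)" for n unfolding e_def[abs_def] by (rule scale_test[OF \<eta>(1) c0])
  have P: "pd j (e n) x = c n ^ 1 * pd j \<eta> (c n *\<^sub>R x)" for n j x
    unfolding e_def[abs_def] using sm by (simp add: scale_pd)
  have l1: "(\<lambda>n. LINT x|lborel. pd j (e n) x * (r x * d j x)) \<longlonglongrightarrow> 0" if j: "j \<in> Basis" for j
    unfolding P c_def
    by (rule scaled_integral_limit[OF integrable_mult_squares[OF measurables(1) measurables(2)[OF j] r_sq d_sq[OF j]] test_pd[OF \<eta>(1) j] p0])
  have l2: "(\<lambda>n. LINT x|lborel. e n x * (d j x * d j x)) \<longlonglongrightarrow> (LINT x|lborel. d j x * d j x)" if j: "j \<in> Basis" for j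
    unfolding e_def c_def
    by (rule scaled_cutoff_limit[OF integrable_mult_squares[OF measurables(2)[OF j] measurables(2)[OF j] d_sq[OF j] d_sq[OF j]] \<eta>])
  have "(\<lambda>n. (\<Sum>j\<in>Basis. LINT x|lborel. pd j (e n) x * (r x * d j x)) + (\<Sum>j\<in>Basis. LINT x|lborel. e n x * (d j x * d j x)))
     \<longlonglongrightarrow> (\<Sum>j\<in>(Basis::'a set). 0) + (\<Sum>j\<in>Basis. LINT x|lborel. d j x * d j x)"
    by (intro tendsto_add tendsto_sum l1 l2)
  then have "(\<Sum>j\<in>Basis. LINT x|lborel. d j x * d j x) = 0"
    unfolding gradient_cutoff[OF te] sum.neutral_const add_0_left LIMSEQ_const_iff by (rule sym)
  moreover have "0 \<le> (LINT x|lborel. d j x * d j x)" for j by (intro integral_nonneg_AE) simp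
  ultimately have "\<forall>j\<in>Basis. (LINT x|lborel. d j x * d j x) = 0"
    by (simp only: sum_nonneg_eq_0_iff[OF finite_Basis])
  then have "(LINT x|lborel. (d i x)\<^sup>2) = 0"
    unfolding power2_eq_square using i by blast
  then show ?thesis by (rule square_integral_zero[OF d_sq[OF i]])
qed

text \<open>Every mollification of \<open>r\<close> has zero gradient and is a constant
  \<open>c\<close>. Jensen's inequality bounds the square of \<open>c\<close> by the mollification
  of the square of \<open>r\<close> at any point, and this tends to 0 at infinity.\<close>

lemma r_zero: "AE x in lborel. r x = 0"
proof (rule mo_zero_AE[OF loc1s(1)])
  fix n x
  let ?w = "mo n r"
  have "(?w has_derivative (\<lambda>h. 0)) (at y)" for y
  proof -
    have "pd i ?w y = 0" if "i \<in> Basis" for i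
      using mo_cong_AE[OF d_zero[OF that], of n y] measurables(2)[OF that] mo_r(1)[OF that, of n]
      by (simp add: mo_def conv_def)
    then show ?thesis using smooth_has_derivative[OF r_smooth[of n], of y] by simp
  qed
  then obtain c where c: "\<And>y. ?w y = c"
    using has_derivative_zero_constant[of UNIV ?w] by auto
  obtain b :: 'a where b: "b \<in> Basis" using nonempty_Basis by blast
  have sq: "(\<lambda>x. \<bar>r x\<bar> powr 2) = (\<lambda>x. (r x)\<^sup>2)" by auto
  have "\<bar>c\<bar> powr 2 \<le> mo n (\<lambda>x. (r x)\<^sup>2) y" for y
    using mo_jensen[OF loc2s(1), of n y] by (simp add: c)
  then have "\<bar>c\<bar> powr 2 \<le> 0"
    by (intro LIMSEQ_le_const[OF moll_integral_at_infinity[OF r_sq b, of n]]) auto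
  then show "mo n r x = 0" by (simp add: c)
qed

end

section \<open>Reduction to real-valued Borel representatives\<close>

text \<open>Fubini's theorem for \<open>lborel \<Otimes>\<^sub>M lborel\<close> needs Borel functions, while the Sobolev classes contain Lebesgue-measurable ones.\<close>

definition borel_version :: "('a::euclidean_space \<Rightarrow> real) \<Rightarrow> 'a \<Rightarrow> real" where
  "borel_version f = (SOME f'. f' \<in> borel_measurable borel \<and> (AE x in lborel. f x = f' x))"

lemma borel_version:
  assumes "f \<in> borel_measurable lebesgue"
  shows "borel_version f \<in> borel_measurable borel" "AE x in lborel. f x = borel_version f x"
proof -
  have "\<exists>f'. f' \<in> borel_measurable borel \<and> (AE x in lborel. f x = f' x)"
    using completion_ex_borel_measurable_real[OF assms] by auto
  from someI_ex[OF this] show "borel_version f \<in> borel_measurable borel" "AE x in lborel. f x = borel_version f x"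
    unfolding borel_version_def by blast+
qed

text \<open>\<open>lebesgue\<close> completes \<open>lborel\<close>, so an almost everywhere equal
  Borel function has the same integral. All later transfers between the two measures of signed
  integrals go through this.\<close>

lemma lebesgue_to_lborel:
  fixes h h' :: "'a::euclidean_space \<Rightarrow> real"
  assumes "h \<in> borel_measurable lebesgue" "h' \<in> borel_measurable borel" "AE x in lborel. h x = h' x"
  shows "(LINT x|lebesgue. h x) = (LINT x|lborel. h' x)" "integrable lebesgue h \<longleftrightarrow> integrable lborel h'"
proof -
  have m: "h' \<in> borel_measurable lebesgue" using assms(2) by (intro measurable_completion) simp
  have ae: "AE x in lebesgue. h x = h' x" by (rule AE_completion[OF assms(3)])
  show "(LINT x|lebesgue. h x) = (LINT x|lborel. h' x)"
    using integral_cong_AE[OF assms(1) m ae] assms(2) by (simp add: integral_completion)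
  show "integrable lebesgue h \<longleftrightarrow> integrable lborel h'"
    using integrable_cong_AE[OF assms(1) m ae] assms(2) by (simp add: integrable_completion)
qed

lemma Lp_loc_locp:
  fixes f :: "'a::euclidean_space \<Rightarrow> real"
  assumes "f \<in> Lp_loc p" shows "locp p (borel_version f)"
  unfolding locp_def loc1_def
proof (intro conjI allI)
  have m: "f \<in> borel_measurable lebesgue" using assms by (simp add: Lp_loc_def)
  note [measurable] = borel_version(1)[OF m]
  show "borel_version f \<in> borel_measurable borel" by measurable
  show "(\<lambda>x. \<bar>borel_version f x\<bar> powr p) \<in> borel_measurable borel" by measurable
  fix R
  have i: "integrable lebesgue (\<lambda>x. indicator (cball 0 R) x * \<bar>f x\<bar> powr p)"
    using assms by (simp add: Lp_loc_def set_integrable_def)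
  have [measurable]: "cball (0::'a) R \<in> sets borel" by simp
  have b: "(\<lambda>x. indicator (cball 0 R) x * \<bar>borel_version f x\<bar> powr p) \<in> borel_measurable borel" by measurable
  have "AE x in lborel. indicator (cball 0 R) x * \<bar>f x\<bar> powr p = indicator (cball 0 R) x * \<bar>borel_version f x\<bar> powr p"
    using borel_version(2)[OF m] by eventually_elim simp
  from lebesgue_to_lborel(2)[OF borel_measurable_integrable[OF i] b this]
  show "integrable lborel (\<lambda>x. indicator (cball 0 R) x * \<bar>borel_version f x\<bar> powr p)" by (rule iffD1) (rule i)
qed

lemma Lp2_square_integrable:
  fixes f :: "'a::euclidean_space \<Rightarrow> real"
  assumes "f \<in> Lp 2" shows "integrable lborel (\<lambda>x. (borel_version f x)\<^sup>2)"
proof -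
  have m: "f \<in> borel_measurable lebesgue" using assms by (simp add: Lp_def)
  note [measurable] = borel_version(1)[OF m]
  have i: "integrable lebesgue (\<lambda>x. (f x)\<^sup>2)" using assms by (simp add: Lp_def)
  have "AE x in lborel. (f x)\<^sup>2 = (borel_version f x)\<^sup>2"
    using borel_version(2)[OF m] by eventually_elim simp
  from lebesgue_to_lborel(2)[OF borel_measurable_integrable[OF i] _ this]
  show ?thesis by (rule iffD1) (simp_all add: i)
qed

lemma smooth_measurable_lebesgue: "smooth f \<Longrightarrow> f \<in> borel_measurable lebesgue"
  by (intro measurable_completion) (simp add: smooth_measurable)

lemma partial_deriv_pd: "partial_deriv i f x = pd i f x" by (simp add: pd_def)

lemma has_weak_deriv_wd:
  fixes f g :: "'a::euclidean_space \<Rightarrow> real"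
  assumes w: "has_weak_deriv i f g" and i: "i \<in> Basis"
  shows "wd i (borel_version f) (borel_version g)"
  unfolding wd_def
proof (intro conjI allI impI)
  have l: "f \<in> Lp_loc 1" "g \<in> Lp_loc 1" using w by (auto simp: has_weak_deriv_def)
  then have m: "f \<in> borel_measurable lebesgue" "g \<in> borel_measurable lebesgue" by (auto simp: Lp_loc_def)
  show "loc1 (borel_version f)" "loc1 (borel_version g)" using locp_loc1[OF Lp_loc_locp] l by auto
  fix \<phi> :: "'a \<Rightarrow> real" assume \<phi>: "test \<phi>"
  have t: "(LINT x|lebesgue. \<psi> x * h x) = (LINT x|lborel. \<psi> x * borel_version h x)"
    if "test \<psi>" "h \<in> borel_measurable lebesgue" for \<psi> h :: "'a \<Rightarrow> real"
  proof (rule lebesgue_to_lborel(1))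
    show "(\<lambda>x. \<psi> x * h x) \<in> borel_measurable lebesgue"
      using smooth_measurable_lebesgue[OF test_smooth[OF that(1)]] that(2) by (intro borel_measurable_times)
    show "(\<lambda>x. \<psi> x * borel_version h x) \<in> borel_measurable borel"
      using smooth_measurable[OF test_smooth[OF that(1)]] borel_version(1)[OF that(2)] by (intro borel_measurable_times)
    show "AE x in lborel. \<psi> x * h x = \<psi> x * borel_version h x"
      using borel_version(2)[OF that(2)] by eventually_elim simp
  qed
  have "(LINT x|lebesgue. pd i \<phi> x * f x) = - (LINT x|lebesgue. \<phi> x * g x)"
    using w \<phi> by (simp add: has_weak_deriv_def test_fun_iff partial_deriv_pd)
  then show "(LINT x|lborel. pd i \<phi> x * borel_version f x) = - (LINT x|lborel. \<phi> x * borel_version g x)"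
    using t[OF test_pd[OF \<phi> i] m(1)] t[OF \<phi> m(2)] by simp
qed

text \<open>Required because \<open>weak_deriv\<close> is a choice: the fundamental lemma, applied
  to the difference of Borel versions, makes any two choices agree almost everywhere. The functions
  differentiated need only agree almost everywhere as well.\<close>

lemma weak_deriv_unique_real:
  fixes f g :: "'a::euclidean_space \<Rightarrow> real"
  assumes w: "has_weak_deriv i f g" "has_weak_deriv i f' g'" and i: "i \<in> Basis" and ae: "AE x in lborel. f x = f' x"
  shows "AE x in lborel. g x = g' x"
proof -
  have m: "f \<in> borel_measurable lebesgue" "g \<in> borel_measurable lebesgue" "f' \<in> borel_measurable lebesgue" "g' \<in> borel_measurable lebesgue"
    using w by (auto simp: has_weak_deriv_def Lp_loc_def)
  note W = has_weak_deriv_wd[OF w(1) i] has_weak_deriv_wd[OF w(2) i]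
  have l: "loc1 (borel_version f)" "loc1 (borel_version g)" "loc1 (borel_version g')" using W by (auto simp: wd_def)
  have ff: "AE x in lborel. borel_version f x = borel_version f' x"
    using ae borel_version(2)[OF m(1)] borel_version(2)[OF m(3)] by eventually_elim simp
  have "AE x in lborel. borel_version g x + (-1) * borel_version g' x = 0"
  proof (rule loc1_AE_zero[OF loc1_add[OF l(2) loc1_cmult[OF l(3)]]])
    fix \<phi> :: "'a \<Rightarrow> real" assume \<phi>: "test \<phi>"
    have "(LINT x|lborel. pd i \<phi> x * borel_version f x) = (LINT x|lborel. pd i \<phi> x * borel_version f' x)"
      using smooth_measurable[OF test_smooth[OF test_pd[OF \<phi> i]]] borel_version(1)[OF m(1)] borel_version(1)[OF m(3)] ff
      by (intro integral_cong_AE borel_measurable_times) (auto elim: eventually_mono)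
    then have "(LINT x|lborel. \<phi> x * borel_version g x) = (LINT x|lborel. \<phi> x * borel_version g' x)"
      using W \<phi> by (simp add: wd_def)
    then show "(LINT x|lborel. \<phi> x * (borel_version g x + (-1) * borel_version g' x)) = 0"
      using test_integrable_loc1[OF \<phi> l(2)] test_integrable_loc1[OF \<phi> l(3)] by (simp add: right_diff_distrib)
  qed
  then show ?thesis
    using borel_version(2)[OF m(2)] borel_version(2)[OF m(4)] by eventually_elim simp
qed

section \<open>Bounded linear images and complex-valued weak derivatives\<close>

lemma bounded_linear_measurable: "bounded_linear T \<Longrightarrow> f \<in> borel_measurable M \<Longrightarrow> (\<lambda>x. T (f x)) \<in> borel_measurable M"
  by (rule measurable_compose[of f M borel T borel])
     (auto intro!: borel_measurable_continuous_onI linear_continuous_on)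

lemma bounded_linear_integrable_powr:
  fixes T :: "'b::{banach,second_countable_topology} \<Rightarrow> 'c::{banach,second_countable_topology}"
  assumes T: "bounded_linear T" and p: "p > 0" and m: "f \<in> borel_measurable M"
    and A: "A \<in> sets M" and i: "integrable M (\<lambda>x. indicator A x *\<^sub>R norm (f x) powr p)"
  shows "integrable M (\<lambda>x. indicator A x *\<^sub>R norm (T (f x)) powr p)"
proof -
  obtain K where K: "\<And>x. norm (T x) \<le> norm x * K" "K > 0" using bounded_linear.pos_bounded[OF T] by blast
  note [measurable] = m A bounded_linear_measurable[OF T m]
  show ?thesis
  proof (rule Bochner_Integration.integrable_bound)
    show "integrable M (\<lambda>x. K powr p * (indicator A x *\<^sub>R norm (f x) powr p))" by (intro integrable_mult_right i)
    have "norm (T (f x)) powr p \<le> K powr p * norm (f x) powr p" for x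
      using K(2) powr_mono2[OF _ _ K(1)[of "f x"], of p] p by (simp add: powr_mult mult.commute)
    then show "AE x in M. norm (indicat_real A x *\<^sub>R norm (T (f x)) powr p) \<le> norm (K powr p * (indicat_real A x *\<^sub>R norm (f x) powr p))"
      by (intro always_eventually) (auto simp: indicator_def)
  qed measurable
qed

lemma Lp_linear:
  assumes T: "bounded_linear T" and f: "f \<in> Lp p" and p: "p > 0"
  shows "(\<lambda>x. T (f x)) \<in> Lp p"
  using bounded_linear_integrable_powr[OF T p, of f lebesgue UNIV] bounded_linear_measurable[OF T, of f] f
  by (simp add: Lp_def)

lemma compact_sets_lebesgue: "compact K \<Longrightarrow> K \<in> sets lebesgue"
  by (rule fmeasurableD[OF lmeasurable_compact])

lemma Lp_loc_linear:
  assumes T: "bounded_linear T" and f: "f \<in> Lp_loc p" and p: "p > 0"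
  shows "(\<lambda>x. T (f x)) \<in> Lp_loc p"
proof -
  have "set_integrable lebesgue K (\<lambda>x. norm (T (f x)) powr p)" if "compact K" for K
    using bounded_linear_integrable_powr[OF T p, of f lebesgue K] f that compact_sets_lebesgue[OF that]
    by (auto simp: Lp_loc_def set_integrable_def)
  then show ?thesis using f bounded_linear_measurable[OF T, of f] by (simp add: Lp_loc_def)
qed

lemma test_integrable_Lp_loc:
  fixes f :: "'a::euclidean_space \<Rightarrow> 'b::{banach,second_countable_topology}"
  assumes \<phi>: "test \<phi>" and f: "f \<in> Lp_loc 1"
  shows "integrable lebesgue (\<lambda>x. \<phi> x *\<^sub>R f x)"
proof -
  obtain R where R: "\<And>x. R < norm x \<Longrightarrow> \<phi> x = 0" using test_bound[OF \<phi>] by blast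
  obtain C where C: "C > 0" "\<And>x. \<bar>\<phi> x\<bar> \<le> C" using test_bounded[OF \<phi>] by blast
  have [measurable]: "f \<in> borel_measurable lebesgue" using f by (simp add: Lp_loc_def)
  have [measurable]: "\<phi> \<in> borel_measurable lebesgue" by (rule smooth_measurable_lebesgue[OF test_smooth[OF \<phi>]])
  show ?thesis
  proof (rule Bochner_Integration.integrable_bound)
    show "integrable lebesgue (\<lambda>x. C * (indicator (cball 0 R) x * norm (f x)))"
      using f by (intro integrable_mult_right) (auto simp: Lp_loc_def set_integrable_def)
    show "AE x in lebesgue. norm (\<phi> x *\<^sub>R f x) \<le> norm (C * (indicat_real (cball 0 R) x * norm (f x)))"
      using C R by (intro always_eventually) (auto simp: indicator_def intro!: mult_right_mono)
  qed measurable
qed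

text \<open>Bounded linear maps commute with the Bochner integral of integrable functions. The
  instances needed are real and imaginary part, the embedding of the reals, and their
  composition.\<close>

lemma has_weak_deriv_linear:
  fixes T :: "'b::{banach,second_countable_topology} \<Rightarrow> 'c::{banach,second_countable_topology}"
  assumes T: "bounded_linear T" and w: "has_weak_deriv i f g" and i: "i \<in> Basis"
  shows "has_weak_deriv i (\<lambda>x. T (f x)) (\<lambda>x. T (g x))"
  unfolding has_weak_deriv_def
proof (intro conjI ballI)
  have l: "f \<in> Lp_loc 1" "g \<in> Lp_loc 1" using w by (auto simp: has_weak_deriv_def)
  then show "(\<lambda>x. T (f x)) \<in> Lp_loc 1" "(\<lambda>x. T (g x)) \<in> Lp_loc 1" by (auto intro: Lp_loc_linear[OF T])
  fix \<phi> :: "'a \<Rightarrow> real" assume "\<phi> \<in> test_fun"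
  then have \<phi>: "test \<phi>" by (simp add: test_fun_iff)
  have s: "(LINT x|lebesgue. \<psi> x *\<^sub>R T (h x)) = T (LINT x|lebesgue. \<psi> x *\<^sub>R h x)" if "test \<psi>" "h \<in> Lp_loc 1" for \<psi> h
    using integral_bounded_linear[OF T test_integrable_Lp_loc[OF that]] linear_scale[OF bounded_linear.linear[OF T]] by simp
  have "(LINT x|lebesgue. pd i \<phi> x *\<^sub>R f x) = - (LINT x|lebesgue. \<phi> x *\<^sub>R g x)"
    using w \<phi> by (simp add: has_weak_deriv_def test_fun_iff partial_deriv_pd)
  then show "(LINT x|lebesgue. partial_deriv i \<phi> x *\<^sub>R T (f x)) = - (LINT x|lebesgue. \<phi> x *\<^sub>R T (g x))"
    unfolding partial_deriv_pd s[OF test_pd[OF \<phi> i] l(1)] s[OF \<phi> l(2)]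
    using linear_neg[OF bounded_linear.linear[OF T]] by simp
qed

lemma weak_deriv_unique:
  fixes f g :: "'a::euclidean_space \<Rightarrow> complex"
  assumes w: "has_weak_deriv i f g" "has_weak_deriv i f' g'" and i: "i \<in> Basis" and ae: "AE x in lborel. f x = f' x"
  shows "AE x in lborel. g x = g' x"
proof -
  have "AE x in lborel. P (g x) = P (g' x)" if P: "bounded_linear P" for P :: "complex \<Rightarrow> real"
    by (rule weak_deriv_unique_real[OF has_weak_deriv_linear[OF P w(1) i] has_weak_deriv_linear[OF P w(2) i] i])
       (use ae in \<open>auto elim: eventually_mono\<close>)
  from this[OF bounded_linear_Re] this[OF bounded_linear_Im]
  show ?thesis by eventually_elim (simp add: complex_eq_iff)
qed

lemma has_weak_deriv_cong:
  assumes w: "has_weak_deriv i f g" and f': "f' \<in> Lp_loc 1" and ae: "AE x in lborel. f x = f' x" and i: "i \<in> Basis"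
  shows "has_weak_deriv i f' g"
  unfolding has_weak_deriv_def
proof (intro conjI ballI)
  show "f' \<in> Lp_loc 1" "g \<in> Lp_loc 1" using f' w by (auto simp: has_weak_deriv_def)
  have m: "f \<in> borel_measurable lebesgue" "f' \<in> borel_measurable lebesgue"
    using f' w by (auto simp: has_weak_deriv_def Lp_loc_def)
  fix \<phi> :: "'a \<Rightarrow> real" assume p: "\<phi> \<in> test_fun"
  then have \<phi>: "test \<phi>" by (simp add: test_fun_iff)
  have pm: "pd i \<phi> \<in> borel_measurable lebesgue"
    by (rule smooth_measurable_lebesgue[OF test_smooth[OF test_pd[OF \<phi> i]]])
  have "(LINT x|lebesgue. pd i \<phi> x *\<^sub>R f' x) = (LINT x|lebesgue. pd i \<phi> x *\<^sub>R f x)"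
    using AE_completion[OF ae] by (intro integral_cong_AE borel_measurable_scaleR pm m) (auto elim: eventually_mono)
  then show "(LINT x|lebesgue. partial_deriv i \<phi> x *\<^sub>R f' x) = - (LINT x|lebesgue. \<phi> x *\<^sub>R g x)"
    using w p by (simp add: has_weak_deriv_def partial_deriv_pd)
qed

lemma has_weak_deriv_weak_deriv: "has_weak_deriv i f g \<Longrightarrow> has_weak_deriv i f (weak_deriv i f)"
  unfolding weak_deriv_def by (rule someI[of "has_weak_deriv i f"])

lemma Lp_cong:
  assumes "f \<in> Lp p" "g \<in> borel_measurable lebesgue" "AE x in lborel. f x = g x"
  shows "g \<in> Lp p"
proof -
  have m: "f \<in> borel_measurable lebesgue" using assms by (simp add: Lp_def)
  have "integrable lebesgue (\<lambda>x. norm (f x) powr p) \<longleftrightarrow> integrable lebesgue (\<lambda>x. norm (g x) powr p)"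
  proof (rule integrable_cong_AE)
    show "AE x in lebesgue. norm (f x) powr p = norm (g x) powr p"
      using AE_completion[OF assms(3)] by eventually_elim simp
  qed (use m assms(2) in measurable)
  then show ?thesis using assms by (simp add: Lp_def)
qed

lemma Lp_loc_cong:
  assumes "f \<in> Lp_loc p" "g \<in> borel_measurable lebesgue" "AE x in lborel. f x = g x"
  shows "g \<in> Lp_loc p"
proof -
  have m[measurable]: "f \<in> borel_measurable lebesgue" "g \<in> borel_measurable lebesgue" using assms by (simp_all add: Lp_loc_def)
  have "set_integrable lebesgue K (\<lambda>x. norm (g x) powr p)" if K: "compact K" for K
  proof -
    have [measurable]: "K \<in> sets lebesgue" by (rule compact_sets_lebesgue[OF K])
    have "integrable lebesgue (\<lambda>x. indicator K x *\<^sub>R norm (f x) powr p) \<longleftrightarrow> integrable lebesgue (\<lambda>x. indicator K x *\<^sub>R norm (g x) powr p)"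
    proof (rule integrable_cong_AE)
      show "AE x in lebesgue. indicat_real K x *\<^sub>R norm (f x) powr p = indicat_real K x *\<^sub>R norm (g x) powr p"
        using AE_completion[OF assms(3)] by eventually_elim simp
    qed measurable
    then show ?thesis using assms(1) K by (auto simp: Lp_loc_def set_integrable_def)
  qed
  then show ?thesis using m by (simp add: Lp_loc_def)
qed

text \<open>\<open>weak_laplacian\<close> chooses twice. The inner choice may differ from
  \<open>g i\<close> on a null set, which \<open>has_weak_deriv_cong\<close> absorbs before
  uniqueness is applied to the outer one.\<close>

lemma weak_laplacian_AE:
  fixes f :: "'a::euclidean_space \<Rightarrow> complex"
  assumes "\<And>i. i \<in> Basis \<Longrightarrow> has_weak_deriv i f (g i)" "\<And>i. i \<in> Basis \<Longrightarrow> has_weak_deriv i (g i) (h i)"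
  shows "AE x in lborel. weak_laplacian f x = (\<Sum>i\<in>Basis. h i x)"
proof -
  have "AE x in lborel. weak_deriv i (weak_deriv i f) x = h i x" if i: "i \<in> Basis" for i
  proof -
    have 1: "has_weak_deriv i f (weak_deriv i f)" by (rule has_weak_deriv_weak_deriv[OF assms(1)[OF i]])
    have ae: "AE x in lborel. g i x = weak_deriv i f x"
      by (rule weak_deriv_unique[OF assms(1)[OF i] 1 i]) simp
    have 2: "has_weak_deriv i (weak_deriv i f) (h i)"
      by (rule has_weak_deriv_cong[OF assms(2)[OF i] _ ae i]) (use 1 in \<open>simp add: has_weak_deriv_def\<close>)
    show ?thesis by (rule weak_deriv_unique[OF has_weak_deriv_weak_deriv[OF 2] 2 i]) simp
  qed
  then have "AE x in lborel. \<forall>i\<in>Basis. weak_deriv i (weak_deriv i f) x = h i x"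
    by (subst AE_finite_all) auto
  then show ?thesis by eventually_elim (simp add: weak_laplacian_def)
qed

text \<open>Membership in \<open>H2\<close> provides some derivatives in the right spaces; by
  uniqueness the representatives selected by \<open>weak_deriv\<close> inherit these
  properties.\<close>

lemma H2_weak_derivs:
  fixes u :: "'a::euclidean_space \<Rightarrow> complex"
  assumes u: "u \<in> H2" and i: "i \<in> Basis"
  shows "has_weak_deriv i u (weak_deriv i u)" "weak_deriv i u \<in> Lp 2"
    "j \<in> Basis \<Longrightarrow> has_weak_deriv j (weak_deriv i u) (weak_deriv j (weak_deriv i u))"
    "j \<in> Basis \<Longrightarrow> weak_deriv j (weak_deriv i u) \<in> Lp 2"
proof -
  obtain G where G: "G \<in> H1" "has_weak_deriv i u G" using u i by (auto simp: H2_def)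
  show 1: "has_weak_deriv i u (weak_deriv i u)" by (rule has_weak_deriv_weak_deriv[OF G(2)])
  then have l: "weak_deriv i u \<in> Lp_loc 1" by (simp add: has_weak_deriv_def)
  then have m: "weak_deriv i u \<in> borel_measurable lebesgue" by (simp add: Lp_loc_def)
  have ae: "AE x in lborel. G x = weak_deriv i u x" by (rule weak_deriv_unique[OF G(2) 1 i]) simp
  show "weak_deriv i u \<in> Lp 2" by (rule Lp_cong[OF _ m ae]) (use G(1) in \<open>simp add: H1_def\<close>)
  assume j: "j \<in> Basis"
  obtain k where k: "k \<in> Lp 2" "has_weak_deriv j G k" using G(1) j by (auto simp: H1_def)
  have 2: "has_weak_deriv j (weak_deriv i u) k" by (rule has_weak_deriv_cong[OF k(2) l ae j])
  show 3: "has_weak_deriv j (weak_deriv i u) (weak_deriv j (weak_deriv i u))" by (rule has_weak_deriv_weak_deriv[OF 2])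
  show "weak_deriv j (weak_deriv i u) \<in> Lp 2"
  proof (rule Lp_cong[OF k(1)])
    show "weak_deriv j (weak_deriv i u) \<in> borel_measurable lebesgue"
      using 3 by (simp add: has_weak_deriv_def Lp_loc_def)
    show "AE x in lborel. k x = weak_deriv j (weak_deriv i u) x"
      by (rule weak_deriv_unique[OF 2 3 j]) simp
  qed
qed

section \<open>Test functions in the eigenvalue equation and passage to components\<close>

lemma H2I:
  assumes "u \<in> Lp 2" "\<And>i. i \<in> Basis \<Longrightarrow> has_weak_deriv i u (g i)" "\<And>i. i \<in> Basis \<Longrightarrow> g i \<in> Lp 2"
    "\<And>i j. i \<in> Basis \<Longrightarrow> j \<in> Basis \<Longrightarrow> has_weak_deriv j (g i) (h i j)"
    "\<And>i j. i \<in> Basis \<Longrightarrow> j \<in> Basis \<Longrightarrow> h i j \<in> Lp 2"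
  shows "u \<in> H2"
  using assms unfolding H2_def H1_def by blast

lemma test_Lp2: assumes "test \<phi>" shows "\<phi> \<in> Lp 2"
proof -
  have m: "\<phi> \<in> borel_measurable borel" by (rule smooth_measurable[OF test_smooth[OF assms]])
  have "integrable lborel (\<lambda>x. (\<phi> x)\<^sup>2)"
    using test_integrable[OF test_mult[OF assms test_smooth[OF assms]]] by (simp add: power2_eq_square)
  then have "integrable lebesgue (\<lambda>x. (\<phi> x)\<^sup>2)" using m by (subst integrable_completion) auto
  then show ?thesis using smooth_measurable_lebesgue[OF test_smooth[OF assms]] by (simp add: Lp_def)
qed

lemma smooth_has_weak_deriv:
  assumes f: "smooth f" and i: "i \<in> Basis" shows "has_weak_deriv i f (pd i f)"
  unfolding has_weak_deriv_def
proof (intro conjI ballI)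
  have l: "h \<in> Lp_loc 1" if h: "smooth h" for h :: "'a \<Rightarrow> real"
  proof -
    have m: "h \<in> borel_measurable borel" by (rule smooth_measurable[OF h])
    have "set_integrable lebesgue K (\<lambda>x. norm (h x) powr 1)" if K: "compact K" for K
    proof -
      have [measurable]: "K \<in> sets borel" using K by (simp add: borel_compact)
      have "integrable lborel (\<lambda>x. indicator K x *\<^sub>R \<bar>h x\<bar>)"
        by (intro borel_integrable_compact K continuous_on_rabs smooth_continuous h)
      then have "integrable lebesgue (\<lambda>x. indicator K x *\<^sub>R \<bar>h x\<bar>)"
        using m by (subst integrable_completion) auto
      then show ?thesis by (simp add: set_integrable_def)
    qed
    then show ?thesis using smooth_measurable_lebesgue[OF h] by (simp add: Lp_loc_def)
  qed
  show "f \<in> Lp_loc 1" "pd i f \<in> Lp_loc 1" using f i by (auto intro!: l)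
  fix \<phi> :: "'a \<Rightarrow> real" assume "\<phi> \<in> test_fun"
  then have \<phi>: "test \<phi>" by (simp add: test_fun_iff)
  have t: "(LINT x|lebesgue. a x * b x) = (LINT x|lborel. a x * b x)" if "smooth a" "smooth b" for a b :: "'a \<Rightarrow> real"
    using smooth_measurable[OF smooth_mult[OF that]] by (simp add: integral_completion)
  show "(LINT x|lebesgue. partial_deriv i \<phi> x *\<^sub>R f x) = - (LINT x|lebesgue. \<phi> x *\<^sub>R pd i f x)"
    using smooth_wd[OF f i] \<phi> f i by (simp add: partial_deriv_pd wd_def t test_smooth test_pd smooth_pd)
qed

lemma complex_integrable_parts:
  fixes f :: "'a \<Rightarrow> complex"
  assumes "integrable M (\<lambda>x. Re (f x))" "integrable M (\<lambda>x. Im (f x))"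
  shows "integrable M f"
proof -
  have "integrable M (\<lambda>x. complex_of_real (Re (f x)) + \<i> * complex_of_real (Im (f x)))"
    using assms by (intro Bochner_Integration.integrable_add integrable_mult_right integrable_of_real)
  then show ?thesis by (simp add: complex_eq[symmetric])
qed

lemma Lp_measurable:
  "f \<in> Lp p \<Longrightarrow> f \<in> borel_measurable lebesgue" "f \<in> Lp_loc p \<Longrightarrow> f \<in> borel_measurable lebesgue"
  by (auto simp: Lp_def Lp_loc_def)

lemma test_in_H2:
  fixes \<phi> :: "'a::euclidean_space \<Rightarrow> real"
  assumes \<phi>: "test \<phi>"
  shows "(\<lambda>x. complex_of_real (\<phi> x)) \<in> H2"
    "AE x in lborel. weak_laplacian (\<lambda>x. complex_of_real (\<phi> x)) x = complex_of_real (lap \<phi> x)"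
    "essentially_compact_support (\<lambda>x. complex_of_real (\<phi> x))"
proof -
  let ?T = "complex_of_real"
  have T: "bounded_linear ?T" by (rule bounded_linear_of_real)
  have w1: "has_weak_deriv i (\<lambda>x. ?T (\<phi> x)) (\<lambda>x. ?T (pd i \<phi> x))" if "i \<in> Basis" for i
    by (intro has_weak_deriv_linear[OF T] smooth_has_weak_deriv test_smooth[OF \<phi>] that)
  have w2: "has_weak_deriv j (\<lambda>x. ?T (pd i \<phi> x)) (\<lambda>x. ?T (pd j (pd i \<phi>) x))" if "i \<in> Basis" "j \<in> Basis" for i j
    by (intro has_weak_deriv_linear[OF T] smooth_has_weak_deriv test_smooth test_pd \<phi> that)
  show "(\<lambda>x. ?T (\<phi> x)) \<in> H2"
  proof (rule H2I[OF _ w1 _ w2])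
    show "(\<lambda>x. ?T (\<phi> x)) \<in> Lp 2" by (intro Lp_linear[OF T] test_Lp2 \<phi>) simp
    show "(\<lambda>x. ?T (pd i \<phi> x)) \<in> Lp 2" if "i \<in> Basis" for i
      by (intro Lp_linear[OF T] test_Lp2 test_pd \<phi> that) simp
    show "(\<lambda>x. ?T (pd j (pd i \<phi>) x)) \<in> Lp 2" if "i \<in> Basis" "j \<in> Basis" for i j
      by (intro Lp_linear[OF T] test_Lp2 test_pd \<phi> that) simp
  qed
  have "AE x in lborel. weak_laplacian (\<lambda>x. ?T (\<phi> x)) x = (\<Sum>i\<in>Basis. ?T (pd i (pd i \<phi>) x))"
    by (rule weak_laplacian_AE[OF w1 w2])
  then show "AE x in lborel. weak_laplacian (\<lambda>x. ?T (\<phi> x)) x = ?T (lap \<phi> x)" by (simp add: lap_def)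
  obtain R where "\<And>x. R < norm x \<Longrightarrow> \<phi> x = 0" using test_bound[OF \<phi>] by blast
  then have "x \<notin> cball 0 R \<longrightarrow> ?T (\<phi> x) = 0" for x by simp
  then show "essentially_compact_support (\<lambda>x. ?T (\<phi> x))"
    unfolding essentially_compact_support_def by (intro exI[of _ "cball 0 R"] conjI compact_cball always_eventually allI)
qed

text \<open>The real and the imaginary part of \<open>u\<close> are treated one at a time, through
  Borel versions of the part and of its derivatives, which form an instance of the locale
  \<open>virial\<close>.\<close>

lemma eigenfunction_component_zero:
  fixes V :: "'a::euclidean_space \<Rightarrow> real" and P :: "complex \<Rightarrow> real"
  assumes D: "real DIM('a) = D" "D \<ge> 5"
    and a: "0 \<le> a" "a < 1"
    and hardy: "\<And>\<psi> :: 'a \<Rightarrow> complex. \<psi> \<in> H2 \<Longrightarrow>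
           ennreal (1/4) * (\<integral>\<^sup>+x. ennreal (max (x \<bullet> weak_grad V x) 0 * (norm (\<psi> x))\<^sup>2) \<partial>lebesgue)
             \<le> ennreal a * (\<integral>\<^sup>+x. ennreal ((norm (weak_laplacian \<psi> x))\<^sup>2) \<partial>lebesgue)"
    and V: "V \<in> W1_loc (D / 4)"
    and eig: "eigenfunction V z u"
    and P: "P = Re \<or> P = Im"
  shows "AE x in lborel. P (u x) = 0"
proof -
  note bv = borel_version
  have D4: "D / 4 > 0" using D by simp
  have VL: "V \<in> Lp_loc (D / 4)" using V by (simp add: W1_loc_def)
  have Vm: "V \<in> borel_measurable lebesgue" by (rule Lp_measurable(2)[OF VL])
  have wV: "has_weak_deriv i V (weak_deriv i V)" "weak_deriv i V \<in> Lp_loc (D / 4)" if i: "i \<in> Basis" for i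
  proof -
    obtain g where g: "g \<in> Lp_loc (D / 4)" "has_weak_deriv i V g" using V i by (auto simp: W1_loc_def)
    show 1: "has_weak_deriv i V (weak_deriv i V)" by (rule has_weak_deriv_weak_deriv[OF g(2)])
    show "weak_deriv i V \<in> Lp_loc (D / 4)"
    proof (rule Lp_loc_cong[OF g(1)])
      show "weak_deriv i V \<in> borel_measurable lebesgue" using 1 by (simp add: has_weak_deriv_def Lp_loc_def)
      show "AE x in lborel. g x = weak_deriv i V x" by (rule weak_deriv_unique_real[OF g(2) 1 i]) simp
    qed
  qed
  have u: "u \<in> H2" using eig by (simp add: eigenfunction_def)
  have u2: "u \<in> Lp 2" using u by (simp add: H2_def)
  have um: "u \<in> borel_measurable lebesgue" by (rule Lp_measurable(1)[OF u2])
  define g where "g i = weak_deriv i u" for i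
  define h where "h i j = weak_deriv j (weak_deriv i u)" for i j
  have gw: "has_weak_deriv i u (g i)" "g i \<in> Lp 2" if "i \<in> Basis" for i
    unfolding g_def using H2_weak_derivs(1,2)[OF u that] by auto
  have hw: "has_weak_deriv j (g i) (h i j)" "h i j \<in> Lp 2" if "i \<in> Basis" "j \<in> Basis" for i j
    unfolding g_def h_def using H2_weak_derivs(3,4)[OF u that] by auto
  have lapu: "weak_laplacian u x = (\<Sum>i\<in>Basis. h i i x)" for x by (simp add: weak_laplacian_def h_def)
  define r where "r Q = borel_version (\<lambda>x. Q (u x))" for Q :: "complex \<Rightarrow> real"
  define d where "d Q i = borel_version (\<lambda>x. Q (g i x))" for Q :: "complex \<Rightarrow> real" and i
  define dd where "dd Q i j = borel_version (\<lambda>x. Q (h i j x))" for Q :: "complex \<Rightarrow> real" and i j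
  define L where "L Q x = (\<Sum>i\<in>Basis. dd Q i i x)" for Q x
  define V' where "V' = borel_version V"
  define dV where "dV i = borel_version (weak_deriv i V)" for i
  have BL: "bounded_linear Q" if "Q = Re \<or> Q = Im" for Q using that bounded_linear_Re bounded_linear_Im by auto
  \<comment> \<open>Established for both parts and not only for \<open>P\<close>, since splitting a
    complex integral needs both parts integrable.\<close>
  have set: "sobolev_setting V' (r Q) (L Q) (d Q) dV (dd Q) D (2 * D / (D - 2)) (2 * D / (D + 2)) (2 * D / (D - 4))"
    if "Q = Re \<or> Q = Im" for Q
  proof
    note Q = BL[OF that]
    fix i j :: 'a assume i: "i \<in> Basis"
    show "wd i (r Q) (d Q i)" unfolding r_def d_def
      by (rule has_weak_deriv_wd[OF has_weak_deriv_linear[OF Q gw(1)[OF i] i] i])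
    show "integrable lborel (\<lambda>x. (d Q i x)\<^sup>2)" unfolding d_def
      by (intro Lp2_square_integrable Lp_linear[OF Q] gw i) simp
    show "wd i V' (dV i)" unfolding V'_def dV_def by (rule has_weak_deriv_wd[OF wV(1)[OF i] i])
    show "locp (D / 4) (dV i)" unfolding dV_def by (rule Lp_loc_locp[OF wV(2)[OF i]])
    assume j: "j \<in> Basis"
    show "wd j (d Q i) (dd Q i j)" unfolding d_def dd_def
      by (rule has_weak_deriv_wd[OF has_weak_deriv_linear[OF Q hw(1)[OF i j] j] j])
    show "integrable lborel (\<lambda>x. (dd Q i j x)\<^sup>2)" unfolding dd_def
      by (intro Lp2_square_integrable Lp_linear[OF Q] hw i j) simp
  next
    show "integrable lborel (\<lambda>x. (r Q x)\<^sup>2)" unfolding r_def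
      by (intro Lp2_square_integrable Lp_linear[OF BL[OF that]] u2) simp
    show "locp (D / 4) V'" unfolding V'_def by (rule Lp_loc_locp[OF VL])
  qed (use D in \<open>auto simp: L_def\<close>)
  have Qm: "(\<lambda>x. Q (f x)) \<in> borel_measurable lebesgue" if "Q = Re \<or> Q = Im" "f \<in> borel_measurable lebesgue"
    for Q and f :: "'a \<Rightarrow> complex" by (rule bounded_linear_measurable[OF BL[OF that(1)] that(2)])
  have hm: "h i j \<in> borel_measurable lebesgue" if "i \<in> Basis" "j \<in> Basis" for i j
    by (rule Lp_measurable(1)[OF hw(2)[OF that]])
  have rAE: "AE x in lborel. Q (u x) = r Q x" if "Q = Re \<or> Q = Im" for Q
    unfolding r_def by (rule bv(2)[OF Qm[OF that um]])
  have LAE: "AE x in lborel. Q (weak_laplacian u x) = L Q x" if Q: "Q = Re \<or> Q = Im" for Q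
  proof -
    have "AE x in lborel. Q (h i i x) = dd Q i i x" if "i \<in> Basis" for i
      unfolding dd_def by (rule bv(2)[OF Qm[OF Q hm[OF that that]]])
    then have "AE x in lborel. \<forall>i\<in>Basis. Q (h i i x) = dd Q i i x" by (subst AE_finite_all) auto
    then show ?thesis
      by eventually_elim (simp add: lapu L_def linear_sum[OF bounded_linear.linear[OF BL[OF Q]]])
  qed
  have VAE: "AE x in lborel. V x = V' x" unfolding V'_def by (rule bv(2)[OF Vm])
  have rm: "r Q \<in> borel_measurable borel" if "Q = Re \<or> Q = Im" for Q
    unfolding r_def by (rule bv(1)[OF Qm[OF that um]])
  have Lm: "L Q \<in> borel_measurable borel" if "Q = Re \<or> Q = Im" for Q
    by (rule sobolev_setting.L_measurable[OF set[OF that]])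
  have V'm: "V' \<in> borel_measurable borel" unfolding V'_def by (rule bv(1)[OF Vm])
  have lapm: "weak_laplacian u \<in> borel_measurable lebesgue"
    unfolding lapu[abs_def] by (intro borel_measurable_sum hm)
  \<comment> \<open>Real and imaginary part separately: the coefficients are real, so each solves the equation.\<close>
  have part: "integrable lebesgue (\<lambda>x. \<phi> x *\<^sub>R f x)"
      "Q (LINT x|lebesgue. \<phi> x *\<^sub>R f x) = (LINT x|lborel. f' Q x * \<phi> x)"
    if \<phi>: "test \<phi>" and f: "f \<in> borel_measurable lebesgue"
      and f': "\<And>Q. Q = Re \<or> Q = Im \<Longrightarrow> loc1 (f' Q)" "\<And>Q. Q = Re \<or> Q = Im \<Longrightarrow> AE x in lborel. Q (f x) = f' Q x"
      and Q: "Q = Re \<or> Q = Im" for \<phi> and f :: "'a \<Rightarrow> complex" and f' Q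
  proof -
    have m: "\<phi> \<in> borel_measurable lebesgue" by (rule smooth_measurable_lebesgue[OF test_smooth[OF \<phi>]])
    have m': "\<phi> \<in> borel_measurable borel" by (rule smooth_measurable[OF test_smooth[OF \<phi>]])
    have e: "(LINT x|lebesgue. Q (\<phi> x *\<^sub>R f x)) = (LINT x|lborel. f' Q x * \<phi> x)"
      "integrable lebesgue (\<lambda>x. Q (\<phi> x *\<^sub>R f x))" if Q: "Q = Re \<or> Q = Im" for Q
    proof -
      have 1: "(\<lambda>x. Q (\<phi> x *\<^sub>R f x)) \<in> borel_measurable lebesgue"
        by (intro Qm[OF Q] borel_measurable_scaleR m f)
      have 2: "(\<lambda>x. f' Q x * \<phi> x) \<in> borel_measurable borel"
        by (intro borel_measurable_times loc1_measurable f'(1) Q m')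
      have 3: "AE x in lborel. Q (\<phi> x *\<^sub>R f x) = f' Q x * \<phi> x"
        using f'(2)[OF Q] by eventually_elim (use Q in auto)
      show "(LINT x|lebesgue. Q (\<phi> x *\<^sub>R f x)) = (LINT x|lborel. f' Q x * \<phi> x)" by (rule lebesgue_to_lborel(1)[OF 1 2 3])
      have "integrable lborel (\<lambda>x. f' Q x * \<phi> x)"
        using test_integrable_loc1[OF \<phi> f'(1)[OF Q]] by (simp add: mult.commute)
      then show "integrable lebesgue (\<lambda>x. Q (\<phi> x *\<^sub>R f x))" by (rule iffD2[OF lebesgue_to_lborel(2)[OF 1 2 3]])
    qed
    show i: "integrable lebesgue (\<lambda>x. \<phi> x *\<^sub>R f x)"
      by (rule complex_integrable_parts) (use e(2)[of Re] e(2)[of Im] in auto)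
    show "Q (LINT x|lebesgue. \<phi> x *\<^sub>R f x) = (LINT x|lborel. f' Q x * \<phi> x)"
      using integral_bounded_linear[OF BL[OF Q] i] e(1)[OF Q] by simp
  qed
  \<comment> \<open>For real test functions the conjugation disappears, and \<open>P\<close> passes
    through the equation because \<open>V\<close> and \<open>z\<close> are real.\<close>
  have eq: "(LINT x|lborel. L P x * lap \<phi> x) + (LINT x|lborel. (V' x * r P x) * \<phi> x) = z * (LINT x|lborel. r P x * \<phi> x)"
    if \<phi>: "test \<phi>" for \<phi>
  proof -
    let ?v = "\<lambda>x. complex_of_real (\<phi> x)"
    have 1: "(LINT x|lebesgue. weak_laplacian u x * cnj (weak_laplacian ?v x)) = (LINT x|lebesgue. lap \<phi> x *\<^sub>R weak_laplacian u x)"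
    proof (rule integral_cong_AE)
      have ae: "AE x in lebesgue. weak_laplacian ?v x = complex_of_real (lap \<phi> x)"
        by (rule AE_completion[OF test_in_H2(2)[OF \<phi>]])
      then show "AE x in lebesgue. weak_laplacian u x * cnj (weak_laplacian ?v x) = lap \<phi> x *\<^sub>R weak_laplacian u x"
        by eventually_elim (simp add: scaleR_conv_of_real mult.commute)
      have lm: "lap \<phi> \<in> borel_measurable lebesgue" by (rule smooth_measurable_lebesgue[OF test_smooth[OF test_lap[OF \<phi>]]])
      show "(\<lambda>x. lap \<phi> x *\<^sub>R weak_laplacian u x) \<in> borel_measurable lebesgue"
        by (intro borel_measurable_scaleR lm lapm)
      have "(\<lambda>x. complex_of_real (lap \<phi> x)) \<in> borel_measurable lebesgue"
        by (rule bounded_linear_measurable[OF bounded_linear_of_real lm])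
      then have "weak_laplacian ?v \<in> borel_measurable lebesgue"
        by (rule borel_measurable_AE) (use ae in \<open>auto elim: eventually_mono\<close>)
      then show "(\<lambda>x. weak_laplacian u x * cnj (weak_laplacian ?v x)) \<in> borel_measurable lebesgue"
        using lapm by (intro borel_measurable_times bounded_linear_measurable[OF bounded_linear_cnj])
    qed
    have 2: "(LINT x|lebesgue. complex_of_real (V x) * u x * cnj (?v x)) = (LINT x|lebesgue. \<phi> x *\<^sub>R (complex_of_real (V x) * u x))"
      by (intro Bochner_Integration.integral_cong refl) (simp add: scaleR_conv_of_real mult_ac)
    have 3: "(LINT x|lebesgue. u x * cnj (?v x)) = (LINT x|lebesgue. \<phi> x *\<^sub>R u x)"
      by (intro Bochner_Integration.integral_cong refl) (simp add: scaleR_conv_of_real mult_ac)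
    have "(LINT x|lebesgue. lap \<phi> x *\<^sub>R weak_laplacian u x) + (LINT x|lebesgue. \<phi> x *\<^sub>R (complex_of_real (V x) * u x))
      = z *\<^sub>R (LINT x|lebesgue. \<phi> x *\<^sub>R u x)"
      unfolding scaleR_conv_of_real[of z]
      using eig[unfolded eigenfunction_def, THEN conjunct2, THEN conjunct2, rule_format, OF test_in_H2(1,3)[OF \<phi>]]
      unfolding 1 2 3 .
    then have "P ((LINT x|lebesgue. lap \<phi> x *\<^sub>R weak_laplacian u x) + (LINT x|lebesgue. \<phi> x *\<^sub>R (complex_of_real (V x) * u x)))
      = P (z *\<^sub>R (LINT x|lebesgue. \<phi> x *\<^sub>R u x))" by (rule arg_cong)
    then have "P (LINT x|lebesgue. lap \<phi> x *\<^sub>R weak_laplacian u x) + P (LINT x|lebesgue. \<phi> x *\<^sub>R (complex_of_real (V x) * u x))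
      = z * P (LINT x|lebesgue. \<phi> x *\<^sub>R u x)"
      unfolding linear_add[OF bounded_linear.linear[OF BL[OF P]]] linear_scale[OF bounded_linear.linear[OF BL[OF P]]] real_scaleR_def .
    moreover have "P (LINT x|lebesgue. lap \<phi> x *\<^sub>R weak_laplacian u x) = (LINT x|lborel. L P x * lap \<phi> x)"
      by (rule part(2)[OF test_lap[OF \<phi>] lapm sobolev_setting.L_loc1[OF set] LAE P])
    moreover have "P (LINT x|lebesgue. \<phi> x *\<^sub>R (complex_of_real (V x) * u x)) = (LINT x|lborel. (V' x * r P x) * \<phi> x)"
    proof (rule part(2)[OF \<phi> _ sobolev_setting.Vr_loc1[OF set] _ P])
      show "(\<lambda>x. complex_of_real (V x) * u x) \<in> borel_measurable lebesgue"
        by (intro borel_measurable_times um bounded_linear_measurable[OF bounded_linear_of_real Vm])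
      show "AE x in lborel. Q (complex_of_real (V x) * u x) = V' x * r Q x" if "Q = Re \<or> Q = Im" for Q
        using VAE rAE[OF that] by eventually_elim (use that in auto)
    qed
    moreover have "P (LINT x|lebesgue. \<phi> x *\<^sub>R u x) = (LINT x|lborel. r P x * \<phi> x)"
      by (rule part(2)[OF \<phi> um sobolev_setting.loc1s(1)[OF set] rAE P])
    ultimately show ?thesis by simp
  qed
  have hardy': "(\<integral>\<^sup>+x. ennreal (max (\<Sum>i\<in>Basis. (x \<bullet> i) * dV i x) 0 * (r P x)\<^sup>2) \<partial>lborel)
        \<le> ennreal (4 * a * (LINT x|lborel. (L P x)\<^sup>2))"
  proof -
    \<comment> \<open>The assumed inequality is applied to the single component, regarded again as a
      complex function, so that its right-hand side contains \<open>L P\<close> alone.\<close>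
    let ?T = "\<lambda>w. complex_of_real (P w)"
    have T: "bounded_linear ?T" using bounded_linear_compose[OF bounded_linear_of_real BL[OF P]] by (simp add: o_def)
    let ?\<psi> = "\<lambda>x. ?T (u x)"
    have w1: "has_weak_deriv i ?\<psi> (\<lambda>x. ?T (g i x))" if "i \<in> Basis" for i
      by (intro has_weak_deriv_linear[OF T] gw that)
    have w2: "has_weak_deriv j (\<lambda>x. ?T (g i x)) (\<lambda>x. ?T (h i j x))" if "i \<in> Basis" "j \<in> Basis" for i j
      by (intro has_weak_deriv_linear[OF T] hw that)
    have "?\<psi> \<in> H2"
      by (rule H2I[OF _ w1 _ w2]) (auto intro!: Lp_linear[OF T] u2 gw hw)
    from hardy[OF this] have "ennreal (1/4) * (\<integral>\<^sup>+x. ennreal (max (x \<bullet> weak_grad V x) 0 * (norm (?\<psi> x))\<^sup>2) \<partial>lborel)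
             \<le> ennreal a * (\<integral>\<^sup>+x. ennreal ((norm (weak_laplacian ?\<psi> x))\<^sup>2) \<partial>lborel)"
      by (simp only: nn_integral_completion)
    moreover have "(\<integral>\<^sup>+x. ennreal ((norm (weak_laplacian ?\<psi> x))\<^sup>2) \<partial>lborel) = ennreal (LINT x|lborel. (L P x)\<^sup>2)"
    proof -
      have "AE x in lborel. weak_laplacian ?\<psi> x = (\<Sum>i\<in>Basis. ?T (h i i x))" by (rule weak_laplacian_AE[OF w1 w2])
      then have "AE x in lborel. ennreal ((norm (weak_laplacian ?\<psi> x))\<^sup>2) = ennreal ((L P x)\<^sup>2)"
        using LAE[OF P]
      proof eventually_elim
        case (elim x)
        have "(\<Sum>i\<in>Basis. ?T (h i i x)) = ?T (weak_laplacian u x)"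
          unfolding lapu by (rule linear_sum[OF bounded_linear.linear[OF T], symmetric])
        then show ?case using elim by simp
      qed
      then have "(\<integral>\<^sup>+x. ennreal ((norm (weak_laplacian ?\<psi> x))\<^sup>2) \<partial>lborel) = (\<integral>\<^sup>+x. ennreal ((L P x)\<^sup>2) \<partial>lborel)"
        by (rule nn_integral_cong_AE)
      also have "\<dots> = ennreal (LINT x|lborel. (L P x)\<^sup>2)"
        by (rule nn_integral_eq_integral[OF sobolev_setting.L_sq[OF set[OF P]]]) simp
      finally show ?thesis .
    qed
    moreover have "(\<integral>\<^sup>+x. ennreal (max (x \<bullet> weak_grad V x) 0 * (norm (?\<psi> x))\<^sup>2) \<partial>lborel)
      = (\<integral>\<^sup>+x. ennreal (max (\<Sum>i\<in>Basis. (x \<bullet> i) * dV i x) 0 * (r P x)\<^sup>2) \<partial>lborel)"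
    proof (rule nn_integral_cong_AE)
      have "AE x in lborel. weak_deriv i V x = dV i x" if "i \<in> Basis" for i
        unfolding dV_def by (rule bv(2)[OF Lp_measurable(2)[OF wV(2)[OF that]]])
      then have "AE x in lborel. \<forall>i\<in>Basis. weak_deriv i V x = dV i x" by (subst AE_finite_all) auto
      then show "AE x in lborel. ennreal (max (x \<bullet> weak_grad V x) 0 * (norm (?\<psi> x))\<^sup>2)
        = ennreal (max (\<Sum>i\<in>Basis. (x \<bullet> i) * dV i x) 0 * (r P x)\<^sup>2)"
        using rAE[OF P] by eventually_elim (simp add: weak_grad_def inner_sum_right mult.commute)
    qed
    ultimately have "ennreal (1/4) * (\<integral>\<^sup>+x. ennreal (max (\<Sum>i\<in>Basis. (x \<bullet> i) * dV i x) 0 * (r P x)\<^sup>2) \<partial>lborel)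
        \<le> ennreal a * ennreal (LINT x|lborel. (L P x)\<^sup>2)" by simp
    then have "ennreal 4 * (ennreal (1/4) * (\<integral>\<^sup>+x. ennreal (max (\<Sum>i\<in>Basis. (x \<bullet> i) * dV i x) 0 * (r P x)\<^sup>2) \<partial>lborel))
        \<le> ennreal 4 * (ennreal a * ennreal (LINT x|lborel. (L P x)\<^sup>2))" by (rule mult_left_mono) simp
    moreover have "ennreal 4 * (ennreal (1/4) * X) = X" for X
      unfolding mult.assoc[symmetric] by (subst ennreal_mult[symmetric]) auto
    moreover have "ennreal 4 * (ennreal a * ennreal (LINT x|lborel. (L P x)\<^sup>2)) = ennreal (4 * a * (LINT x|lborel. (L P x)\<^sup>2))"
      using a by (simp add: ennreal_mult mult.assoc)
    ultimately show ?thesis by simp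
  qed
  interpret S: sobolev_setting V' "r P" "L P" "d P" dV "dd P" D "2 * D / (D - 2)" "2 * D / (D + 2)" "2 * D / (D - 4)"
    by (rule set[OF P])
  interpret virial V' "r P" "L P" "d P" dV "dd P" D "2 * D / (D - 2)" "2 * D / (D + 2)" "2 * D / (D - 4)" z a
    by unfold_locales (use eq a hardy' in auto)
  show ?thesis using rAE[OF P] r_zero by eventually_elim simp
qed

theorem theorem1p5:
  fixes V :: "real ^ 'd \<Rightarrow> real" and a :: real
  assumes "CARD('d) \<ge> 5"
    and "V \<in> Lp_loc 1"
    and "(\<lambda>x. max (x \<bullet> weak_grad V x) 0) \<in> Lp_loc 1"
    and "0 \<le> a" and "a < 1"
    and "\<And>\<psi> :: real ^ 'd \<Rightarrow> complex. \<psi> \<in> H2 \<Longrightarrow>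
           ennreal (1/4) * (\<integral>\<^sup>+x. ennreal (max (x \<bullet> weak_grad V x) 0 * (norm (\<psi> x))\<^sup>2) \<partial>lebesgue)
             \<le> ennreal a * (\<integral>\<^sup>+x. ennreal ((norm (weak_laplacian \<psi> x))\<^sup>2) \<partial>lebesgue)"
    and "V \<in> W1_loc (real CARD('d) / 4)"
  shows "point_spectrum V = {}"
proof (rule ccontr)
  assume "point_spectrum V \<noteq> {}"
  then obtain z u where eig: "eigenfunction V z u" by (auto simp: point_spectrum_def)
  have zero: "AE x in lborel. P (u x) = 0" if "P = Re \<or> P = Im" for P
    by (rule eigenfunction_component_zero[OF _ _ assms(4,5,6,7) eig that]) (use assms(1) in simp_all)
  have "AE x in lborel. u x = 0"
    using zero[OF disjI1, OF refl] zero[OF disjI2, OF refl]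
    by eventually_elim (simp add: complex_eq_iff)
  then have "AE x in lebesgue. u x = 0" by (rule AE_completion)
  then show False using eig by (simp add: eigenfunction_def)
qed

end
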